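(* Let $P$ be a locally finite geometric lattice (hence finite) with unique maximum $\mathbf 1$ and at least two elements, and let $Q=P\setminus\{\mathbf 1\}$. Let $|\cdot|$ be the corank function of $Q$, let $\mu$ be the Möbius function of $P$, and for $x\in Q$ put $\mu_x=(-1)^{|x|-1}\mu(x,\mathbf 1)$. Then $Q$ is cellular, and for every presheaf $F$ on $Q$ and every $n\ge 0$ $$C^n(Q;F)\cong\bigoplus_{|x|=n}A_x\otimes F(x)\quad\text{with }A_x\cong\mathbb Z^{\mu_x}\text{ for every }x\in Q.$$ In particular $HS^*(Q;F)\cong HC^*(Q;F)$ for every presheaf $F$ on $Q$.
   Context: Geometric lattices. A lattice is a poset in which any two elements $x,y$ have a join $x\vee y$ and a meet $x\wedge y$. It has finite length if there is an absolute bound on the number of elements in any chain. If $P$ has finite length and unique minimum $\mathbf 0$, $\mathrm{rk}(x)$ is the supremum of the lengths of all chains from $\mathbf 0$ to $x$. Such a $P$ is a geometric lattice if every element is a join of elements of rank $1$ and $\mathrm{rk}(x\vee y)+\mathrm{rk}(x\wedge y)\le\mathrm{rk}(x)+\mathrm{rk}(y)$ for all $x,y$; $\mathrm{rk}$ is then a rank function. The Möbius function is given by $\mu(x,x)=1$ and $\mu(x,y)=-\sum_{x\le z<y}\mu(x,z)$ for $x<y$. Graded posets. $x\prec y$ means $x<y$ with nothing strictly between. A poset is graded if there is $\mathrm{rk}$ to $\mathbb Z$ such that $x<y$ implies $\mathrm{rk}(x)<\mathrm{rk}(y)$ and $x\prec y$ implies $\mathrm{rk}(y)=\mathrm{rk}(x)+1$;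 if $\mathrm{rk}$ is bounded above with maximum $r$, the corank is $|x|=r-\mathrm{rk}(x)$ (so for $Q$ the maximal elements have corank $0$). $Q^k=\{x\in Q:|x|\le k\}$, $Q_{\ge x}=\{y\in Q:y\ge x\}$. A poset is locally finite if each $x$ has only finitely many $y$ with $x\prec y$. Presheaves and cochains. A presheaf on a poset $Q$ (viewed as a category with a unique morphism $x\to y$ iff $x\le y$) is a functor $F:Q^{\mathrm{op}}\to\mathbf{Ab}$; write $F^y_x:F(y)\to F(x)$ for the map induced by $x\le y$. Presheaves restrict to subposets. $N^nQ$ is the set of $n$-simplices $\sigma=(\sigma_n\le\cdots\le\sigma_0)$, $N^n_\circ Q$ the subset of non-degenerate ones $\sigma_n<\cdots<\sigma_0$; the face map $d_i$ deletes $\sigma_i$. $S^n(Q;F)=\prod_{\sigma\in N^nQ}F(\sigma_n)$, with $\sigma$-component of $s$ written $s\cdot\sigma$, and $$ds\cdot\sigma=\sum_{i=0}^{n-1}(-1)^i s\cdot d_i\sigma+(-1)^nF^{\sigma_{n-1}}_{\sigma_n}(s\cdot d_n\sigma).$$ $HS^*(Q;F)=H(S^*(Q;F),d)$, which is the higher limits $\varprojlim_Q^*F$; $S^*(\varnothing;F)=0$. For a subposet $R\subseteq Q$, $S^*(Q,R;F)$ is the kernel of the restriction $S^*(Q;F)\to S^*(R;F)$ and $HS^*(Q,R;F)$ is its cohomology. Cellular cohomology. $C^n(Q;F)=HS^n(Q^n,Q^{n-1};F)$, with $\delta:C^{n-1}\to C^n$ the connecting homomorphism of $0\to S^*(Q^n,Q^{n-1};F)\to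 S^*(Q^n,Q^{n-2};F)\to S^*(Q^{n-1},Q^{n-2};F)\to0$; $HC^*(Q;F)=H(C^*(Q;F),\delta)$. $Q$ is cellular if for every presheaf $F$ and every $n$, $HS^i(Q^n,Q^{n-1};F)=0$ for all $i\ne n$. The group $A_x$. For $x\in Q$ with $|x|=n$, elements of $N^n_\circ Q_{\ge x}$ have the form $x\sigma_{n-1}\cdots\sigma_0$ with $|\sigma_i|=i$. For $\tau=x\tau_{n-1}\cdots\tau_{j+1}\tau_{j-1}\cdots\tau_0\in N^{n-1}_\circ Q_{\ge x}$ with $0\le j<n$, $|\tau_i|=i$, let $B_\tau$ be the set of all $x\tau_{n-1}\cdots\tau_{j+1}\,y\,\tau_{j-1}\cdots\tau_0\in N^n_\circ Q_{\ge x}$. $A_x$ is the abelian group with generators $N^n_\circ Q_{\ge x}$ and relations $\sum_{\sigma\in B_\tau}\sigma=0$ for all such $\tau$. *)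

theory Defs
  imports "HOL-Algebra.Algebra" "HOL-Library.Lub_Glb"
begin

section \<open>Posets and geometric lattices\<close>

text \<open>
  Posets are subsets of a type of class \<open>order\<close> with the induced order. A bounded lattice is
  a type of class \<open>bounded_lattice\<close>.
\<close>

definition finite_length :: "'a::order set \<Rightarrow> bool" where
  "finite_length P \<longleftrightarrow>
     (\<exists>N::nat. \<forall>C\<subseteq>P. Complete_Partial_Order.chain (\<le>) C \<longrightarrow> finite C \<and> card C \<le> N)"

definition covers :: "'a::order set \<Rightarrow> 'a \<Rightarrow> 'a \<Rightarrow> bool" where
  "covers P x y \<longleftrightarrow> x \<in> P \<and> y \<in> P \<and> x < y \<and> \<not> (\<exists>z\<in>P. x < z \<and> z < y)"

definition locally_finite :: "'a::order set \<Rightarrow> bool" where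
  "locally_finite P \<longleftrightarrow> (\<forall>x\<in>P. finite {y. covers P x y})"

text \<open>
  The length of a finite chain is its number of elements minus one. The supremum is meant for
  posets of finite length, where it is a maximum.
\<close>

definition lattice_rank :: "'a::bounded_lattice \<Rightarrow> int" where
  "lattice_rank x = (SUP C \<in> {C. finite C \<and> Complete_Partial_Order.chain (\<le>) C \<and> bot \<in> C \<and> x \<in> C \<and> C \<subseteq> {bot..x}}.
     int (card C) - 1)"

definition geometric_lattice :: "'a::bounded_lattice itself \<Rightarrow> bool" where
  "geometric_lattice T \<longleftrightarrow>
     finite_length (UNIV :: 'a set) \<and>
     (\<forall>x::'a. \<exists>A \<subseteq> {a. lattice_rank a = 1}. isLub UNIV A x) \<and>
     (\<forall>x y::'a. lattice_rank (sup x y) + lattice_rank (inf x y) \<le> lattice_rank x + lattice_rank y)"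

text \<open>The values \<open>0\<close> off the order relation and on infinite intervals are junk values.\<close>

function moebius :: "'a::order \<Rightarrow> 'a \<Rightarrow> int" where
  "moebius x y =
     (if x = y then 1
      else if x < y \<and> finite {x..y} then - (\<Sum>z\<in>{x..<y}. moebius x z)
      else 0)"
  by pat_completeness auto
termination
proof (relation "measure (\<lambda>(x, y). card {x..y})")
  fix x y z :: 'a
  assume "x \<noteq> y" "x < y \<and> finite {x..y}" "z \<in> {x..<y}"
  then have "{x..z} \<subset> {x..y}" by auto
  with \<open>x < y \<and> finite {x..y}\<close> show "((x, z), (x, y)) \<in> measure (\<lambda>(x, y). card {x..y})"
    by (simp add: psubset_card_mono)
qed simp

declare moebius.simps [simp del]

section \<open>Graded posets\<close>

definition graded :: "'a::order set \<Rightarrow> ('a \<Rightarrow> int) \<Rightarrow> bool" where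
  "graded Q rk \<longleftrightarrow>
     (\<forall>x\<in>Q. \<forall>y\<in>Q. (x < y \<longrightarrow> rk x < rk y) \<and> (covers Q x y \<longrightarrow> rk y = rk x + 1))"

definition corank :: "'a set \<Rightarrow> ('a \<Rightarrow> int) \<Rightarrow> 'a \<Rightarrow> int" where
  "corank Q rk x = Sup (rk ` Q) - rk x"

text \<open>The index is an integer, so that \<open>skeleton Q rk (-1)\<close> is empty.\<close>

definition skeleton :: "'a set \<Rightarrow> ('a \<Rightarrow> int) \<Rightarrow> int \<Rightarrow> 'a set" where
  "skeleton Q rk k = {x \<in> Q. corank Q rk x \<le> k}"

definition up_set :: "'a::order set \<Rightarrow> 'a \<Rightarrow> 'a set" where
  "up_set Q x = {y \<in> Q. x \<le> y}"

section \<open>Presheaves and cochains\<close>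

text \<open>
  Abelian groups are the (multiplicatively written) commutative groups of \<open>HOL-Algebra\<close>.
  \<open>res F y x\<close> is the map from \<open>sec F y\<close> to \<open>sec F x\<close> induced by \<open>x \<le> y\<close>.
\<close>

record ('a, 'b) presheaf =
  sec :: "'a \<Rightarrow> 'b monoid"
  res :: "'a \<Rightarrow> 'a \<Rightarrow> 'b \<Rightarrow> 'b"

definition is_presheaf :: "'a::order set \<Rightarrow> ('a, 'b) presheaf \<Rightarrow> bool" where
  "is_presheaf Q F \<longleftrightarrow>
     (\<forall>x\<in>Q. comm_group (sec F x)) \<and>
     (\<forall>x\<in>Q. \<forall>y\<in>Q. x \<le> y \<longrightarrow> res F y x \<in> hom (sec F y) (sec F x)) \<and>
     (\<forall>x\<in>Q. \<forall>a\<in>carrier (sec F x). res F x x a = a) \<and>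
     (\<forall>x\<in>Q. \<forall>y\<in>Q. \<forall>z\<in>Q. x \<le> y \<longrightarrow> y \<le> z \<longrightarrow>
        (\<forall>a\<in>carrier (sec F z). res F z x a = res F y x (res F z y a)))"

text \<open>
  The simplex \<open>\<sigma>\<^sub>n \<le> \<dots> \<le> \<sigma>\<^sub>0\<close> is the list with \<open>\<sigma> ! i = \<sigma>\<^sub>i\<close>, so it is written in descending order.
\<close>

definition simplices :: "'a::order set \<Rightarrow> nat \<Rightarrow> 'a list set" where
  "simplices Q n = {\<sigma>. length \<sigma> = Suc n \<and> set \<sigma> \<subseteq> Q \<and> sorted_wrt (\<ge>) \<sigma>}"

definition nd_simplices :: "'a::order set \<Rightarrow> nat \<Rightarrow> 'a list set" where
  "nd_simplices Q n = {\<sigma>. length \<sigma> = Suc n \<and> set \<sigma> \<subseteq> Q \<and> sorted_wrt (>) \<sigma>}"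

definition face :: "nat \<Rightarrow> 'a list \<Rightarrow> 'a list" where
  "face i \<sigma> = take i \<sigma> @ drop (Suc i) \<sigma>"

definition cochains :: "'a::order set \<Rightarrow> ('a, 'b) presheaf \<Rightarrow> nat \<Rightarrow> ('a list \<Rightarrow> 'b) monoid" where
  "cochains Q F n = product_group (simplices Q n) (\<lambda>\<sigma>. sec F (\<sigma> ! n))"

definition differential ::
  "'a::order set \<Rightarrow> ('a, 'b) presheaf \<Rightarrow> nat \<Rightarrow> ('a list \<Rightarrow> 'b) \<Rightarrow> 'a list \<Rightarrow> 'b" where
  "differential Q F n s =
     (\<lambda>\<sigma>\<in>simplices Q (Suc n). let G = sec F (\<sigma> ! Suc n) in
        (\<Otimes>\<^bsub>G\<^esub>i\<in>{0..n}. s (face i \<sigma>) [^]\<^bsub>G\<^esub> ((-1) ^ i :: int))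
        \<otimes>\<^bsub>G\<^esub> res F (\<sigma> ! n) (\<sigma> ! Suc n) (s (face (Suc n) \<sigma>)) [^]\<^bsub>G\<^esub> ((-1) ^ Suc n :: int))"

definition rel_cochains ::
  "'a::order set \<Rightarrow> 'a set \<Rightarrow> ('a, 'b) presheaf \<Rightarrow> nat \<Rightarrow> ('a list \<Rightarrow> 'b) monoid" where
  "rel_cochains Q R F n =
     (cochains Q F n)
       \<lparr>carrier := kernel (cochains Q F n) (cochains R F n) (\<lambda>s. restrict s (simplices R n))\<rparr>"

section \<open>Cohomology of cochain complexes concentrated in degrees at least zero\<close>

definition cocycles :: "(nat \<Rightarrow> 'c monoid) \<Rightarrow> (nat \<Rightarrow> 'c \<Rightarrow> 'c) \<Rightarrow> nat \<Rightarrow> 'c set" where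
  "cocycles K d n = kernel (K n) (K (Suc n)) (d n)"

definition coboundaries :: "(nat \<Rightarrow> 'c monoid) \<Rightarrow> (nat \<Rightarrow> 'c \<Rightarrow> 'c) \<Rightarrow> nat \<Rightarrow> 'c set" where
  "coboundaries K d n = (case n of 0 \<Rightarrow> {\<one>\<^bsub>K 0\<^esub>} | Suc m \<Rightarrow> d m ` carrier (K m))"

definition cohomology :: "(nat \<Rightarrow> 'c monoid) \<Rightarrow> (nat \<Rightarrow> 'c \<Rightarrow> 'c) \<Rightarrow> nat \<Rightarrow> 'c set monoid" where
  "cohomology K d n = (K n)\<lparr>carrier := cocycles K d n\<rparr> Mod coboundaries K d n"

text \<open>
  The connecting homomorphism from degree \<open>n\<close> to degree \<open>Suc n\<close> of a short exact sequence
  \<open>0 \<rightarrow> A \<rightarrow> B \<rightarrow> C \<rightarrow> 0\<close>, where \<open>A\<close> is a subcomplex of \<open>(B, d)\<close> and \<open>q\<close> is the projection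
  onto \<open>C\<close>: a class \<open>c\<close> (a coset of cocycles of \<open>C\<close>) goes to the class of \<open>d b\<close>, for any \<open>b\<close>
  lifting a representative of \<open>c\<close>.
\<close>

definition connecting ::
  "(nat \<Rightarrow> 'c monoid) \<Rightarrow> (nat \<Rightarrow> 'c monoid) \<Rightarrow> (nat \<Rightarrow> 'c \<Rightarrow> 'c) \<Rightarrow> (nat \<Rightarrow> 'c \<Rightarrow> 'e) \<Rightarrow>
     nat \<Rightarrow> 'e set \<Rightarrow> 'c set" where
  "connecting A B d q n c =
     (THE k. \<exists>b\<in>carrier (B n). q n b \<in> c \<and>
        k = coboundaries A d (Suc n) #>\<^bsub>A (Suc n)\<^esub> d n b)"

definition HS ::
  "'a::order set \<Rightarrow> ('a, 'b) presheaf \<Rightarrow> nat \<Rightarrow> ('a list \<Rightarrow> 'b) set monoid" where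
  "HS Q F = cohomology (cochains Q F) (differential Q F)"

definition HS_rel ::
  "'a::order set \<Rightarrow> 'a set \<Rightarrow> ('a, 'b) presheaf \<Rightarrow> nat \<Rightarrow> ('a list \<Rightarrow> 'b) set monoid" where
  "HS_rel Q R F = cohomology (rel_cochains Q R F) (differential Q F)"

section \<open>Cellular cohomology\<close>

definition cell_cochains ::
  "'a::order set \<Rightarrow> ('a \<Rightarrow> int) \<Rightarrow> ('a, 'b) presheaf \<Rightarrow> nat \<Rightarrow> ('a list \<Rightarrow> 'b) set monoid" where
  "cell_cochains Q rk F n =
     HS_rel (skeleton Q rk (int n)) (skeleton Q rk (int n - 1)) F n"

definition cell_differential ::
  "'a::order set \<Rightarrow> ('a \<Rightarrow> int) \<Rightarrow> ('a, 'b) presheaf \<Rightarrow> nat \<Rightarrow>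
     ('a list \<Rightarrow> 'b) set \<Rightarrow> ('a list \<Rightarrow> 'b) set" where
  "cell_differential Q rk F n =
     connecting
       (rel_cochains (skeleton Q rk (int n + 1)) (skeleton Q rk (int n)) F)
       (rel_cochains (skeleton Q rk (int n + 1)) (skeleton Q rk (int n - 1)) F)
       (differential (skeleton Q rk (int n + 1)) F)
       (\<lambda>m s. restrict s (simplices (skeleton Q rk (int n)) m))
       n"

definition HC ::
  "'a::order set \<Rightarrow> ('a \<Rightarrow> int) \<Rightarrow> ('a, 'b) presheaf \<Rightarrow> nat \<Rightarrow> ('a list \<Rightarrow> 'b) set set monoid" where
  "HC Q rk F = cohomology (cell_cochains Q rk F) (cell_differential Q rk F)"

text \<open>
  Cellularity is a property of posets graded by a rank function that is bounded above. The type
  argument is the type carrying the values of the presheaves.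
\<close>

definition cellular :: "'b itself \<Rightarrow> 'a::order set \<Rightarrow> ('a \<Rightarrow> int) \<Rightarrow> bool" where
  "cellular T Q rk \<longleftrightarrow>
     graded Q rk \<and> bdd_above (rk ` Q) \<and>
     (\<forall>F :: ('a, 'b) presheaf. is_presheaf Q F \<longrightarrow>
        (\<forall>n i. i \<noteq> n \<longrightarrow>
           trivial_group (HS_rel (skeleton Q rk (int n)) (skeleton Q rk (int n - 1)) F i)))"

section \<open>The groups \<open>A\<^sub>x\<close> and tensor products\<close>

text \<open>
  A relation of \<open>A\<^sub>x\<close> is given by \<open>j < n\<close> and a chain \<open>\<tau>\<close> that has one element of each corank
  \<open>0, \<dots>, n\<close> except \<open>j\<close>, hence \<open>\<tau> ! i\<close> has corank \<open>i\<close> for \<open>i < j\<close> and corank \<open>i + 1\<close> otherwise.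
\<close>

definition A_relators :: "'a::order set \<Rightarrow> ('a \<Rightarrow> int) \<Rightarrow> 'a \<Rightarrow> ('a list \<Rightarrow>\<^sub>0 int) set" where
  "A_relators Q rk x =
     {\<Sum>\<sigma>\<in>{\<sigma> \<in> nd_simplices (up_set Q x) n. face j \<sigma> = \<tau>}. frag_of \<sigma> | n j \<tau>.
        int n = corank Q rk x \<and> j < n \<and>
        \<tau> \<in> nd_simplices (up_set Q x) (n - 1) \<and> last \<tau> = x \<and>
        (\<forall>i<n. corank Q rk (\<tau> ! i) = (if i < j then int i else int i + 1))}"

definition A_group :: "'a::order set \<Rightarrow> ('a \<Rightarrow> int) \<Rightarrow> 'a \<Rightarrow> ('a list \<Rightarrow>\<^sub>0 int) set monoid" where
  "A_group Q rk x =
     (let L = free_Abelian_group (nd_simplices (up_set Q x) (nat (corank Q rk x)))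
      in L Mod generate L (A_relators Q rk x))"

definition tensor_group :: "'c monoid \<Rightarrow> 'e monoid \<Rightarrow> (('c \<times> 'e) \<Rightarrow>\<^sub>0 int) set monoid" where
  "tensor_group G H =
     (let L = free_Abelian_group (carrier G \<times> carrier H)
      in L Mod generate L
        ({frag_of (g \<otimes>\<^bsub>G\<^esub> g', h) - frag_of (g, h) - frag_of (g', h) | g g' h.
            g \<in> carrier G \<and> g' \<in> carrier G \<and> h \<in> carrier H} \<union>
         {frag_of (g, h \<otimes>\<^bsub>H\<^esub> h') - frag_of (g, h) - frag_of (g, h') | g h h'.
            g \<in> carrier G \<and> h \<in> carrier H \<and> h' \<in> carrier H}))"

text \<open>
  \<open>(-1)\<close> to the power \<open>corank - 1\<close>, also for corank zero, is minus \<open>(-1)\<close> to the power \<open>corank\<close>.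
\<close>

definition mu_exponent :: "'a::bounded_lattice set \<Rightarrow> ('a \<Rightarrow> int) \<Rightarrow> 'a \<Rightarrow> int" where
  "mu_exponent Q rk x = - ((-1) ^ nat (corank Q rk x)) * moebius x Orderings.top"

end

theory Submission
  imports Defs
begin

text \<open>
  Write \<open>n\<close> for the corank of \<open>x\<close>. A relative cochain of two successive skeleta is a function on the
  simplices whose last (smallest) vertex has maximal corank, so the relative complex is a product
  over these vertices \<open>x\<close>, and the factor at \<open>x\<close> consists of cochains on the simplices ending in
  \<open>x\<close>, with values in the single group \<open>F(x)\<close>. Both cellularity and the description of the cells
  therefore follow from one statement about integral chains, which no longer mentions presheaves:
  the chain complex of simplices ending in \<open>x\<close>, modulo those that end elsewhere, has a contracting
  homotopy away from degree \<open>n\<close>, and its cycles in degree \<open>n\<close> are free on dual cycles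
  \<open>\<rho> b\<close>, indexed by a set \<open>B\<close> of top chains.

  That statement is proved for every interval \<open>[x, y]\<close> of a semimodular lattice by induction on its
  length (\<open>spherical_exists\<close>). Fix an atom \<open>a\<close> of the interval. The chains whose first entry \<open>z\<close>
  satisfies \<open>sup z a < y\<close> are contracted by the prism over \<open>z \<mapsto> sup z a\<close> (\<open>prism_homotopy\<close>).
  By semimodularity every other chain starts with a coatom \<open>c\<close> with \<open>sup c a = y\<close>, followed by a chain
  of the shorter interval \<open>[x, c]\<close>. So the cycles of \<open>[x, y]\<close> are the sum over these \<open>c\<close> of the cycles
  of \<open>[x, c]\<close>, and Weisner's theorem \<open>\<mu>(x, y) = - (\<Sum>c. \<mu>(x, c))\<close> counts them. Degenerate simplices
  are a direct summand with a contraction of its own (\<open>degen_homotopy\<close>).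

  A cochain extends to a homomorphism on chains (\<open>coeval\<close>), and the differential becomes
  precomposition with the boundary. The contraction then shows that a relative cocycle of degree
  different from \<open>n\<close> is a coboundary, and that one of degree \<open>n\<close> is determined modulo coboundaries by
  its values on the cycles \<open>\<rho> b\<close>, which can be prescribed (\<open>cell_iso\<close>). For the constant
  coefficients \<open>\<int>\<close> the same argument shows that \<open>A\<^sub>x\<close>, the cokernel of the transposed boundary, is
  free on \<open>B\<close> (\<open>A_group_free\<close>). A tensor product with a free group is a power of the other factor
  (\<open>tensor_free\<close>), which identifies the cells.

  Finally, once the relative cohomology of the skeleta is concentrated in the diagonal degrees, the
  cocycles that vanish on the skeleton below their degree map onto both cohomologies, with the same
  kernel (\<open>cohomology_iso_cellular\<close>).
\<close>

section \<open>Chains of lists and their boundaries\<close>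

abbreviation supp :: "('a \<Rightarrow>\<^sub>0 int) \<Rightarrow> 'a set" where "supp \<equiv> Poly_Mapping.keys"
abbreviation coef :: "('a \<Rightarrow>\<^sub>0 int) \<Rightarrow> 'a \<Rightarrow> int" where "coef \<equiv> Poly_Mapping.lookup"

definition cone :: "'a \<Rightarrow> ('a list \<Rightarrow>\<^sub>0 int) \<Rightarrow> 'a list \<Rightarrow>\<^sub>0 int" where
  "cone a = frag_extend (\<lambda>\<sigma>. frag_of (a # \<sigma>))"

text \<open>
  Chains of strictly descending lists are chains modulo degenerate lists, so a cone that would
  repeat its apex is zero.
\<close>

definition nd_cone :: "'a \<Rightarrow> ('a list \<Rightarrow>\<^sub>0 int) \<Rightarrow> 'a list \<Rightarrow>\<^sub>0 int" where
  "nd_cone a = frag_extend (\<lambda>\<sigma>. if \<sigma> \<noteq> [] \<and> hd \<sigma> = a then 0 else frag_of (a # \<sigma>))"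

text \<open>
  The usual alternating sum of faces (\<open>bdry_face\<close>). The cone formula is used as the definition
  because it turns every computation with signs into an induction on the list.
\<close>

fun bdry :: "'a list \<Rightarrow> 'a list \<Rightarrow>\<^sub>0 int" where
  "bdry [] = 0"
| "bdry (a # \<sigma>) = frag_of \<sigma> - cone a (bdry \<sigma>)"

text \<open>
  The last entry is never deleted: on strictly descending lists ending in \<open>x\<close> this is the boundary
  modulo the lists that do not end in \<open>x\<close>.
\<close>

fun inner_bdry :: "'a list \<Rightarrow> 'a list \<Rightarrow>\<^sub>0 int" where
  "inner_bdry [] = 0"
| "inner_bdry [a] = 0"
| "inner_bdry (a # b # \<sigma>) = frag_of (b # \<sigma>) - cone a (inner_bdry (b # \<sigma>))"

lemma inner_bdry_Cons: "\<sigma> \<noteq> [] \<Longrightarrow> inner_bdry (a # \<sigma>) = frag_of \<sigma> - cone a (inner_bdry \<sigma>)"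
  by (cases \<sigma>) auto

lemmas frag_lin = frag_extend_diff frag_extend_add frag_extend_minus

lemma cone_simps [simp]:
  "cone a 0 = 0" "cone a (frag_of \<sigma>) = frag_of (a # \<sigma>)" "cone a (u + v) = cone a u + cone a v"
  "cone a (u - v) = cone a u - cone a v" "cone a (- u) = - cone a u"
  by (simp_all add: cone_def frag_lin)

lemma nd_cone_simps [simp]:
  "nd_cone a 0 = 0" "nd_cone a (frag_of \<sigma>) = (if \<sigma> \<noteq> [] \<and> hd \<sigma> = a then 0 else frag_of (a # \<sigma>))"
  "nd_cone a (u + v) = nd_cone a u + nd_cone a v" "nd_cone a (u - v) = nd_cone a u - nd_cone a v"
  "nd_cone a (- u) = - nd_cone a u"
  by (simp_all add: nd_cone_def frag_lin)

lemma keys_cone: "supp (cone a z) \<subseteq> (#) a ` supp z"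
  unfolding cone_def by (rule order_trans [OF keys_frag_extend]) auto

lemma keys_nd_cone:
  "supp (nd_cone a z) \<subseteq> {a # \<sigma> | \<sigma>. \<sigma> \<in> supp z \<and> (\<sigma> = [] \<or> hd \<sigma> \<noteq> a)}"
  unfolding nd_cone_def by (rule order_trans [OF keys_frag_extend]) (auto split: if_splits)

lemma keys_diff_subset:
  "supp u \<subseteq> S \<Longrightarrow> supp v \<subseteq> S \<Longrightarrow> supp (u - v) \<subseteq> S"
  using keys_diff [of u v] by blast

lemma keys_add_subset:
  "supp u \<subseteq> S \<Longrightarrow> supp v \<subseteq> S \<Longrightarrow> supp (u + v) \<subseteq> S"
  using Poly_Mapping.keys_add [of u v] by blast

lemma keys_extend_subset:
  assumes "supp z \<subseteq> S" "\<And>\<sigma>. \<sigma> \<in> S \<Longrightarrow> supp (f \<sigma>) \<subseteq> T"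
  shows "supp (frag_extend f z) \<subseteq> T"
  using keys_frag_extend [of f z] assms by blast

lemma keys_cone_subset:
  assumes "supp z \<subseteq> S" "\<And>\<sigma>. \<sigma> \<in> S \<Longrightarrow> a # \<sigma> \<in> T"
  shows "supp (cone a z) \<subseteq> T"
  using keys_cone [of a z] assms by blast

lemma cone_nd_cone:
  "(\<And>\<sigma>. \<sigma> \<in> supp z \<Longrightarrow> \<sigma> \<noteq> [] \<Longrightarrow> hd \<sigma> \<noteq> a) \<Longrightarrow> nd_cone a z = cone a z"
  unfolding nd_cone_def cone_def by (rule frag_extend_eq) auto

lemma nd_cone_cone_same: "nd_cone a (cone a z) = 0"
proof -
  have "nd_cone a (cone a z) = frag_extend (\<lambda>\<sigma>. 0) z" if "supp z \<subseteq> UNIV"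
    using that by (induction z rule: frag_induction) (auto simp: frag_lin)
  then show ?thesis by (simp add: frag_extend_eq_0)
qed

lemma extend_cone:
  assumes "supp z \<subseteq> S" "\<And>\<sigma>. \<sigma> \<in> S \<Longrightarrow> f (a # \<sigma>) = A (frag_of \<sigma>)" "A 0 = 0"
    "\<And>u v. A (u - v) = A u - A v"
  shows "frag_extend f (cone a z) = A z"
  using assms(1)
  by (induction z rule: frag_induction) (auto simp: assms frag_lin)

lemma frag_ext_eq:
  assumes "supp z \<subseteq> S" "\<And>\<sigma>. \<sigma> \<in> S \<Longrightarrow> A (frag_of \<sigma>) = B (frag_of \<sigma>)"
    "A 0 = (0::'b::ab_group_add)" "B 0 = 0"
    "\<And>u v. A (u - v) = A u - A v" "\<And>u v. B (u - v) = B u - B v"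
  shows "A z = B z"
  using assms(1)
  by (induction z rule: frag_induction) (auto simp: assms)

lemma bnd_cone: "frag_extend bdry (cone a z) = z - cone a (frag_extend bdry z)"
  by (rule extend_cone [of z UNIV]) (auto simp: frag_lin)

lemma bnd_bdry: "frag_extend bdry (bdry \<sigma>) = 0"
  by (induction \<sigma>) (auto simp: frag_lin bnd_cone)

lemma inner_bdry_cone:
  "supp z \<subseteq> - {[]} \<Longrightarrow> frag_extend inner_bdry (cone a z) = z - cone a (frag_extend inner_bdry z)"
  by (rule extend_cone [of z "- {[]}"]) (auto simp: frag_lin inner_bdry_Cons)

lemma keys_inner_bdry: "supp (inner_bdry \<sigma>) \<subseteq> {\<tau>. \<tau> \<noteq> [] \<and> set \<tau> \<subseteq> set \<sigma>}"
proof (induction \<sigma> rule: inner_bdry.induct)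
  case (3 a b \<sigma>)
  show ?case unfolding inner_bdry.simps
    by (intro keys_diff_subset keys_cone_subset [OF "3.IH"]) auto
qed auto

lemma bdry_snoc: "bdry (\<sigma> @ [x]) = inner_bdry (\<sigma> @ [x]) + frag_cmul ((-1) ^ length \<sigma>) (frag_of \<sigma>)"
proof (induction \<sigma>)
  case (Cons a \<sigma>)
  have "cone a (frag_cmul c (frag_of \<sigma>)) = frag_cmul c (frag_of (a # \<sigma>))" for c
    by (simp add: cone_def frag_extend_cmul)
  with Cons show ?case
    by (simp add: inner_bdry_Cons)
qed simp

lemma bdry_face: "bdry \<sigma> = (\<Sum>i<length \<sigma>. frag_cmul ((-1) ^ i) (frag_of (face i \<sigma>)))"
proof (induction \<sigma>)
  case (Cons a \<sigma>)
  have "(\<Sum>i<length (a # \<sigma>). frag_cmul ((-1) ^ i) (frag_of (face i (a # \<sigma>))))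
      = frag_of \<sigma> + (\<Sum>i<length \<sigma>. frag_cmul ((-1) ^ Suc i) (frag_of (face (Suc i) (a # \<sigma>))))"
    unfolding list.size(4) add_Suc_right add_0_right by (subst sum.lessThan_Suc_shift) (simp add: face_def)
  also have "(\<Sum>i<length \<sigma>. frag_cmul ((-1) ^ Suc i) (frag_of (face (Suc i) (a # \<sigma>))))
      = - cone a (\<Sum>i<length \<sigma>. frag_cmul ((-1) ^ i) (frag_of (face i \<sigma>)))"
    by (simp add: cone_def frag_extend_sum o_def frag_extend_cmul face_def flip: sum_negf)
  finally show ?case using Cons by simp
qed simp

lemma keys_bdry: "supp (bdry \<sigma>) \<subseteq> {face i \<sigma> | i. i < length \<sigma>}"
proof (induction \<sigma>)
  case (Cons a \<sigma>)
  let ?S = "{face i (a # \<sigma>) | i. i < length (a # \<sigma>)}"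
  have "\<sigma> = face 0 (a # \<sigma>)" by (simp add: face_def)
  then have "\<sigma> \<in> ?S" by fastforce
  moreover have "a # face i \<sigma> = face (Suc i) (a # \<sigma>)" for i by (simp add: face_def)
  then have "a # \<tau> \<in> ?S" if "\<tau> \<in> {face i \<sigma> | i. i < length \<sigma>}" for \<tau> using that by fastforce
  ultimately show ?case unfolding bdry.simps
    by (intro keys_diff_subset keys_cone_subset [OF Cons]) auto
qed simp

lemma sorted_face:
  assumes "sorted_wrt R \<sigma>" shows "sorted_wrt R (face i \<sigma>)"
proof -
  have "sorted_wrt R (take i \<sigma> @ drop i \<sigma>)" using assms by simp
  moreover have "set (drop (Suc i) \<sigma>) \<subseteq> set (drop i \<sigma>)" by (simp add: set_drop_subset_set_drop)
  ultimately show ?thesis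
    unfolding face_def sorted_wrt_append using sorted_wrt_drop [OF assms] by blast
qed

lemma length_face: "i < length \<sigma> \<Longrightarrow> length (face i \<sigma>) = length \<sigma> - 1"
  by (auto simp: face_def)

lemma set_face: "set (face i \<sigma>) \<subseteq> set \<sigma>"
  by (auto simp: face_def dest: in_set_takeD in_set_dropD)

section \<open>Degenerate simplices\<close>

text \<open>
  The first repeated entry, in position \<open>p\<close>, is repeated once more, with the sign \<open>(-1)\<^sup>p\<close>.
\<close>

fun degen_homotopy :: "'a list \<Rightarrow> 'a list \<Rightarrow>\<^sub>0 int" where
  "degen_homotopy (a # b # \<sigma>) = (if a = b then frag_of (a # a # b # \<sigma>) else - cone a (degen_homotopy (b # \<sigma>)))"
| "degen_homotopy _ = 0"

lemma degen_homotopy_strict: "sorted_wrt (>) (\<sigma> :: 'a::order list) \<Longrightarrow> degen_homotopy \<sigma> = 0"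
  by (induction \<sigma> rule: degen_homotopy.induct) auto

lemma keys_degen_homotopy:
  "supp (degen_homotopy \<sigma>) \<subseteq> {\<tau>. length \<tau> = Suc (length \<sigma>) \<and> set \<tau> = set \<sigma> \<and> last \<tau> = last \<sigma> \<and> hd \<tau> = hd \<sigma>
     \<and> (sorted_wrt (\<ge>) (\<sigma> :: 'a::order list) \<longrightarrow> sorted_wrt (\<ge>) \<tau>)}"
proof (induction \<sigma> rule: degen_homotopy.induct)
  case (1 a b \<sigma>)
  show ?case
  proof (cases "a = b")
    case False
    note IH = "1.IH" [OF False]
    have "supp (degen_homotopy (a # b # \<sigma>)) = supp (cone a (degen_homotopy (b # \<sigma>)))"
      using False by simp
    also have "\<dots> \<subseteq> (#) a ` {\<tau>. length \<tau> = Suc (length (b # \<sigma>)) \<and> set \<tau> = set (b # \<sigma>) \<and>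
        last \<tau> = last (b # \<sigma>) \<and> hd \<tau> = hd (b # \<sigma>) \<and>
        (sorted_wrt (\<ge>) (b # \<sigma>) \<longrightarrow> sorted_wrt (\<ge>) \<tau>)}"
      using keys_cone [of a "degen_homotopy (b # \<sigma>)"] IH by blast
    finally have *: "supp (degen_homotopy (a # b # \<sigma>)) \<subseteq> \<dots>" .
    show ?thesis
    proof
      fix \<tau> assume "\<tau> \<in> supp (degen_homotopy (a # b # \<sigma>))"
      with * obtain \<rho> where \<rho>: "\<tau> = a # \<rho>" "length \<rho> = Suc (length (b # \<sigma>))" "set \<rho> = set (b # \<sigma>)"
        "last \<rho> = last (b # \<sigma>)" "sorted_wrt (\<ge>) (b # \<sigma>) \<Longrightarrow> sorted_wrt (\<ge>) \<rho>"
        by blast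
      then have "\<rho> \<noteq> []" by auto
      with \<rho> show "\<tau> \<in> {\<tau>. length \<tau> = Suc (length (a # b # \<sigma>)) \<and> set \<tau> = set (a # b # \<sigma>) \<and>
        last \<tau> = last (a # b # \<sigma>) \<and> hd \<tau> = hd (a # b # \<sigma>) \<and>
        (sorted_wrt (\<ge>) (a # b # \<sigma>) \<longrightarrow> sorted_wrt (\<ge>) \<tau>)}"
        by simp
    qed
  qed auto
qed auto

lemma degen_homotopy_cone:
  assumes "supp z \<subseteq> {\<sigma>. \<sigma> = [] \<or> hd \<sigma> \<noteq> a}"
  shows "frag_extend degen_homotopy (cone a z) = - cone a (frag_extend degen_homotopy z)"
proof (rule extend_cone [OF assms])
  fix \<sigma> :: "'a list"
  assume "\<sigma> \<in> {\<sigma>. \<sigma> = [] \<or> hd \<sigma> \<noteq> a}"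
  then show "degen_homotopy (a # \<sigma>) = - cone a (frag_extend degen_homotopy (frag_of \<sigma>))"
    by (cases \<sigma>) auto
qed (auto simp: frag_lin)

lemma degen_homotopy_cone_cone:
  "frag_extend degen_homotopy (cone a (cone a z)) = cone a (cone a (cone a z))"
proof -
  have "frag_extend degen_homotopy (cone a (cone a z)) = cone a (cone a (cone a z))" if "supp z \<subseteq> UNIV"
    using that by (induction z rule: frag_induction) (auto simp: frag_lin)
  then show ?thesis by simp
qed

text \<open>
  Of the three faces that delete one of three equal entries two cancel and the third is the given
  list; the other faces cancel against the operator applied to the boundary.
\<close>

lemma degen_homotopy_identity:
  assumes "sorted_wrt (\<ge>) (\<sigma> :: 'a::order list)"
  shows "frag_extend bdry (degen_homotopy \<sigma>) + frag_extend degen_homotopy (bdry \<sigma>)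
    = (if sorted_wrt (>) \<sigma> then 0 else frag_of \<sigma>)"
  using assms
proof (induction \<sigma> rule: degen_homotopy.induct)
  case (1 a b \<sigma>)
  show ?case
  proof (cases "a = b")
    case True
    then show ?thesis
      by (simp add: frag_lin bnd_cone degen_homotopy_cone_cone)
  next
    case False
    with "1.prems" have lt: "b < a" by auto
    have "supp (bdry (b # \<sigma>)) \<subseteq> {\<tau>. \<tau> = [] \<or> hd \<tau> \<noteq> a}"
    proof
      fix \<tau> assume "\<tau> \<in> supp (bdry (b # \<sigma>))"
      then have "set \<tau> \<subseteq> set (b # \<sigma>)" using keys_bdry set_face by fastforce
      moreover have "\<forall>c\<in>set (b # \<sigma>). c < a" using "1.prems" lt by auto
      ultimately show "\<tau> \<in> {\<tau>. \<tau> = [] \<or> hd \<tau> \<noteq> a}" by (cases \<tau>) auto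
    qed
    note * = degen_homotopy_cone [OF this]
    have s: "sorted_wrt (>) (a # b # \<sigma>) \<longleftrightarrow> sorted_wrt (>) (b # \<sigma>)"
      using lt by auto
    have "frag_extend bdry (degen_homotopy (a # b # \<sigma>)) + frag_extend degen_homotopy (bdry (a # b # \<sigma>))
      = cone a (frag_extend bdry (degen_homotopy (b # \<sigma>)) + frag_extend degen_homotopy (bdry (b # \<sigma>)))"
      using False * by (simp add: frag_lin bnd_cone)
    also have "\<dots> = (if sorted_wrt (>) (b # \<sigma>) then 0 else frag_of (a # b # \<sigma>))"
      using "1.IH"[OF False] "1.prems" by simp
    finally show ?thesis using s by metis
  qed
qed auto

definition nd_part :: "('a::order list \<Rightarrow>\<^sub>0 int) \<Rightarrow> 'a list \<Rightarrow>\<^sub>0 int" where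
  "nd_part = frag_extend (\<lambda>\<sigma>. if sorted_wrt (>) \<sigma> then frag_of \<sigma> else 0)"

text \<open>
  The two faces that delete one of two equal entries cancel, and the others are degenerate.
\<close>

lemma nd_part_bdry:
  assumes "sorted_wrt (\<ge>) (\<sigma> :: 'a::order list)" "\<not> sorted_wrt (>) \<sigma>"
  shows "nd_part (bdry \<sigma>) = 0"
  using assms
proof (induction \<sigma> rule: degen_homotopy.induct)
  case (1 a b \<sigma>)
  have deg: "nd_part (cone a (cone a z)) = 0" for z
  proof -
    have "nd_part (cone a (cone a z)) = 0" if "supp z \<subseteq> UNIV"
      using that by (induction z rule: frag_induction) (auto simp: frag_lin nd_part_def)
    then show ?thesis by simp
  qed
  show ?case
  proof (cases "a = b")
    case True
    then show ?thesis using deg by (simp add: nd_part_def frag_lin)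
  next
    case False
    with "1.prems" have lt: "b < a" by auto
    then have ns: "\<not> sorted_wrt (>) (b # \<sigma>)" using 1(2,3) by (auto)
    have "nd_part (cone a z) = nd_part (cone a (nd_part z))" if "supp z \<subseteq> UNIV" for z
      using that by (induction z rule: frag_induction) (auto simp: frag_lin nd_part_def)
    then have "nd_part (cone a (bdry (b # \<sigma>))) = nd_part (cone a (nd_part (bdry (b # \<sigma>))))" by blast
    also have "\<dots> = 0"
      using "1.IH"[OF False] 1(2) ns by (simp add: nd_part_def)
    moreover have "nd_part (frag_of (b # \<sigma>)) = 0" using ns by (simp add: nd_part_def)
    ultimately show ?thesis
      by (simp add: nd_part_def frag_lin)
  qed
qed auto

section \<open>The prism over the map that joins with a fixed element\<close>

lemma nd_cone_inner_bdry:
  assumes "sorted_wrt (>) (\<tau> :: 'a::order list)" "\<tau> \<noteq> []" "hd \<tau> \<le> c" "c \<noteq> last \<tau>"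
  shows "frag_extend inner_bdry (nd_cone c (frag_of \<tau>)) = frag_of \<tau> - nd_cone c (inner_bdry \<tau>)"
proof (cases \<tau>)
  case (Cons d \<tau>')
  show ?thesis
  proof (cases "c = d")
    case True
    then have ne: "\<tau>' \<noteq> []" using assms Cons by auto
    then have "hd \<tau>' \<noteq> d" using assms(1) Cons by (cases \<tau>') auto
    with True ne Cons show ?thesis by (simp add: inner_bdry_Cons nd_cone_cone_same)
  next
    case False
    then have lt: "d < c" using assms Cons by auto
    have *: "\<forall>b\<in>set \<tau>. b < c" using assms(1) Cons lt by auto
    have "nd_cone c (inner_bdry \<tau>) = cone c (inner_bdry \<tau>)"
    proof (rule cone_nd_cone)
      fix \<sigma> assume "\<sigma> \<in> supp (inner_bdry \<tau>)" "\<sigma> \<noteq> []"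
      then have "set \<sigma> \<subseteq> set \<tau>" using keys_inner_bdry by blast
      then show "hd \<sigma> \<noteq> c" using * hd_in_set [OF \<open>\<sigma> \<noteq> []\<close>] by blast
    qed
    with False Cons show ?thesis by (simp add: inner_bdry_Cons)
  qed
qed (use assms in auto)

text \<open>
  The prism operator of the monotone map that joins every entry with \<open>a\<close>, without its degenerate
  terms.
\<close>

fun prism :: "'a::lattice \<Rightarrow> 'a list \<Rightarrow> 'a list \<Rightarrow>\<^sub>0 int" where
  "prism a [] = 0"
| "prism a (y # \<sigma>) = nd_cone (sup y a) (frag_of (y # \<sigma>) - prism a \<sigma>)"

lemma keys_prism:
  assumes "\<sigma> \<noteq> []" "sorted_wrt (>) \<sigma>"
  shows "supp (prism a \<sigma>) \<subseteq>
    {\<tau>. \<tau> \<noteq> [] \<and> sorted_wrt (>) \<tau> \<and> hd \<tau> = sup (hd \<sigma>) a \<and> last \<tau> = last \<sigma> \<and> length \<tau> = Suc (length \<sigma>)}"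
  using assms
proof (induction a \<sigma> rule: prism.induct)
  case (2 a y \<sigma>)
  show ?case
  proof
    fix \<tau> assume "\<tau> \<in> supp (prism a (y # \<sigma>))"
    then obtain \<tau>' where \<tau>: "\<tau> = sup y a # \<tau>'" "\<tau>' = [] \<or> hd \<tau>' \<noteq> sup y a"
      "\<tau>' \<in> supp (frag_of (y # \<sigma>) - prism a \<sigma>)"
      using keys_nd_cone [of "sup y a" "frag_of (y # \<sigma>) - prism a \<sigma>"] by auto
    then consider "\<tau>' = y # \<sigma>" | "\<sigma> \<noteq> []" "\<tau>' \<in> supp (prism a \<sigma>)"
      using keys_diff [of "frag_of (y # \<sigma>)" "prism a \<sigma>"] by (cases \<sigma>) auto
    then have "\<tau>' \<noteq> [] \<and> sorted_wrt (>) \<tau>' \<and> hd \<tau>' \<le> sup y a \<and> last \<tau>' = last (y # \<sigma>) \<and> length \<tau>' = Suc (length \<sigma>)"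
    proof cases
      case 2
      then have "hd \<tau>' = sup (hd \<sigma>) a" "\<tau>' \<noteq> []" "sorted_wrt (>) \<tau>'" "last \<tau>' = last \<sigma>" "length \<tau>' = Suc (length \<sigma>)"
        using "2.IH" "2.prems" by auto
      moreover have "hd \<sigma> \<le> y" using \<open>\<sigma> \<noteq> []\<close> "2.prems" by (cases \<sigma>) auto
      ultimately show ?thesis using \<open>\<sigma> \<noteq> []\<close> by (auto simp: le_supI1)
    qed (use "2.prems" in auto)
    moreover from this \<tau>(2) have "hd \<tau>' < sup y a" by (auto simp: order.strict_iff_order)
    ultimately show "\<tau> \<in> {\<tau>. \<tau> \<noteq> [] \<and> sorted_wrt (>) \<tau> \<and> hd \<tau> = sup (hd (y # \<sigma>)) a \<and>
      last \<tau> = last (y # \<sigma>) \<and> length \<tau> = Suc (length (y # \<sigma>))}"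
      using \<tau>(1) by (cases \<tau>') (auto intro: less_trans)
  qed
qed auto

text \<open>
  The prism is a homotopy from the identity to the map that joins every entry with \<open>a\<close>. As \<open>a\<close> is
  not below the last entry, that map changes the last entry, so it is zero modulo the lists with
  another last entry; only the identity remains.
\<close>

lemma prism_homotopy:
  assumes "\<sigma> \<noteq> []" "sorted_wrt (>) (\<sigma> :: 'a::lattice list)" "\<not> a \<le> last \<sigma>"
  shows "frag_extend inner_bdry (prism a \<sigma>) + frag_extend (prism a) (inner_bdry \<sigma>) = frag_of \<sigma>"
  using assms
proof (induction a \<sigma> rule: prism.induct)
  case (2 a y \<sigma>)
  have ne: "sup y a \<noteq> last (y # \<sigma>)" using "2.prems"(3) by (metis sup.cobounded2)
  define S where "S = {\<tau>. \<tau> \<noteq> [] \<and> sorted_wrt (>) \<tau> \<and> hd \<tau> \<le> sup y a \<and> last \<tau> = last (y # \<sigma>)}"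
  have 1: "supp (frag_of (y # \<sigma>) - prism a \<sigma>) \<subseteq> S"
  proof (cases "\<sigma> = []")
    case False
    then have "hd \<sigma> \<le> y" using "2.prems" by (cases \<sigma>) auto
    then have "supp (prism a \<sigma>) \<subseteq> S"
      using keys_prism [of \<sigma> a] False "2.prems" by (fastforce simp: S_def le_supI1)
    then show ?thesis using "2.prems" by (intro keys_diff_subset) (auto simp: S_def)
  qed (auto simp: S_def)
  have S: "frag_extend inner_bdry (nd_cone (sup y a) z) = z - nd_cone (sup y a) (frag_extend inner_bdry z)"
    if "supp z \<subseteq> S" for z
  proof (rule frag_ext_eq [OF that])
    fix \<tau> assume "\<tau> \<in> S"
    then have "frag_extend inner_bdry (nd_cone (sup y a) (frag_of \<tau>)) = frag_of \<tau> - nd_cone (sup y a) (inner_bdry \<tau>)"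
      using ne by (intro nd_cone_inner_bdry) (auto simp: S_def)
    then show "frag_extend inner_bdry (nd_cone (sup y a) (frag_of \<tau>)) = frag_of \<tau> - nd_cone (sup y a) (frag_extend inner_bdry (frag_of \<tau>))"
      by simp
  qed (auto simp: frag_lin)
  have P: "frag_extend (prism a) (cone y z) = nd_cone (sup y a) (cone y z - frag_extend (prism a) z)" for z
    by (rule extend_cone [of z UNIV]) (auto simp: frag_lin)
  show ?case
  proof (cases "\<sigma> = []")
    case True
    then show ?thesis using S [OF 1] by (simp add: frag_lin)
  next
    case False
    then have IH: "frag_extend inner_bdry (prism a \<sigma>) = frag_of \<sigma> - frag_extend (prism a) (inner_bdry \<sigma>)"
      using "2.IH" "2.prems" by (simp add: eq_diff_eq)
    show ?thesis
      using S [OF 1] by (simp add: inner_bdry_Cons False IH P frag_lin)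
  qed
qed auto

section \<open>The open intervals of a semimodular lattice\<close>

lemma moebius_sum_zero:
  assumes "finite {x..y}" "x < (y::'a::order)"
  shows "(\<Sum>z\<in>{x..y}. moebius x z) = 0"
proof -
  have "{x..y} = insert y {x..<y}" using assms by (auto simp: order.order_iff_strict)
  moreover have "finite {x..<y}" using finite_subset [OF _ assms(1)] by (auto simp: less_imp_le subset_eq)
  ultimately show ?thesis using assms by (simp add: moebius.simps [of x y])
qed

text \<open>
  The sum of \<open>\<mu>(x, z)\<close> over all \<open>z\<close> in \<open>[x, w]\<close> is zero. Sorting
  it by the value of \<open>sup z a\<close> expresses it through the sums in question for the elements of
  \<open>[a, w]\<close>, all but one of which vanish by induction.
\<close>

lemma weisner_sum:
  assumes fin: "finite (UNIV :: 'a::lattice set)" and "x < (a::'a)" "a \<le> w"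
  shows "(\<Sum>z | x \<le> z \<and> sup z a = w. moebius x z) = 0"
  using \<open>a \<le> w\<close>
proof (induction "card {a..w}" arbitrary: w rule: less_induct)
  case less
  have f: "finite (A :: 'a set)" for A using fin by (rule finite_subset [rotated]) simp
  let ?S = "\<lambda>v. (\<Sum>z | x \<le> z \<and> sup z a = v. moebius x z)"
  have "0 = (\<Sum>z\<in>{x..w}. moebius x z)"
    using less.prems assms(2) by (subst moebius_sum_zero) (auto simp: f)
  also have "\<dots> = (\<Sum>v\<in>{a..w}. \<Sum>z | z \<in> {x..w} \<and> sup z a = v. moebius x z)"
    using less.prems by (intro sum.group [symmetric]) (auto simp: f)
  also have "\<dots> = (\<Sum>v\<in>{a..w}. ?S v)"
    by (intro sum.cong refl arg_cong2 [where f = sum]) auto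
  also have "\<dots> = ?S w + (\<Sum>v\<in>{a..w} - {w}. ?S v)"
    using less.prems by (intro sum.remove) (auto simp: f)
  also have "(\<Sum>v\<in>{a..w} - {w}. ?S v) = 0"
  proof (rule sum.neutral, rule ballI)
    fix v assume v: "v \<in> {a..w} - {w}"
    then have "{a..v} \<subset> {a..w}" by (auto simp: less_le)
    with v show "?S v = 0" by (intro less.hyps psubset_card_mono) (auto simp: f)
  qed
  finally show ?case by simp
qed

lemma weisner:
  assumes fin: "finite (UNIV :: 'a::lattice set)" and "x < (a::'a)" "a \<le> y"
  shows "moebius x y = - (\<Sum>c | x \<le> c \<and> c < y \<and> sup c a = y. moebius x c)"
proof -
  have "{z. x \<le> z \<and> sup z a = y} = insert y {c. x \<le> c \<and> c < y \<and> sup c a = y}"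
    using assms by (auto simp: less_le sup_absorb1)
  moreover have "finite {c. x \<le> c \<and> c < y \<and> sup c a = y}"
    using fin by (rule finite_subset [rotated]) simp
  ultimately show ?thesis
    using weisner_sum [OF assms] by simp
qed

text \<open>
  The chains of the half-open interval \<open>[x, y)\<close> that contain \<open>x\<close>. Removing the first entry \<open>c\<close>
  leaves such a chain for \<open>[x, c)\<close>, which is why the upper end varies in the induction below.
\<close>

definition dchains :: "'a::order \<Rightarrow> 'a \<Rightarrow> 'a list set" where
  "dchains x y = {\<sigma>. \<sigma> \<noteq> [] \<and> last \<sigma> = x \<and> sorted_wrt (>) (y # \<sigma>)}"

abbreviation dchains_len :: "'a::order \<Rightarrow> 'a \<Rightarrow> nat \<Rightarrow> 'a list set" where
  "dchains_len x y n \<equiv> {\<sigma> \<in> dchains x y. length \<sigma> = n}"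

lemma dchains_single [simp]: "[z] \<in> dchains x y \<longleftrightarrow> z = x \<and> x < y"
  by (auto simp: dchains_def)

lemma dchains_Cons: "\<sigma> \<noteq> [] \<Longrightarrow> c # \<sigma> \<in> dchains x y \<longleftrightarrow> c < y \<and> \<sigma> \<in> dchains x c"
  by (fastforce simp: dchains_def)

lemma dchains_mono: "\<sigma> \<in> dchains x c \<Longrightarrow> c \<le> y \<Longrightarrow> \<sigma> \<in> dchains x y"
  by (fastforce simp: dchains_def)

lemma dchains_hd:
  assumes "\<sigma> \<in> dchains x y" shows "x \<le> hd \<sigma>" "hd \<sigma> < y" "\<sigma> \<noteq> []"
  using assms by (cases \<sigma>; auto simp: dchains_def less_imp_le)+

lemma dchains_hdI:
  assumes "\<sigma> \<noteq> []" "sorted_wrt (>) \<sigma>" "last \<sigma> = x" "hd \<sigma> < y" shows "\<sigma> \<in> dchains x y"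
  using assms by (cases \<sigma>) (auto simp: dchains_def)

lemma keys_inner_bdry_dchains:
  assumes "\<sigma> \<in> dchains x y"
  shows "supp (inner_bdry \<sigma>) \<subseteq> {\<tau> \<in> dchains x y. hd \<tau> \<le> hd \<sigma> \<and> Suc (length \<tau>) = length \<sigma>}"
  using assms
proof (induction \<sigma> arbitrary: y rule: inner_bdry.induct)
  case (3 c d \<sigma>)
  then have c: "c < y" "d # \<sigma> \<in> dchains x c" by (auto simp: dchains_Cons)
  show ?case unfolding inner_bdry.simps
  proof (intro keys_diff_subset)
    show "supp (frag_of (d # \<sigma>)) \<subseteq>
      {\<tau> \<in> dchains x y. hd \<tau> \<le> hd (c # d # \<sigma>) \<and> Suc (length \<tau>) = length (c # d # \<sigma>)}"
      using c dchains_mono [OF c(2)] dchains_hd(2) [OF c(2)] by simp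
    show "supp (cone c (inner_bdry (d # \<sigma>))) \<subseteq>
      {\<tau> \<in> dchains x y. hd \<tau> \<le> hd (c # d # \<sigma>) \<and> Suc (length \<tau>) = length (c # d # \<sigma>)}"
      using c by (intro keys_cone_subset [OF "3.IH" [OF c(2)]]) (auto simp: dchains_Cons dchains_hd(3))
  qed
qed auto

text \<open>
  The interval \<open>[x, y]\<close>, of length \<open>r\<close>, has the homology of a wedge of spheres of one dimension,
  in explicit form: \<open>H\<close> contracts the chains of length other than \<open>r\<close>, and the coefficients on \<open>B\<close>
  are coordinates for the cycles of length \<open>r\<close>, with dual basis \<open>\<rho>\<close>. Injectivity of the coordinates
  is the last clause.
\<close>

definition spherical where
  "spherical r x y H B \<rho> \<longleftrightarrow>
     (\<forall>\<sigma>\<in>dchains x y. supp (H \<sigma>) \<subseteq> dchains_len x y (Suc (length \<sigma>))) \<and>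
     (\<forall>\<sigma>\<in>dchains x y. length \<sigma> \<noteq> r \<longrightarrow>
        frag_extend inner_bdry (H \<sigma>) + frag_extend H (inner_bdry \<sigma>) = frag_of \<sigma>) \<and>
     finite B \<and> int (card B) = (-1) ^ r * moebius x y \<and> B \<subseteq> dchains_len x y r \<and>
     (\<forall>b\<in>B. supp (\<rho> b) \<subseteq> dchains_len x y r \<and> frag_extend inner_bdry (\<rho> b) = 0 \<and>
        (\<forall>b'\<in>B. coef (\<rho> b) b' = (if b' = b then 1 else 0))) \<and>
     (\<forall>z. supp z \<subseteq> dchains_len x y r \<longrightarrow> frag_extend inner_bdry z = 0 \<longrightarrow>
        (\<forall>b\<in>B. coef z b = 0) \<longrightarrow> z = 0)"

lemma spherical_cycle_zero:
  assumes "spherical r x y H B \<rho>" "supp z \<subseteq> dchains_len x y r" "frag_extend inner_bdry z = 0"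
    "\<And>b. b \<in> B \<Longrightarrow> coef z b = 0"
  shows "z = 0"
proof -
  have "\<forall>z. supp z \<subseteq> dchains_len x y r \<longrightarrow> frag_extend inner_bdry z = 0 \<longrightarrow>
        (\<forall>b\<in>B. coef z b = 0) \<longrightarrow> z = 0"
    using assms(1) unfolding spherical_def by (elim conjE)
  with assms(2-) show ?thesis by simp
qed

lemma spherical_homotopy:
  assumes "spherical r x y H B \<rho>" "\<sigma> \<in> dchains x y"
  shows "supp (H \<sigma>) \<subseteq> dchains_len x y (Suc (length \<sigma>))"
    and "length \<sigma> \<noteq> r \<Longrightarrow> frag_extend inner_bdry (H \<sigma>) + frag_extend H (inner_bdry \<sigma>) = frag_of \<sigma>"
  using assms unfolding spherical_def by simp_all

lemma spherical_basis:
  assumes "spherical r x y H B \<rho>"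
  shows "finite B" "int (card B) = (-1) ^ r * moebius x y" "B \<subseteq> dchains_len x y r"
  using assms by (simp_all only: spherical_def)

lemma spherical_dual:
  assumes "spherical r x y H B \<rho>" "b \<in> B"
  shows "supp (\<rho> b) \<subseteq> dchains_len x y r" "frag_extend inner_bdry (\<rho> b) = 0"
    "b' \<in> B \<Longrightarrow> coef (\<rho> b) b' = (if b' = b then 1 else 0)"
  using assms by (simp_all only: spherical_def)

locale semimodular =
  fixes rk :: "'a::bounded_lattice \<Rightarrow> int"
  assumes finite_lattice: "finite (UNIV :: 'a set)"
    and rk_strict: "x < y \<Longrightarrow> rk x < rk y"
    and rk_cover: "covers UNIV x y \<Longrightarrow> rk y = rk x + 1"
    and rk_submodular: "rk (sup x y) + rk (inf x y) \<le> rk x + rk y"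
begin

lemma length_chain: "\<sigma> \<in> dchains x y \<Longrightarrow> int (length \<sigma>) \<le> rk y - rk x"
proof (induction \<sigma> arbitrary: y)
  case (Cons c \<sigma>)
  show ?case
  proof (cases "\<sigma> = []")
    case True
    then show ?thesis using Cons.prems rk_strict by fastforce
  next
    case False
    then have "c < y" "\<sigma> \<in> dchains x c" using Cons.prems by (auto simp: dchains_Cons)
    then show ?thesis using Cons.IH [of c] rk_strict [of c y] by simp
  qed
qed (simp add: dchains_def)

lemma atom_exists:
  assumes "x < (y :: 'a)" obtains a where "covers UNIV x a" "a \<le> y"
proof -
  have "finite {z. x < z \<and> z \<le> y}" using finite_lattice by (rule finite_subset [rotated]) simp
  moreover have "y \<in> {z. x < z \<and> z \<le> y}" using assms by simp
  ultimately obtain a where a: "a \<in> {z. x < z \<and> z \<le> y}" "\<And>b. b \<in> {z. x < z \<and> z \<le> y} \<Longrightarrow> b \<le> a \<Longrightarrow> a = b"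
    using finite_has_minimal [of "{z. x < z \<and> z \<le> y}"] by blast
  have "\<not> (x < z \<and> z < a)" for z
    using a(1) a(2)[of z] by force
  then show ?thesis using a that [of a] by (auto simp: covers_def)
qed

text \<open>
  Induction on the length of the interval, with a fixed atom \<open>a\<close>. In the proof, \<open>G\<close> is the set of
  chains contracted by the prism; every other chain is some \<open>c\<close> in \<open>bad\<close> followed by a chain of
  \<open>[x, c]\<close>, which lies in \<open>G\<close> again because \<open>c\<close> is a coatom.
\<close>

lemma spherical_exists:
  assumes "x < y" "rk y - rk x = int r"
  shows "\<exists>H B \<rho>. spherical r x y H B \<rho>"
  using assms
proof (induction r arbitrary: y)
  case 0
  then show ?case using rk_strict by fastforce
next
  case (Suc r)
  obtain a where a: "covers UNIV x a" "a \<le> y" using atom_exists Suc.prems by blast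
  then have xa: "x < a" and rka: "rk a = rk x + 1" using rk_cover by (auto simp: covers_def)
  show ?case
  proof (cases "r = 0")
    case True
    have cov: "\<not> (x < z \<and> z < y)" for z using rk_strict [of x z] rk_strict [of z y] Suc.prems True by force
    have ch: "\<sigma> = [x]" if "\<sigma> \<in> dchains x y" for \<sigma>
      using that length_chain [OF that] Suc.prems True
      by (cases \<sigma>) (auto simp: dchains_def)
    then have chs: "dchains x y = {[x]}" using Suc.prems by auto
    have "{x..<y} = {x}" using cov Suc.prems(1) by (auto simp: order.order_iff_strict)
    then have mu: "moebius x y = -1"
      using Suc.prems finite_subset [OF _ finite_lattice] by (simp add: moebius.simps [of x y] moebius.simps [of x x])
    have "z = 0" if "supp z \<subseteq> {[x]}" "coef z [x] = 0" for z :: "'a list \<Rightarrow>\<^sub>0 int"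
      using that by (metis in_keys_iff keys_eq_empty subset_singletonD singletonI)
    then have "spherical (Suc r) x y (\<lambda>_. 0) {[x]} (\<lambda>_. frag_of [x])"
      using True mu by (auto simp: spherical_def chs)
    then show ?thesis by blast
  next
    case False
    have ay: "a < y" using a Suc.prems False rka by (auto simp: order.order_iff_strict)
    define bad where "bad = {c. x \<le> c \<and> c < y \<and> sup c a = y}"
    have fin: "finite (A :: 'a set)" for A using finite_lattice by (rule finite_subset [rotated]) simp
    have bad: "x < c \<and> rk c = rk y - 1 \<and> c < y" if "c \<in> bad" for c
    proof -
      from that have c: "x \<le> c" "c < y" "sup c a = y" by (auto simp: bad_def)
      have "c \<noteq> x" using c ay xa by (metis less_imp_le order_less_irrefl sup.absorb2)
      with c have "x < c" by simp
      have "inf c a \<noteq> a" using c by (metis inf.absorb_iff2 order_less_irrefl sup.absorb1)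
      then have "inf c a < a" by (simp add: less_le)
      moreover have "x \<le> inf c a" using c xa by simp
      ultimately have "inf c a = x" using a by (auto simp: covers_def order.order_iff_strict)
      then have "rk y + rk x \<le> rk c + rk a" using rk_submodular [of c a] c by simp
      then show ?thesis using rk_strict [OF c(2)] rka \<open>x < c\<close> c by simp
    qed
    have "\<exists>H B \<rho>. spherical r x c H B \<rho>" if "c \<in> bad" for c
      using Suc.IH [of c] bad [OF that] Suc.prems by simp
    then obtain H B \<rho> where sph: "\<And>c. c \<in> bad \<Longrightarrow> spherical r x c (H c) (B c) (\<rho> c)"
      by metis
    have Hkeys: "supp (H c \<tau>) \<subseteq> dchains_len x c (Suc (length \<tau>))"
      if "c \<in> bad" "\<tau> \<in> dchains x c" for c \<tau> by (rule spherical_homotopy(1) [OF sph [OF that(1)] that(2)])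
    have Hhom: "frag_extend inner_bdry (H c \<tau>) = frag_of \<tau> - frag_extend (H c) (inner_bdry \<tau>)"
      if "c \<in> bad" "\<tau> \<in> dchains x c" "length \<tau> \<noteq> r" for c \<tau>
      using spherical_homotopy(2) [OF sph [OF that(1)] that(2,3)] by (simp add: eq_diff_eq)
    note Bsub = spherical_basis(3) [OF sph] spherical_basis(1) [OF sph] spherical_basis(2) [OF sph]
    note rkeys = spherical_dual(1) [OF sph] and rcyc = spherical_dual(2) [OF sph]
      and rdual = spherical_dual(3) [OF sph] and cycz = spherical_cycle_zero [OF sph]
    define G where "G = {\<sigma> \<in> dchains x y. sup (hd \<sigma>) a < y}"
    define P where "P = frag_extend (prism a)"
    have P_lin: "P (u - v) = P u - P v" "P (u + v) = P u + P v" "P (- u) = - P u" "P 0 = 0"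
      "P (frag_of \<sigma>) = prism a \<sigma>" for u v \<sigma>
      by (simp_all add: P_def frag_lin)
    have G_chain: "\<tau> \<in> G" if "c \<in> bad" "\<tau> \<in> dchains x c" for c \<tau>
    proof -
      have c: "rk c = rk y - 1" "c < y" using bad [OF that(1)] by auto
      have t: "x \<le> hd \<tau>" "hd \<tau> < c" using dchains_hd [OF that(2)] by auto
      have "hd \<tau> \<notin> bad" using bad [of "hd \<tau>"] rk_strict [OF t(2)] c by auto
      moreover have "sup (hd \<tau>) a \<le> y" using t c ay by (simp add: less_imp_le order_less_trans)
      ultimately have "sup (hd \<tau>) a < y" using t c by (auto simp: bad_def less_le)
      then show ?thesis using dchains_mono [OF that(2)] c by (simp add: G_def)
    qed
    have bad_chain: "\<exists>c\<in>bad. \<exists>\<tau>\<in>dchains x c. \<sigma> = c # \<tau>" if sG: "\<sigma> \<in> dchains x y" "\<sigma> \<notin> G" for \<sigma>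
    proof -
      obtain c \<tau> where s: "\<sigma> = c # \<tau>" using dchains_hd(3) [OF sG(1)] by (cases \<sigma>) auto
      have "x \<le> c" "c < y" using dchains_hd [OF sG(1)] s by auto
      moreover have "sup c a \<le> y" using \<open>c < y\<close> ay by (simp add: less_imp_le)
      ultimately have "c \<in> bad" using sG s by (auto simp: bad_def G_def less_le)
      moreover have "\<tau> \<noteq> []" using bad [OF \<open>c \<in> bad\<close>] sG(1) s by auto
      ultimately show ?thesis using sG(1) s by (auto simp: dchains_Cons)
    qed
    have Gbad: "c # \<tau> \<notin> G" if "c \<in> bad" for c \<tau> using that by (auto simp: G_def bad_def)
    have Gc: "G \<subseteq> dchains x y" by (auto simp: G_def)
    have cbad: "c # \<tau> \<in> dchains x y" if "c \<in> bad" "\<tau> \<in> dchains x c" for c \<tau>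
      using that bad [OF that(1)] dchains_hd(3) [OF that(2)] by (simp add: dchains_Cons)
    have Gbdr: "supp (inner_bdry \<sigma>) \<subseteq> G" if "\<sigma> \<in> G" for \<sigma>
    proof -
      have "sup (hd \<tau>) a < y" if "hd \<tau> \<le> hd \<sigma>" for \<tau>
        using \<open>\<sigma> \<in> G\<close> le_less_trans [OF sup_mono [OF that order_refl [of a]]] by (simp add: G_def)
      then show ?thesis using keys_inner_bdry_dchains [of \<sigma> x y] that by (auto simp: G_def)
    qed
    have nax: "\<not> a \<le> x" using xa by auto
    have Gprism: "supp (prism a \<sigma>) \<subseteq> {\<tau> \<in> G. length \<tau> = Suc (length \<sigma>)}" if "\<sigma> \<in> G" for \<sigma>
    proof -
      have s: "\<sigma> \<noteq> []" "sorted_wrt (>) \<sigma>" "last \<sigma> = x" "sup (hd \<sigma>) a < y"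
        using that by (auto simp: G_def dchains_def)
      show ?thesis
        using keys_prism [OF s(1,2), of a] s by (auto simp: G_def intro!: dchains_hdI)
    qed
    have Pkeys: "supp (P z) \<subseteq> {\<tau> \<in> G. length \<tau> = Suc n}"
      if "supp z \<subseteq> {\<tau> \<in> G. length \<tau> = n}" for z n
      unfolding P_def using Gprism by (intro keys_extend_subset [OF that]) blast
    have Phom: "frag_extend inner_bdry (P z) = z - P (frag_extend inner_bdry z)" if "supp z \<subseteq> G" for z
    proof (rule frag_ext_eq [OF that])
      fix \<sigma> assume "\<sigma> \<in> G"
      then have "frag_extend inner_bdry (prism a \<sigma>) + P (inner_bdry \<sigma>) = frag_of \<sigma>"
        unfolding P_def using nax by (intro prism_homotopy) (auto simp: G_def dchains_def)
      then show "frag_extend inner_bdry (P (frag_of \<sigma>)) = frag_of \<sigma> - P (frag_extend inner_bdry (frag_of \<sigma>))"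
        by (simp add: P_lin eq_diff_eq)
    qed (auto simp: P_lin frag_lin)
    \<comment> \<open>The first term is forced by the cone formula; the second contracts what it leaves over, a chain in \<open>G\<close>.\<close>
    define HH where "HH = (\<lambda>\<sigma>. if sup (hd \<sigma>) a < y then prism a \<sigma>
      else - cone (hd \<sigma>) (H (hd \<sigma>) (tl \<sigma>)) + P (H (hd \<sigma>) (tl \<sigma>) - prism a (tl \<sigma>)))"
    define BB where "BB = (\<Union>c\<in>bad. (#) c ` B c)"
    \<comment> \<open>The boundary of the cone is \<open>\<rho> c\<close> itself, a cycle in \<open>G\<close>, which the prism fills in.\<close>
    define RR where "RR = (\<lambda>\<sigma>. cone (hd \<sigma>) (\<rho> (hd \<sigma>) (tl \<sigma>)) - P (\<rho> (hd \<sigma>) (tl \<sigma>)))"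
    have HG: "HH \<sigma> = prism a \<sigma>" if "\<sigma> \<in> G" for \<sigma> using that by (simp add: HH_def G_def)
    have HB: "HH (c # \<tau>) = - cone c (H c \<tau>) + P (H c \<tau> - prism a \<tau>)" if "c \<in> bad" for c \<tau>
      using that by (simp add: HH_def bad_def)
    have HGz: "frag_extend HH z = P z" if "supp z \<subseteq> G" for z
      unfolding P_def using that HG by (intro frag_extend_eq) auto
    have HBz: "frag_extend HH (cone c z) = - cone c (frag_extend (H c) z) + P (frag_extend (H c) z - P z)"
      if "c \<in> bad" "supp z \<subseteq> dchains x c" for c z
      by (rule extend_cone [OF that(2)]) (auto simp: HB that(1) P_lin frag_lin)
    have Hl: "supp (H c \<tau>) \<subseteq> {\<sigma> \<in> G. length \<sigma> = Suc (length \<tau>)}" if "c \<in> bad" "\<tau> \<in> dchains x c" for c \<tau>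
      using Hkeys [OF that] G_chain [OF that(1)] by blast
    have wl: "supp (H c \<tau> - prism a \<tau>) \<subseteq> {\<sigma> \<in> G. length \<sigma> = Suc (length \<tau>)}"
      if "c \<in> bad" "\<tau> \<in> dchains x c" for c \<tau>
      using Hl [OF that] Gprism [OF G_chain [OF that]] by (rule keys_diff_subset)
    have "supp (HH \<sigma>) \<subseteq> dchains_len x y (Suc (length \<sigma>))" if s: "\<sigma> \<in> dchains x y" for \<sigma>
    proof (cases "\<sigma> \<in> G")
      case True
      then show ?thesis using HG [OF True] Gprism [OF True] Gc by auto
    next
      case False
      then obtain c \<tau> where c: "c \<in> bad" "\<tau> \<in> dchains x c" "\<sigma> = c # \<tau>" using bad_chain s by blast
      have "supp (cone c (H c \<tau>)) \<subseteq> dchains_len x y (Suc (length \<sigma>))"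
        using c cbad by (intro keys_cone_subset [OF Hkeys [OF c(1,2)]]) auto
      moreover have "supp (P (H c \<tau> - prism a \<tau>)) \<subseteq> dchains_len x y (Suc (length \<sigma>))"
        using Pkeys [OF wl [OF c(1,2)]] Gc c(3) by auto
      ultimately show ?thesis unfolding c(3) HB [OF c(1)] by (intro keys_add_subset) auto
    qed
    moreover
    have "frag_extend inner_bdry (HH \<sigma>) + frag_extend HH (inner_bdry \<sigma>) = frag_of \<sigma>"
      if s: "\<sigma> \<in> dchains x y" "length \<sigma> \<noteq> Suc r" for \<sigma>
    proof (cases "\<sigma> \<in> G")
      case True
      then show ?thesis using Phom [of "frag_of \<sigma>"] HGz [OF Gbdr [OF True]] HG by (simp add: P_lin)
    next
      case False
      then obtain c \<tau> where c: "c \<in> bad" "\<tau> \<in> dchains x c" "\<sigma> = c # \<tau>" using bad_chain s by blast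
      have len: "length \<tau> \<noteq> r" using s c by auto
      have ne: "\<tau> \<noteq> []" using dchains_hd(3) c by blast
      have tG: "\<tau> \<in> G" using G_chain c by blast
      have k1: "supp (H c \<tau>) \<subseteq> - {[]}" using Hl [OF c(1,2)] by auto
      have k2: "supp (H c \<tau> - prism a \<tau>) \<subseteq> G" using wl [OF c(1,2)] by auto
      have k3: "supp (inner_bdry \<tau>) \<subseteq> dchains x c" using keys_inner_bdry_dchains [OF c(2)] by auto
      have e1: "frag_extend inner_bdry (prism a \<tau>) = frag_of \<tau> - P (inner_bdry \<tau>)"
        using Phom [of "frag_of \<tau>"] tG by (simp add: P_lin)
      have e2: "HH \<tau> = prism a \<tau>" by (rule HG [OF tG])
      have "frag_extend inner_bdry (HH \<sigma>) = - (H c \<tau> - cone c (frag_extend inner_bdry (H c \<tau>)))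
          + (H c \<tau> - prism a \<tau> - P (frag_extend inner_bdry (H c \<tau> - prism a \<tau>)))"
        by (simp only: c(3) HB [OF c(1)] frag_extend_add frag_extend_minus inner_bdry_cone [OF k1] Phom [OF k2])
      moreover have "frag_extend HH (inner_bdry \<sigma>) = prism a \<tau>
          + cone c (frag_extend (H c) (inner_bdry \<tau>)) - P (frag_extend (H c) (inner_bdry \<tau>) - P (inner_bdry \<tau>))"
        by (simp add: c(3) inner_bdry_Cons [OF ne] frag_lin HBz [OF c(1) k3] e2)
      ultimately show ?thesis
        unfolding frag_lin e1 Hhom [OF c(1,2) len] by (simp add: P_lin c(3))
    qed
    moreover have "finite BB" using Bsub fin by (auto simp: BB_def)
    moreover have "int (card BB) = (-1) ^ Suc r * moebius x y"
    proof -
      have "card BB = (\<Sum>c\<in>bad. card ((#) c ` B c))"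
        unfolding BB_def using Bsub fin by (intro card_UN_disjoint) auto
      also have "\<dots> = (\<Sum>c\<in>bad. card (B c))"
        by (intro sum.cong refl card_image) (auto simp: inj_on_def)
      finally have "int (card BB) = (\<Sum>c\<in>bad. (-1) ^ r * moebius x c)"
        using Bsub(3) by (simp)
      also have "\<dots> = (-1) ^ Suc r * moebius x y"
        unfolding weisner [OF finite_lattice xa a(2)] bad_def by (simp add: sum_distrib_left sum_negf)
      finally show ?thesis .
    qed
    moreover have "BB \<subseteq> dchains_len x y (Suc r)"
      using Bsub(1) cbad by (force simp: BB_def)
    moreover have "supp (RR b) \<subseteq> dchains_len x y (Suc r) \<and> frag_extend inner_bdry (RR b) = 0 \<and>
        (\<forall>b'\<in>BB. coef (RR b) b' = (if b' = b then 1 else 0))" if bB: "b \<in> BB" for b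
    proof -
      obtain c \<beta> where c: "c \<in> bad" "\<beta> \<in> B c" "b = c # \<beta>" using bB by (auto simp: BB_def)
      have R: "RR b = cone c (\<rho> c \<beta>) - P (\<rho> c \<beta>)" by (simp add: RR_def c)
      have k: "supp (\<rho> c \<beta>) \<subseteq> {\<sigma> \<in> G. length \<sigma> = r}"
        using rkeys [OF c(1,2)] G_chain [OF c(1)] by blast
      then have k': "supp (\<rho> c \<beta>) \<subseteq> G" "supp (\<rho> c \<beta>) \<subseteq> - {[]}"
        using False by auto
      note kP = Pkeys [OF k]
      have "supp (cone c (\<rho> c \<beta>)) \<subseteq> dchains_len x y (Suc r)"
        using cbad c by (intro keys_cone_subset [OF rkeys [OF c(1,2)]]) auto
      moreover have "supp (P (\<rho> c \<beta>)) \<subseteq> dchains_len x y (Suc r)"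
        using kP Gc by auto
      ultimately have "supp (RR b) \<subseteq> dchains_len x y (Suc r)"
        unfolding R by (rule keys_diff_subset)
      moreover have "frag_extend inner_bdry (RR b) = 0"
        unfolding R frag_lin inner_bdry_cone [OF k'(2)] Phom [OF k'(1)] rcyc [OF c(1,2)] by (simp add: P_lin)
      moreover have "coef (RR b) b' = (if b' = b then 1 else 0)" if "b' \<in> BB" for b'
      proof -
        obtain c' \<beta>' where c': "c' \<in> bad" "\<beta>' \<in> B c'" "b' = c' # \<beta>'" using \<open>b' \<in> BB\<close> by (auto simp: BB_def)
        have "b' \<notin> supp (P (\<rho> c \<beta>))" using kP Gbad [OF c'(1)] c'(3) by auto
        then have "coef (RR b) b' = coef (cone c (\<rho> c \<beta>)) b'"
          unfolding R lookup_minus by (simp add: in_keys_iff)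
        also have "\<dots> = (if c' = c then coef (\<rho> c \<beta>) \<beta>' else 0)"
        proof -
          have "coef (cone c z) (c' # \<beta>') = (if c' = c then coef z \<beta>' else 0)"
            for z
            by (rule frag_ext_eq [of z UNIV]) (auto simp: lookup_minus)
          then show ?thesis using c'(3) by simp
        qed
        also have "\<dots> = (if b' = b then 1 else 0)"
          using rdual [OF c(1,2)] c c' by auto
        finally show ?thesis .
      qed
      ultimately show ?thesis by blast
    qed
    moreover have "z = 0" if z: "supp z \<subseteq> dchains_len x y (Suc r)" "frag_extend inner_bdry z = 0"
      "\<forall>b\<in>BB. coef z b = 0" for z
    proof -
      have inG: "supp z \<subseteq> G"
      proof
        fix \<sigma> assume s: "\<sigma> \<in> supp z"
        show "\<sigma> \<in> G"
        proof (rule ccontr)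
          assume "\<sigma> \<notin> G"
          then obtain c \<tau> where c: "c \<in> bad" "\<tau> \<in> dchains x c" "\<sigma> = c # \<tau>"
            using bad_chain s z by blast
          \<comment> \<open>The part of a cycle that starts with \<open>c\<close> is, without \<open>c\<close>, a cycle of \<open>[x, c]\<close>.\<close>
          define tail where "tail = frag_extend (\<lambda>\<sigma>. if \<sigma> \<in> (#) c ` dchains x c then frag_of (tl \<sigma>) else 0)"
          have tail_lin: "tail (u - v) = tail u - tail v" "tail 0 = 0" for u v
            by (simp_all add: tail_def frag_lin)
          have tailG: "tail w = 0" if "supp w \<subseteq> G" for w
            unfolding tail_def using that Gbad [OF c(1)] by (intro frag_extend_eq_0) auto
          have tail_cone: "tail (cone d w) = (if d = c then w else 0)" if "supp w \<subseteq> dchains x d" for d w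
            by (rule frag_ext_eq [OF that]) (auto simp: tail_lin tail_def frag_lin)
          have tail_inner_bdry: "tail (frag_extend inner_bdry z) = - frag_extend inner_bdry (tail z)"
          proof (rule frag_ext_eq [of z "dchains x y"])
            fix \<sigma>' assume s': "\<sigma>' \<in> dchains x y"
            show "tail (frag_extend inner_bdry (frag_of \<sigma>')) = - frag_extend inner_bdry (tail (frag_of \<sigma>'))"
            proof (cases "\<sigma>' \<in> G")
              case True
              then show ?thesis using tailG [OF Gbdr [OF True]] tailG [of "frag_of \<sigma>'"] by simp
            next
              case False
              then obtain d \<tau>' where d: "d \<in> bad" "\<tau>' \<in> dchains x d" "\<sigma>' = d # \<tau>'"
                using bad_chain s' by blast
              have "tail (frag_of \<tau>') = 0" using G_chain d by (intro tailG) auto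
              moreover have "supp (inner_bdry \<tau>') \<subseteq> dchains x d" using keys_inner_bdry_dchains [OF d(2)] by auto
              ultimately show ?thesis
                using tail_cone [of "frag_of \<tau>'" d] tail_cone [of "inner_bdry \<tau>'" d] d dchains_hd(3) [OF d(2)]
                by (simp add: inner_bdry_Cons tail_lin)
            qed
          qed (use z in \<open>auto simp: tail_lin frag_lin\<close>)
          have lk: "coef (tail z) \<tau>' = coef z (c # \<tau>')" if "\<tau>' \<in> dchains x c" for \<tau>'
          proof (rule frag_ext_eq [of z UNIV])
            show "coef (tail (frag_of \<sigma>)) \<tau>' = coef (frag_of \<sigma>) (c # \<tau>')" for \<sigma>
              using that by (auto simp: tail_def image_iff)
          qed (simp_all add: lookup_minus tail_lin)
          have "tail z = 0"
          proof (rule cycz [OF c(1)])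
            show "supp (tail z) \<subseteq> dchains_len x c r"
              unfolding tail_def by (rule keys_extend_subset [OF z(1)]) auto
            show "frag_extend inner_bdry (tail z) = 0"
              using tail_inner_bdry z(2) by (simp add: tail_lin)
            show "coef (tail z) b = 0" if "b \<in> B c" for b
              using lk [of b] z(3) that c(1) Bsub(1) [OF c(1)] by (auto simp: BB_def)
          qed
          then show False using lk [OF c(2)] s c(3) by (simp add: in_keys_iff)
        qed
      qed
      then have "supp z \<subseteq> {\<sigma> \<in> G. length \<sigma> = Suc r}" using z(1) by auto
      note Pkeys [OF this]
      moreover have "{\<tau> \<in> G. length \<tau> = Suc (Suc r)} = {}"
        using length_chain Suc.prems(2) by (fastforce simp: G_def)
      ultimately have "P z = 0" by simp
      then show "z = 0" using Phom [OF inG] z(2) by (simp add: P_lin)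
    qed
    ultimately have "spherical (Suc r) x y HH BB RR"
      unfolding spherical_def by blast
    then show ?thesis by blast
  qed
qed

end

section \<open>The rank of a geometric lattice\<close>

abbreviation rank_chains :: "'a::bounded_lattice \<Rightarrow> 'a set set" where
  "rank_chains x \<equiv> {C. finite C \<and> Complete_Partial_Order.chain (\<le>) C \<and> bot \<in> C \<and> x \<in> C \<and> C \<subseteq> {bot..x}}"

lemma lattice_rank_attained:
  assumes "finite_length (UNIV :: 'a::bounded_lattice set)"
  shows "\<exists>C\<in>rank_chains x. lattice_rank (x :: 'a) = int (card C) - 1"
    and "C \<in> rank_chains x \<Longrightarrow> int (card C) - 1 \<le> lattice_rank x"
proof -
  obtain N where N: "\<And>C :: 'a set. Complete_Partial_Order.chain (\<le>) C \<Longrightarrow> card C \<le> N"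
    using assms by (auto simp: finite_length_def)
  let ?X = "(\<lambda>C. int (card C) - 1) ` rank_chains x"
  have "?X \<subseteq> {-1..int N}" using N by fastforce
  then have fin: "finite ?X" by (rule finite_subset) simp
  have "{bot, x} \<in> rank_chains x" by (auto simp: Complete_Partial_Order.chain_def)
  then have ne: "?X \<noteq> {}" by blast
  have eq: "lattice_rank x = Max ?X"
    unfolding lattice_rank_def using cSup_eq_Max [OF fin ne] by simp
  show "\<exists>C\<in>rank_chains x. lattice_rank x = int (card C) - 1"
    using Max_in [OF fin ne] unfolding eq by blast
  show "C \<in> rank_chains x \<Longrightarrow> int (card C) - 1 \<le> lattice_rank x"
    unfolding eq using fin by (intro Max_ge) auto
qed

lemma lattice_rank_strict:
  assumes "finite_length (UNIV :: 'a::bounded_lattice set)" "(x :: 'a) < y"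
  shows "lattice_rank x < lattice_rank y"
proof -
  obtain C where C: "C \<in> rank_chains x" "lattice_rank x = int (card C) - 1"
    using lattice_rank_attained(1) [OF assms(1)] by blast
  have sub: "C \<subseteq> {bot..x}" using C(1) by blast
  then have "y \<notin> C" using assms(2) leD by (fastforce dest: subsetD)
  have le: "z \<le> y" if "z \<in> C" for z
    using subsetD [OF sub that] assms(2) by simp
  have "Complete_Partial_Order.chain (\<le>) (insert y C)"
    using C(1) le by (simp add: Complete_Partial_Order.chain_def)
  then have "insert y C \<in> rank_chains y"
    using C(1) le by (simp add: subset_iff)
  from lattice_rank_attained(2) [OF assms(1) this] show ?thesis
    using C \<open>y \<notin> C\<close> by simp
qed

lemma lattice_rank_nonneg:
  assumes "finite_length (UNIV :: 'a::bounded_lattice set)" shows "0 \<le> lattice_rank (x :: 'a)"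
proof -
  have "{bot, x} \<in> rank_chains x" by (auto simp: Complete_Partial_Order.chain_def)
  moreover have "1 \<le> card {bot, x}" by (cases "x = bot") auto
  ultimately show ?thesis using lattice_rank_attained(2) [OF assms, of "{bot, x}" x] by simp
qed

text \<open>
  Some element of rank one is below \<open>y\<close> but not below \<open>x\<close>. Its join with \<open>x\<close> is \<open>y\<close>, and
  semimodularity bounds the rank of the join.
\<close>

lemma lattice_rank_cover:
  assumes geo: "geometric_lattice TYPE('a::bounded_lattice)" and cov: "covers UNIV (x :: 'a) y"
  shows "lattice_rank y = lattice_rank x + 1"
proof -
  have fl: "finite_length (UNIV :: 'a set)" using geo by (simp add: geometric_lattice_def)
  have xy: "x < y" using cov by (simp add: covers_def)
  obtain A where A: "A \<subseteq> {a. lattice_rank a = 1}" "isLub UNIV A y"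
    using geo unfolding geometric_lattice_def by blast
  have "\<exists>p\<in>A. \<not> p \<le> x"
  proof (rule ccontr)
    assume "\<not> ?thesis"
    then have "isUb UNIV A x" by (auto intro: isUbI setleI)
    then have "y \<le> x" using A(2) isLub_le_isUb by blast
    with xy show False by simp
  qed
  then obtain p where p: "p \<in> A" "\<not> p \<le> x" by blast
  have "p \<le> y" using isLubD2 [OF A(2) p(1)] .
  then have "sup x p = y"
    using cov p(2) xy by (metis UNIV_I covers_def le_sup_iff less_le order.order_iff_strict sup.cobounded1 sup.cobounded2)
  moreover have "lattice_rank (sup x p) + lattice_rank (inf x p) \<le> lattice_rank x + lattice_rank p"
    using geo by (simp add: geometric_lattice_def)
  moreover have "lattice_rank p = 1" using A p by auto
  ultimately show ?thesis
    using lattice_rank_strict [OF fl xy] lattice_rank_nonneg [OF fl, of "inf x p"] by simp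
qed

text \<open>
  Induction on \<open>rk 1 - rk x\<close>: an element above \<open>x\<close> is \<open>x\<close> itself or lies above one of the finitely
  many covers of \<open>x\<close>.
\<close>

lemma geometric_finite:
  assumes fl: "finite_length (UNIV :: 'a::bounded_lattice set)"
    and lf: "locally_finite (UNIV :: 'a set)"
  shows "finite (UNIV :: 'a set)"
proof -
  have "finite {x..}" if "nat (lattice_rank (Orderings.top :: 'a) - lattice_rank (x :: 'a)) \<le> n" for x n
    using that
  proof (induction n arbitrary: x)
    case 0
    have "x = Orderings.top"
    proof (rule ccontr)
      assume "x \<noteq> Orderings.top"
      then have "x < Orderings.top" by (simp add: top.not_eq_extremum)
      from lattice_rank_strict [OF fl this] 0 show False by linarith
    qed
    then show ?case by (simp add: top.extremum_unique atLeast_def)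
  next
    case (Suc n)
    have sub: "{x..} \<subseteq> insert x (\<Union>z\<in>{z. covers UNIV x z}. {z..})"
    proof
      fix y assume "y \<in> {x..}"
      show "y \<in> insert x (\<Union>z\<in>{z. covers UNIV x z}. {z..})"
      proof (cases "x = y")
        case False
        then have "x < y \<and> y \<le> y" using \<open>y \<in> {x..}\<close> by simp
        from ex_has_least_nat [of "\<lambda>z. x < z \<and> z \<le> y", OF this, of "\<lambda>z. nat (lattice_rank z)"]
        obtain z where z: "x < z" "z \<le> y"
          and least: "\<And>w. x < w \<Longrightarrow> w \<le> y \<Longrightarrow> nat (lattice_rank z) \<le> nat (lattice_rank w)" by blast
        have "\<not> (x < w \<and> w < z)" for w
          using least [of w] z lattice_rank_strict [OF fl, of w z] lattice_rank_nonneg [OF fl, of w]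
          by force
        then have "covers UNIV x z" using z by (auto simp: covers_def)
        then show ?thesis using z by auto
      qed simp
    qed
    have "finite {z. covers UNIV x z}" using lf by (simp add: locally_finite_def)
    moreover have "finite {z..}" if "covers UNIV x z" for z
    proof (rule Suc.IH)
      have "lattice_rank x < lattice_rank z" using that lattice_rank_strict [OF fl] by (simp add: covers_def)
      then show "nat (lattice_rank (Orderings.top :: 'a) - lattice_rank z) \<le> n" using Suc.prems by linarith
    qed
    ultimately have "finite (insert x (\<Union>z\<in>{z. covers UNIV x z}. {z..}))" by simp
    with sub show ?case by (rule finite_subset)
  qed
  moreover have "{bot..} = (UNIV :: 'a set)" by auto
  ultimately show ?thesis by (metis order_refl)
qed

lemma geometric_semimodular:
  assumes "geometric_lattice TYPE('a::bounded_lattice)" "locally_finite (UNIV :: 'a set)"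
  shows "semimodular (lattice_rank :: 'a \<Rightarrow> int)"
proof -
  have fl: "finite_length (UNIV :: 'a set)" using assms(1) by (simp add: geometric_lattice_def)
  show ?thesis
  proof
    show "lattice_rank (sup x y) + lattice_rank (inf x y) \<le> lattice_rank x + lattice_rank (y :: 'a)" for x y
      using assms(1) by (simp add: geometric_lattice_def)
    show "finite (UNIV :: 'a set)" by (rule geometric_finite [OF fl assms(2)])
  qed (rule lattice_rank_strict [OF fl] lattice_rank_cover [OF assms(1)]; assumption)+
qed

locale proper_semimodular = semimodular rk for rk :: "'a::bounded_lattice \<Rightarrow> int" +
  fixes Q :: "'a set"
  assumes bot_top: "(bot :: 'a) \<noteq> Orderings.top" and Q_eq: "Q = UNIV - {Orderings.top}"
begin

lemma in_Q: "x \<in> Q \<longleftrightarrow> x < Orderings.top"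
  by (simp add: Q_eq top.not_eq_extremum)

lemma finite_set: "finite (A :: 'a set)"
  using finite_lattice by (rule finite_subset [rotated]) simp

lemma corank_eq: "corank Q rk x = rk Orderings.top - 1 - rk x"
proof -
  have "Q \<noteq> {}" using bot_top by (auto simp: Q_eq)
  from finite_has_maximal [OF finite_set this]
  obtain c where c: "c \<in> Q" "\<forall>b\<in>Q. c \<le> b \<longrightarrow> c = b" by blast
  have "\<not> (c < z \<and> z < Orderings.top)" for z using c(2) in_Q [of z] by auto
  then have "covers UNIV c Orderings.top" using c(1) in_Q by (simp add: covers_def)
  then have "rk Orderings.top = rk c + 1" by (rule rk_cover)
  moreover have "rk b \<le> rk Orderings.top - 1" if "b \<in> Q" for b using rk_strict [of b Orderings.top] that in_Q by auto
  ultimately have "Sup (rk ` Q) = rk Orderings.top - 1"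
    using c(1) by (intro cSup_eq_maximum) auto
  then show ?thesis by (simp add: corank_def)
qed

lemma corank_nonneg: "x \<in> Q \<Longrightarrow> 0 \<le> corank Q rk x"
  using rk_strict [of x Orderings.top] by (simp add: corank_eq in_Q)

lemma corank_strict: "x < y \<Longrightarrow> corank Q rk y < corank Q rk x"
  using rk_strict by (simp add: corank_eq)

lemma graded_Q: "graded Q rk"
proof -
  have "covers UNIV x y" if "covers Q x y" for x y
    using that by (auto simp: covers_def in_Q) 
  then show ?thesis using rk_strict rk_cover by (auto simp: graded_def)
qed

lemma bdd_Q: "bdd_above (rk ` Q)"
  using finite_set [of Q] by simp

end

section \<open>Contracting all simplices with a given last vertex\<close>

lemma inner_bdry_inner_bdry: "frag_extend inner_bdry (inner_bdry \<sigma>) = 0"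
proof (induction \<sigma> rule: inner_bdry.induct)
  case (3 a b \<sigma>)
  have "supp (inner_bdry (b # \<sigma>)) \<subseteq> - {[]}" using keys_inner_bdry [of "b # \<sigma>"] by blast
  then show ?case using 3 by (simp add: frag_lin inner_bdry_cone)
qed auto

lemma spherical_cycle:
  assumes sph: "spherical r x y H B \<rho>" and z: "supp z \<subseteq> dchains_len x y r" "frag_extend inner_bdry z = 0"
  shows "z = (\<Sum>b\<in>B. frag_cmul (coef z b) (\<rho> b))"
proof -
  let ?w = "\<Sum>b\<in>B. frag_cmul (coef z b) (\<rho> b)"
  have fin: "finite B" using sph by (rule spherical_basis)
  have "z - ?w = 0"
  proof (rule spherical_cycle_zero [OF sph])
    have "supp ?w \<subseteq> (\<Union>b\<in>B. supp (frag_cmul (coef z b) (\<rho> b)))"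
      by (rule keys_sum)
    also have "\<dots> \<subseteq> (\<Union>b\<in>B. supp (\<rho> b))" using keys_cmul by fast
    also have "\<dots> \<subseteq> dchains_len x y r" using spherical_dual(1) [OF sph] by blast
    finally show "supp (z - ?w) \<subseteq> dchains_len x y r" using z by (intro keys_diff_subset)
    have "frag_extend inner_bdry ?w = 0"
      using spherical_dual(2) [OF sph] by (simp add: frag_extend_sum [OF fin] frag_extend_cmul)
    then show "frag_extend inner_bdry (z - ?w) = 0" using z by (simp add: frag_lin)
    fix b assume b: "b \<in> B"
    have "coef ?w b = (\<Sum>b'\<in>B. coef z b' * coef (\<rho> b') b)"
      by (simp add: lookup_sum)
    also have "\<dots> = (\<Sum>b'\<in>B. if b' = b then coef z b' else 0)"
      using spherical_dual(3) [OF sph _ b] by (intro sum.cong) auto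
    also have "\<dots> = coef z b" using fin b by simp
    finally show "coef (z - ?w) b = 0" by (simp add: lookup_minus)
  qed
  then show ?thesis by simp
qed

lemma simplices_length: "\<sigma> \<in> simplices Q m \<Longrightarrow> length \<sigma> = Suc m"
  by (simp add: simplices_def)

lemma simplices_nonempty: "\<sigma> \<in> simplices Q m \<Longrightarrow> \<sigma> \<noteq> []"
  by (auto simp: simplices_def)

lemma simplices_last: "\<sigma> \<in> simplices Q m \<Longrightarrow> \<sigma> ! m = last \<sigma>"
  by (simp add: last_conv_nth simplices_length simplices_nonempty)

lemma simplices_last_in: "\<sigma> \<in> simplices Q m \<Longrightarrow> last \<sigma> \<in> Q"
  using last_in_set simplices_nonempty by (fastforce simp: simplices_def)

lemma simplices_mono: "R \<subseteq> Q \<Longrightarrow> simplices R m \<subseteq> simplices Q m"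
  by (auto simp: simplices_def)

lemma sorted_last_le: "sorted_wrt (\<ge>) (\<sigma> :: 'a::order list) \<Longrightarrow> z \<in> set \<sigma> \<Longrightarrow> last \<sigma> \<le> z"
  by (induction \<sigma>) (auto split: if_splits)

lemma simplices_last_le: "\<sigma> \<in> simplices Q m \<Longrightarrow> z \<in> set \<sigma> \<Longrightarrow> last \<sigma> \<le> z"
  by (auto simp: simplices_def intro: sorted_last_le)

lemma face_simplex:
  assumes "\<sigma> \<in> simplices Q (Suc m)" "i \<le> Suc m" shows "face i \<sigma> \<in> simplices Q m" "last \<sigma> \<le> last (face i \<sigma>)"
proof -
  have "length (face i \<sigma>) = Suc m" using assms length_face [of i \<sigma>] by (simp add: simplices_length)
  moreover have "sorted_wrt (\<ge>) (face i \<sigma>)" using assms sorted_face by (auto simp: simplices_def)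
  moreover have "set (face i \<sigma>) \<subseteq> Q" using assms set_face [of i \<sigma>] by (auto simp: simplices_def)
  ultimately show 1: "face i \<sigma> \<in> simplices Q m" by (simp add: simplices_def)
  have "last (face i \<sigma>) \<in> set \<sigma>" using set_face [of i \<sigma>] last_in_set [OF simplices_nonempty [OF 1]] by blast
  then show "last \<sigma> \<le> last (face i \<sigma>)" using simplices_last_le [OF assms(1)] by blast
qed

text \<open>
  The simplices whose values can be transported to \<open>x\<close> by the presheaf.
\<close>

definition upper :: "'a::order set \<Rightarrow> nat \<Rightarrow> 'a \<Rightarrow> 'a list set" where
  "upper Q m x = {\<tau> \<in> simplices Q m. x \<le> last \<tau>}"

lemma keys_bdry_simplex:
  assumes "\<sigma> \<in> simplices Q (Suc m)"
  shows "supp (bdry \<sigma>) \<subseteq> upper Q m (last \<sigma>)"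
proof -
  have "{face i \<sigma> |i. i < length \<sigma>} \<subseteq> upper Q m (last \<sigma>)"
    using face_simplex [OF assms] simplices_length [OF assms] by (auto simp: upper_def)
  then show ?thesis using keys_bdry [of \<sigma>] by blast
qed

text \<open>
  The strict and the degenerate lists span complementary subcomplexes. The first summand vanishes on
  strict lists and the second on degenerate ones.
\<close>

definition simplex_homotopy :: "'a::order \<Rightarrow> ('a list \<Rightarrow> 'a list \<Rightarrow>\<^sub>0 int) \<Rightarrow> 'a list \<Rightarrow> 'a list \<Rightarrow>\<^sub>0 int" where
  "simplex_homotopy x H \<sigma> = degen_homotopy \<sigma> + (if sorted_wrt (>) \<sigma> \<and> \<sigma> \<noteq> [] \<and> last \<sigma> = x then H \<sigma> else 0)"

context proper_semimodular begin

lemma dchains_Q: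
  assumes "x \<in> Q" "\<sigma> \<in> dchains x Orderings.top" shows "set \<sigma> \<subseteq> Q" "sorted_wrt (\<ge>) \<sigma>"
proof -
  show "set \<sigma> \<subseteq> Q" using assms by (auto simp: dchains_def in_Q)
  have "sorted_wrt (>) \<sigma>" using assms by (simp add: dchains_def)
  then show "sorted_wrt (\<ge>) \<sigma>" by (rule sorted_wrt_mono_rel [rotated]) auto
qed

lemma dchains_simplices:
  "x \<in> Q \<Longrightarrow> dchains_len x Orderings.top (Suc m) = {\<sigma> \<in> simplices Q m. sorted_wrt (>) \<sigma> \<and> last \<sigma> = x}"
  using dchains_Q by (auto simp: simplices_def dchains_def in_Q)

lemma simplex_homotopy_keys:
  assumes "x \<in> Q" "spherical r x Orderings.top H B \<rho>" "\<tau> \<in> simplices Q m"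
  shows "supp (simplex_homotopy x H \<tau>) \<subseteq> {\<tau>' \<in> simplices Q (Suc m). last \<tau>' = last \<tau>}"
  unfolding simplex_homotopy_def
proof (rule keys_add_subset)
  show "supp (degen_homotopy \<tau>) \<subseteq> {\<tau>' \<in> simplices Q (Suc m). last \<tau>' = last \<tau>}"
    using keys_degen_homotopy [of \<tau>] assms(3) by (auto simp: simplices_def)
  show "supp (if sorted_wrt (>) \<tau> \<and> \<tau> \<noteq> [] \<and> last \<tau> = x then H \<tau> else 0)
    \<subseteq> {\<tau>' \<in> simplices Q (Suc m). last \<tau>' = last \<tau>}"
  proof (cases "sorted_wrt (>) \<tau> \<and> \<tau> \<noteq> [] \<and> last \<tau> = x")
    case True
    then have "\<tau> \<in> dchains_len x Orderings.top (Suc m)" using assms dchains_simplices by blast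
    then have "supp (H \<tau>) \<subseteq> dchains_len x Orderings.top (Suc (Suc m))"
      using spherical_homotopy(1) [OF assms(2)] by fastforce
    then show ?thesis using True dchains_simplices [OF assms(1), of "Suc m"] by auto
  qed auto
qed

lemma keys_bdry_diff_inner_bdry:
  assumes x: "x \<in> Q" and \<tau>: "\<tau> \<in> dchains_len x Orderings.top (Suc (Suc m))"
  shows "supp (bdry \<tau> - inner_bdry \<tau>) \<subseteq> {\<tau> \<in> simplices Q m. x < last \<tau>}"
proof -
  have ne: "\<tau> \<noteq> []" "butlast \<tau> \<noteq> []" using \<tau> by (cases \<tau>; auto)+
  have "sorted_wrt (>) (butlast \<tau> @ [last \<tau>])" "last \<tau> = x" using \<tau> ne by (auto simp: dchains_def)
  then have srt: "sorted_wrt (>) (butlast \<tau>)" and lt: "x < last (butlast \<tau>)"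
    using last_in_set [OF ne(2)] by (auto simp: sorted_wrt_append)
  have "set (butlast \<tau>) \<subseteq> Q" using \<tau> dchains_Q(1) [OF x, of \<tau>] by (auto dest: in_set_butlastD)
  moreover have "sorted_wrt (\<ge>) (butlast \<tau>)" using srt by (rule sorted_wrt_mono_rel [rotated]) auto
  ultimately have "butlast \<tau> \<in> simplices Q m" using \<tau> by (simp add: simplices_def)
  moreover have "bdry \<tau> - inner_bdry \<tau> = frag_cmul ((-1) ^ length (butlast \<tau>)) (frag_of (butlast \<tau>))"
    using bdry_snoc [of "butlast \<tau>" "last \<tau>"] ne by simp
  ultimately show ?thesis using lt keys_cmul by fastforce
qed

lemma extend_bdry_inner_bdry: "frag_extend bdry z = frag_extend inner_bdry z + frag_extend (\<lambda>\<tau>. bdry \<tau> - inner_bdry \<tau>) z"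
  by (rule frag_ext_eq [of z UNIV]) (auto simp: frag_lin)

text \<open>
  The chain \<open>j\<close> collects the faces that lose the last vertex \<open>x\<close>; relative cochains vanish on it. In
  degree \<open>n\<close> the strict chains have maximal length, so \<open>H\<close> vanishes on them, and \<open>\<sigma> \<mapsto> \<pi>\<close> is a
  projection to the cycles.
\<close>

lemma simplex_homotopy:
  assumes x: "x \<in> Q" and n: "corank Q rk x = int n" and sph: "spherical (Suc n) x Orderings.top H B \<rho>"
    and \<sigma>: "\<sigma> \<in> simplices Q m" "last \<sigma> = x"
  obtains j \<pi> where
    "frag_extend bdry (simplex_homotopy x H \<sigma>) + frag_extend (simplex_homotopy x H) (bdry \<sigma>) = frag_of \<sigma> + j - \<pi>"
    "supp j \<subseteq> {\<tau> \<in> simplices Q m. x < last \<tau>}"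
    "supp \<pi> \<subseteq> dchains_len x Orderings.top (Suc n)" "frag_extend inner_bdry \<pi> = 0" "m \<noteq> n \<Longrightarrow> \<pi> = 0"
proof -
  let ?N = "\<lambda>\<sigma>. if sorted_wrt (>) \<sigma> \<and> \<sigma> \<noteq> [] \<and> last \<sigma> = x then H \<sigma> else 0"
  let ?top = "Orderings.top"
  have split: "frag_extend (simplex_homotopy x H) z = frag_extend degen_homotopy z + frag_extend ?N (nd_part z)" for z
    by (rule frag_ext_eq [of z UNIV]) (auto simp: frag_lin simplex_homotopy_def nd_part_def)
  have weak: "sorted_wrt (\<ge>) \<sigma>" using \<sigma> by (simp add: simplices_def)
  show thesis
  proof (cases "sorted_wrt (>) \<sigma>")
    case False
    have "frag_extend bdry (simplex_homotopy x H \<sigma>) + frag_extend (simplex_homotopy x H) (bdry \<sigma>) = frag_of \<sigma> + 0 - 0"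
      using degen_homotopy_identity [OF weak] nd_part_bdry [OF weak False] False
      by (simp add: split) (simp add: simplex_homotopy_def)
    then show ?thesis by (rule that) auto
  next
    case True
    have ch: "\<sigma> \<in> dchains_len x ?top (Suc m)" using dchains_simplices [OF x] \<sigma> True by blast
    define j where "j = frag_extend (\<lambda>\<tau>. bdry \<tau> - inner_bdry \<tau>) (H \<sigma>)"
    have bdry_eq: "bdry \<tau> = inner_bdry \<tau> + frag_cmul ((-1) ^ length (butlast \<tau>)) (frag_of (butlast \<tau>))" if "\<tau> \<noteq> []" for \<tau> :: "'a list"
      using bdry_snoc [of "butlast \<tau>" "last \<tau>"] that by simp
    have strict: "sorted_wrt (>) (butlast \<tau>) \<and> (butlast \<tau> \<noteq> [] \<longrightarrow> x < last (butlast \<tau>))"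
      if "\<tau> \<in> dchains x ?top" for \<tau>
    proof -
      have "sorted_wrt (>) (butlast \<tau> @ [last \<tau>])" "last \<tau> = x"
        using that by (auto simp: dchains_def)
      then show ?thesis using last_in_set [of "butlast \<tau>"] by (auto simp: sorted_wrt_append)
    qed
    have Hk: "supp (H \<sigma>) \<subseteq> dchains_len x ?top (Suc (Suc m))"
      using spherical_homotopy(1) [OF sph, of \<sigma>] ch by auto
    have hs: "simplex_homotopy x H \<sigma> = H \<sigma>"
      using True degen_homotopy_strict [OF True] \<sigma> simplices_nonempty [OF \<sigma>(1)] by (simp add: simplex_homotopy_def)
    have bH: "frag_extend bdry (H \<sigma>) = frag_extend inner_bdry (H \<sigma>) + j"
      unfolding j_def by (rule extend_bdry_inner_bdry)
    have kj: "supp j \<subseteq> {\<tau> \<in> simplices Q m. x < last \<tau>}"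
      unfolding j_def by (rule keys_extend_subset [OF Hk keys_bdry_diff_inner_bdry [OF x]])
    have kb: "supp (inner_bdry \<sigma>) \<subseteq> {\<tau> \<in> dchains x ?top. length \<tau> = m}"
      using keys_inner_bdry_dchains [of \<sigma> x ?top] ch by auto
    have h_eq: "simplex_homotopy x H \<tau> = H \<tau>" if "\<tau> \<in> dchains x ?top" for \<tau>
      using that degen_homotopy_strict [of \<tau>] by (simp add: simplex_homotopy_def dchains_def)
    have "simplex_homotopy x H (butlast \<sigma>) = 0"
      using strict [of \<sigma>] ch degen_homotopy_strict [of "butlast \<sigma>"] by (auto simp: simplex_homotopy_def)
    moreover have "\<sigma> \<noteq> []" using ch by auto
    ultimately have "frag_extend (simplex_homotopy x H) (bdry \<sigma>) = frag_extend (simplex_homotopy x H) (inner_bdry \<sigma>)"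
      by (simp add: bdry_eq frag_lin frag_extend_cmul)
    also have "\<dots> = frag_extend H (inner_bdry \<sigma>)" using kb h_eq by (intro frag_extend_eq) auto
    finally have bh: "frag_extend (simplex_homotopy x H) (bdry \<sigma>) = frag_extend H (inner_bdry \<sigma>)" .
    show ?thesis
    proof (cases "m = n")
      case False
      then have "frag_extend inner_bdry (H \<sigma>) + frag_extend H (inner_bdry \<sigma>) = frag_of \<sigma>"
        using spherical_homotopy(2) [OF sph, of \<sigma>] ch by simp
      then have "frag_extend bdry (simplex_homotopy x H \<sigma>) + frag_extend (simplex_homotopy x H) (bdry \<sigma>) = frag_of \<sigma> + j - 0"
        unfolding hs bh bH by (simp add: algebra_simps)
      then show ?thesis by (rule that) (use kj in auto)
    next
      case True
      have "dchains_len x ?top (Suc (Suc m)) = {}"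
        using length_chain [of _ x ?top] n True by (fastforce simp: corank_eq)
      with Hk have "supp (H \<sigma>) \<subseteq> {}" by (simp only:)
      then have H0: "H \<sigma> = 0" by simp
      define \<pi> where "\<pi> = frag_of \<sigma> - frag_extend H (inner_bdry \<sigma>)"
      have j0: "j = 0" by (simp add: j_def H0)
      show ?thesis
      proof (rule that [of j \<pi>])
        show "frag_extend bdry (simplex_homotopy x H \<sigma>) + frag_extend (simplex_homotopy x H) (bdry \<sigma>) = frag_of \<sigma> + j - \<pi>"
          unfolding hs bh by (simp add: H0 \<pi>_def j0)
        have "supp (frag_extend H (inner_bdry \<sigma>)) \<subseteq> dchains_len x ?top (Suc n)"
          using spherical_homotopy(1) [OF sph] True by (intro keys_extend_subset [OF kb]) blast
        then show "supp \<pi> \<subseteq> dchains_len x ?top (Suc n)"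
          unfolding \<pi>_def using ch True by (intro keys_diff_subset) auto
        have "frag_extend inner_bdry (frag_extend H z) = z - frag_extend H (frag_extend inner_bdry z)"
          if "supp z \<subseteq> {\<tau> \<in> dchains x ?top. length \<tau> = m}" for z
          by (rule frag_ext_eq [OF that])
            (use True in \<open>auto simp: frag_lin eq_diff_eq spherical_homotopy(2) [OF sph]\<close>)
        from this [OF kb] show "frag_extend inner_bdry \<pi> = 0"
          by (simp add: \<pi>_def frag_lin inner_bdry_inner_bdry)
      qed (use kj True in auto)
    qed
  qed
qed

end

section \<open>Evaluating integral chains in an abelian group\<close>

text \<open>
  The homomorphism on integral chains that extends \<open>f\<close>, written multiplicatively.
\<close>

definition frag_eval :: "('b, 'm) monoid_scheme \<Rightarrow> ('c \<Rightarrow> 'b) \<Rightarrow> ('c \<Rightarrow>\<^sub>0 int) \<Rightarrow> 'b" where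
  "frag_eval G f z = finprod G (\<lambda>\<tau>. f \<tau> [^]\<^bsub>G\<^esub> coef z \<tau>) (supp z)"

context comm_group begin

lemma frag_eval_0 [simp]: "frag_eval G f 0 = \<one>"
  by (simp add: frag_eval_def)

lemma frag_eval_superset:
  assumes "supp z \<subseteq> K" "finite K" "f ` K \<subseteq> carrier G"
  shows "frag_eval G f z = finprod G (\<lambda>\<tau>. f \<tau> [^] coef z \<tau>) K"
  unfolding frag_eval_def using assms
  by (intro finprod_mono_neutral_cong_left) (auto simp: in_keys_iff)

lemma frag_eval_closed:
  assumes "supp z \<subseteq> S" "f ` S \<subseteq> carrier G" shows "frag_eval G f z \<in> carrier G"
  unfolding frag_eval_def using assms by (intro finprod_closed) auto

lemma frag_eval_cmul_of:
  assumes "f \<tau> \<in> carrier G" shows "frag_eval G f (frag_cmul c (frag_of \<tau>)) = f \<tau> [^] c"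
proof -
  have "frag_eval G f (frag_cmul c (frag_of \<tau>)) =
      finprod G (\<lambda>\<sigma>. f \<sigma> [^] coef (frag_cmul c (frag_of \<tau>)) \<sigma>) {\<tau>}"
    using assms keys_cmul [of c "frag_of \<tau>"] by (intro frag_eval_superset) auto
  then show ?thesis using assms by simp
qed

lemma frag_eval_of: "f \<tau> \<in> carrier G \<Longrightarrow> frag_eval G f (frag_of \<tau>) = f \<tau>"
  using frag_eval_cmul_of [of f \<tau> 1] by simp

lemma frag_eval_add:
  assumes "supp u \<subseteq> S" "supp v \<subseteq> S" "f ` S \<subseteq> carrier G"
  shows "frag_eval G f (u + v) = frag_eval G f u \<otimes> frag_eval G f v"
proof -
  let ?K = "supp u \<union> supp v"
  have K: "finite ?K" "f ` ?K \<subseteq> carrier G" using assms by auto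
  have "frag_eval G f (u + v) = finprod G (\<lambda>\<tau>. f \<tau> [^] coef (u + v) \<tau>) ?K"
    using K Poly_Mapping.keys_add [of u v] by (intro frag_eval_superset)
  also have "\<dots> = finprod G (\<lambda>\<tau>. f \<tau> [^] coef u \<tau> \<otimes> f \<tau> [^] coef v \<tau>) ?K"
    using K(2) by (intro finprod_cong') (auto simp: lookup_add int_pow_mult image_subset_iff)
  also have "\<dots> = finprod G (\<lambda>\<tau>. f \<tau> [^] coef u \<tau>) ?K \<otimes>
      finprod G (\<lambda>\<tau>. f \<tau> [^] coef v \<tau>) ?K"
    using K(2) by (intro finprod_multf) auto
  also have "\<dots> = frag_eval G f u \<otimes> frag_eval G f v"
    using K by (simp add: frag_eval_superset [of u ?K] frag_eval_superset [of v ?K])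
  finally show ?thesis .
qed

lemma frag_eval_diff:
  assumes "supp u \<subseteq> S" "supp v \<subseteq> S" "f ` S \<subseteq> carrier G"
  shows "frag_eval G f (u - v) = frag_eval G f u \<otimes> inv frag_eval G f v"
proof -
  have "frag_eval G f (u - v + v) = frag_eval G f (u - v) \<otimes> frag_eval G f v"
    using assms by (intro frag_eval_add [of _ S] keys_diff_subset)
  then show ?thesis
    using frag_eval_closed [OF assms(1,3)] frag_eval_closed [OF assms(2,3)]
      frag_eval_closed [OF keys_diff_subset [OF assms(1,2)] assms(3)]
    by (simp add: m_assoc)
qed

lemma frag_eval_hom:
  "f ` S \<subseteq> carrier G \<Longrightarrow> frag_eval G f \<in> hom (free_Abelian_group S) G"
  by (intro homI) (auto intro: frag_eval_closed frag_eval_add [of _ S])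

lemma frag_eval_cong:
  assumes "\<And>\<tau>. \<tau> \<in> supp z \<Longrightarrow> f \<tau> = g \<tau>" "g ` supp z \<subseteq> carrier G"
  shows "frag_eval G f z = frag_eval G g z"
  unfolding frag_eval_def using assms by (intro finprod_cong') auto

lemma frag_eval_one:
  assumes "\<And>\<tau>. \<tau> \<in> supp z \<Longrightarrow> f \<tau> = \<one>" shows "frag_eval G f z = \<one>"
proof -
  have "frag_eval G f z = frag_eval G (\<lambda>_. \<one>) z" by (rule frag_eval_cong) (use assms in auto)
  also have "\<dots> = \<one>" unfolding frag_eval_def by (rule finprod_one_eqI) simp
  finally show ?thesis .
qed

lemma frag_eval_extend:
  assumes "supp z \<subseteq> S" "\<And>\<sigma>. \<sigma> \<in> S \<Longrightarrow> supp (g \<sigma>) \<subseteq> T" "f ` T \<subseteq> carrier G"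
  shows "frag_eval G f (frag_extend g z) = frag_eval G (\<lambda>\<sigma>. frag_eval G f (g \<sigma>)) z"
proof -
  have c: "(\<lambda>\<sigma>. frag_eval G f (g \<sigma>)) ` S \<subseteq> carrier G"
    using frag_eval_closed [OF assms(2,3)] by (simp add: image_subset_iff)
  from assms(1)
  have "supp z \<subseteq> S \<and> frag_eval G f (frag_extend g z) = frag_eval G (\<lambda>\<sigma>. frag_eval G f (g \<sigma>)) z"
  proof (induction z rule: frag_induction)
    case (one \<sigma>)
    with c show ?case by (simp add: frag_eval_of image_subset_iff)
  next
    case (diff a b)
    then have k: "supp a \<subseteq> S" "supp b \<subseteq> S"
      and e: "frag_eval G f (frag_extend g a) = frag_eval G (\<lambda>\<sigma>. frag_eval G f (g \<sigma>)) a"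
        "frag_eval G f (frag_extend g b) = frag_eval G (\<lambda>\<sigma>. frag_eval G f (g \<sigma>)) b" by auto
    have k': "supp (frag_extend g a) \<subseteq> T" "supp (frag_extend g b) \<subseteq> T"
      using keys_extend_subset [OF k(1) assms(2)] keys_extend_subset [OF k(2) assms(2)] by auto
    show ?case
      by (simp only: frag_extend_diff frag_eval_diff [OF k' assms(3)] frag_eval_diff [OF k c] e
          keys_diff_subset [OF k])
  qed auto
  then show ?thesis by simp
qed

lemma frag_eval_mult:
  assumes "supp z \<subseteq> S" "f ` S \<subseteq> carrier G" "g ` S \<subseteq> carrier G"
  shows "frag_eval G (\<lambda>\<tau>. f \<tau> \<otimes> g \<tau>) z = frag_eval G f z \<otimes> frag_eval G g z"
proof -
  have c: "f \<tau> \<in> carrier G" "g \<tau> \<in> carrier G" if "\<tau> \<in> supp z" for \<tau> using that assms by auto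
  have "frag_eval G (\<lambda>\<tau>. f \<tau> \<otimes> g \<tau>) z =
      finprod G (\<lambda>\<tau>. f \<tau> [^] coef z \<tau> \<otimes> g \<tau> [^] coef z \<tau>) (supp z)"
    unfolding frag_eval_def using c by (intro finprod_cong') (auto simp: int_pow_mult_distrib m_comm)
  also have "\<dots> = frag_eval G f z \<otimes> frag_eval G g z"
    unfolding frag_eval_def using c by (intro finprod_multf) auto
  finally show ?thesis .
qed

lemma frag_eval_sum:
  assumes "finite I" "\<And>i. i \<in> I \<Longrightarrow> supp (z i) \<subseteq> S" "f ` S \<subseteq> carrier G"
  shows "frag_eval G f (sum z I) = finprod G (\<lambda>i. frag_eval G f (z i)) I"
  using assms(1,2)
proof (induction I rule: finite_induct)
  case (insert i I)
  have "supp (sum z I) \<subseteq> S" using keys_sum [of z I] insert.prems by blast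
  moreover have "(\<lambda>i. frag_eval G f (z i)) \<in> I \<rightarrow> carrier G"
    using insert.prems assms(3) by (auto intro: frag_eval_closed)
  moreover have "frag_eval G f (z i) \<in> carrier G"
    using insert.prems assms(3) by (intro frag_eval_closed [of _ S]) auto
  ultimately show ?case
    using insert assms(3) by (simp add: frag_eval_add [of _ S])
qed simp

lemma frag_eval_cmul:
  assumes "supp z \<subseteq> S" "f ` S \<subseteq> carrier G" "frag_eval G f z = \<one>"
  shows "frag_eval G f (frag_cmul c z) = \<one>"
proof -
  have "supp (frag_cmul c z) \<subseteq> S \<and> frag_eval G f (frag_cmul c z) = \<one>"
    by (rule frag_closure_minus_cmul)
      (use assms in \<open>auto simp: frag_eval_diff [of _ S] dest: subsetD [OF keys_diff]\<close>)
  then show ?thesis by simp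
qed

end

text \<open>
  Applied to the restriction maps of a presheaf, it transports evaluations from one group to another.
\<close>

lemma hom_frag_eval:
  assumes "comm_group G" "comm_group H" "h \<in> hom G H" "f ` supp z \<subseteq> carrier G"
  shows "h (frag_eval G f z) = frag_eval H (\<lambda>\<tau>. h (f \<tau>)) z"
proof -
  interpret G: comm_group G by fact
  interpret H: comm_group H by fact
  interpret group_hom G H h using assms(3) by unfold_locales
  let ?S = "supp z"
  have hf: "(\<lambda>\<tau>. h (f \<tau>)) ` ?S \<subseteq> carrier H" using assms(4) by auto
  have "supp w \<subseteq> ?S \<and> h (frag_eval G f w) = frag_eval H (\<lambda>\<tau>. h (f \<tau>)) w"
    if "supp w \<subseteq> ?S" for w
    using that
  proof (induction w rule: frag_induction)
    case (one \<sigma>)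
    then show ?case using assms(4) hf by (auto simp: G.frag_eval_of H.frag_eval_of)
  next
    case (diff a b)
    then have k: "supp a \<subseteq> ?S" "supp b \<subseteq> ?S" by auto
    then show ?case
      using diff keys_diff_subset [OF k] G.frag_eval_closed [OF k(1) assms(4)] G.frag_eval_closed [OF k(2) assms(4)]
      by (simp add: G.frag_eval_diff [OF k assms(4)] H.frag_eval_diff [OF k hf])
  qed auto
  then show ?thesis by blast
qed

section \<open>Cochains with values in a presheaf\<close>

text \<open>
  A cochain extended to a homomorphism on chains, with all values transported to \<open>x\<close>. This makes the
  differential precomposition with the boundary, so that identities of integral chains imply the
  corresponding ones for cochains with values in a presheaf.
\<close>

definition coeval :: "('a, 'b) presheaf \<Rightarrow> 'a \<Rightarrow> ('a list \<Rightarrow> 'b) \<Rightarrow> ('a list \<Rightarrow>\<^sub>0 int) \<Rightarrow> 'b" where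
  "coeval F x s = frag_eval (sec F x) (\<lambda>\<tau>. res F (last \<tau>) x (s \<tau>))"

locale presheaf_on =
  fixes Q :: "'a::order set" and F :: "('a, 'b) presheaf"
  assumes presheaf: "is_presheaf Q F"
begin

lemma sec_group: "x \<in> Q \<Longrightarrow> comm_group (sec F x)"
  using presheaf by (simp add: is_presheaf_def)

lemma sec_grp: "x \<in> Q \<Longrightarrow> group (sec F x)"
  using sec_group comm_group_def by blast

lemma res_hom: "x \<in> Q \<Longrightarrow> y \<in> Q \<Longrightarrow> x \<le> y \<Longrightarrow> res F y x \<in> hom (sec F y) (sec F x)"
  using presheaf by (simp add: is_presheaf_def)

lemma res_id: "x \<in> Q \<Longrightarrow> a \<in> carrier (sec F x) \<Longrightarrow> res F x x a = a"
  using presheaf by (simp add: is_presheaf_def)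

lemma res_comp:
  assumes "x \<in> Q" "y \<in> Q" "z \<in> Q" "x \<le> y" "y \<le> z" "a \<in> carrier (sec F z)"
  shows "res F z x a = res F y x (res F z y a)"
proof -
  have "\<forall>x\<in>Q. \<forall>y\<in>Q. \<forall>z\<in>Q. x \<le> y \<longrightarrow> y \<le> z \<longrightarrow>
        (\<forall>a\<in>carrier (sec F z). res F z x a = res F y x (res F z y a))"
    using presheaf unfolding is_presheaf_def by (elim conjE)
  with assms show ?thesis by blast
qed

lemma sec_last: "\<sigma> \<in> simplices Q n \<Longrightarrow> comm_group (sec F (\<sigma> ! n)) \<and> group (sec F (\<sigma> ! n))"
  by (simp add: simplices_last simplices_last_in sec_group sec_grp)

lemma cochains_group: "R \<subseteq> Q \<Longrightarrow> comm_group (cochains R F n)"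
proof -
  assume R: "R \<subseteq> Q"
  have g: "comm_group (sec F (\<sigma> ! n))" "group (sec F (\<sigma> ! n))" if "\<sigma> \<in> simplices R n" for \<sigma>
    using that simplices_mono [OF R] sec_last by blast+
  show ?thesis unfolding cochains_def
  proof (rule group.group_comm_groupI)
    show "group (product_group (simplices R n) (\<lambda>\<sigma>. sec F (\<sigma> ! n)))" using g by simp
  next
    fix s t assume "s \<in> carrier (product_group (simplices R n) (\<lambda>\<sigma>. sec F (\<sigma> ! n)))"
      "t \<in> carrier (product_group (simplices R n) (\<lambda>\<sigma>. sec F (\<sigma> ! n)))"
    then show "s \<otimes>\<^bsub>product_group (simplices R n) (\<lambda>\<sigma>. sec F (\<sigma> ! n))\<^esub> t =
        t \<otimes>\<^bsub>product_group (simplices R n) (\<lambda>\<sigma>. sec F (\<sigma> ! n))\<^esub> s"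
      unfolding mult_product_group carrier_product_group
      by (intro restrict_ext comm_groupE(4) [OF g(1)]) (auto simp: PiE_iff)
  qed
qed

lemma cochains_in: "s \<in> carrier (cochains R F n) \<Longrightarrow> \<sigma> \<in> simplices R n \<Longrightarrow> s \<sigma> \<in> carrier (sec F (last \<sigma>))"
  by (force simp: cochains_def PiE_iff simplices_last)

lemma coeval_values:
  assumes "R \<subseteq> Q" "x \<in> Q" "s \<in> carrier (cochains R F n)"
  shows "(\<lambda>\<tau>. res F (last \<tau>) x (s \<tau>)) ` upper R n x \<subseteq> carrier (sec F x)"
proof clarify
  fix \<tau> assume "\<tau> \<in> upper R n x"
  then have t: "\<tau> \<in> simplices R n" "x \<le> last \<tau>" by (auto simp: upper_def)
  then have "last \<tau> \<in> Q" using simplices_last_in assms(1) by blast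
  then show "res F (last \<tau>) x (s \<tau>) \<in> carrier (sec F x)"
    using res_hom [OF assms(2)] t cochains_in [OF assms(3) t(1)] by (auto simp: hom_def)
qed

lemma coeval_closed:
  assumes "R \<subseteq> Q" "x \<in> Q" "s \<in> carrier (cochains R F n)" "supp z \<subseteq> upper R n x"
  shows "coeval F x s z \<in> carrier (sec F x)"
  unfolding coeval_def by (rule comm_group.frag_eval_closed [OF sec_group assms(4) coeval_values]) fact+

lemma coeval_add:
  assumes "R \<subseteq> Q" "x \<in> Q" "s \<in> carrier (cochains R F n)"
    "supp u \<subseteq> upper R n x" "supp v \<subseteq> upper R n x"
  shows "coeval F x s (u + v) = coeval F x s u \<otimes>\<^bsub>sec F x\<^esub> coeval F x s v"
  unfolding coeval_def by (rule comm_group.frag_eval_add [OF sec_group assms(4,5) coeval_values]) fact+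

lemma coeval_diff:
  assumes "R \<subseteq> Q" "x \<in> Q" "s \<in> carrier (cochains R F n)"
    "supp u \<subseteq> upper R n x" "supp v \<subseteq> upper R n x"
  shows "coeval F x s (u - v) = coeval F x s u \<otimes>\<^bsub>sec F x\<^esub> inv\<^bsub>sec F x\<^esub> coeval F x s v"
  unfolding coeval_def by (rule comm_group.frag_eval_diff [OF sec_group assms(4,5) coeval_values]) fact+

lemma coeval_of:
  assumes "R \<subseteq> Q" "\<sigma> \<in> simplices R n" "s \<in> carrier (cochains R F n)"
  shows "coeval F (last \<sigma>) s (frag_of \<sigma>) = s \<sigma>"
proof -
  have "last \<sigma> \<in> Q" using assms simplices_last_in by blast
  moreover have "s \<sigma> \<in> carrier (sec F (last \<sigma>))" using assms cochains_in by blast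
  ultimately show ?thesis
    by (simp add: coeval_def comm_group.frag_eval_of [OF sec_group] res_id)
qed

lemma differential_eq:
  assumes "R \<subseteq> Q" "s \<in> carrier (cochains R F n)" "\<sigma> \<in> simplices R (Suc n)"
  shows "differential R F n s \<sigma> = coeval F (last \<sigma>) s (bdry \<sigma>)"
proof -
  let ?x = "last \<sigma>" and ?f = "\<lambda>\<tau>. res F (last \<tau>) (last \<sigma>) (s \<tau>)"
  have x: "?x \<in> Q" using assms simplices_last_in by blast
  interpret G: comm_group "sec F ?x" using sec_group [OF x] .
  have up: "face i \<sigma> \<in> upper R n ?x" if "i \<le> Suc n" for i
    using face_simplex [OF assms(3) that] by (simp add: upper_def)
  have c: "?f (face i \<sigma>) \<in> carrier (sec F ?x)" if "i \<le> Suc n" for i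
    using coeval_values [OF assms(1) x assms(2)] up [OF that] by blast
  have len: "length \<sigma> = Suc (Suc n)" using assms(3) by (simp add: simplices_length)
  have lf: "last (face i \<sigma>) = ?x" if "i \<le> n" for i using that len by (auto simp: face_def)
  have f: "?f (face i \<sigma>) = s (face i \<sigma>)" if "i \<le> n" for i
    using that face_simplex(1) [OF assms(3), of i] cochains_in [OF assms(2)] lf [OF that] res_id [OF x] by force
  have c': "s (face i \<sigma>) \<in> carrier (sec F ?x)" if "i \<le> n" for i
    using c [of i] f [OF that] that by simp
  have ll: "last (face (Suc n) \<sigma>) = \<sigma> ! n"
    using len by (auto simp: face_def last_conv_nth take_Suc_conv_app_nth)
  have "coeval F ?x s (bdry \<sigma>) =
      finprod (sec F ?x) (\<lambda>i. frag_eval (sec F ?x) ?f (frag_cmul ((-1) ^ i) (frag_of (face i \<sigma>)))) {..<length \<sigma>}"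
    unfolding coeval_def bdry_face
    by (rule G.frag_eval_sum [OF _ _ coeval_values [OF assms(1) x assms(2)]])
      (use up len in \<open>auto simp: less_Suc_eq_le\<close>)
  also have "\<dots> = finprod (sec F ?x) (\<lambda>i. ?f (face i \<sigma>) [^]\<^bsub>sec F ?x\<^esub> ((-1) ^ i :: int)) {..<length \<sigma>}"
    using c len by (intro G.finprod_cong') (auto simp: G.frag_eval_cmul_of less_Suc_eq_le)
  also have "{..<length \<sigma>} = insert (Suc n) {0..n}" using len by auto
  also have "finprod (sec F ?x) (\<lambda>i. ?f (face i \<sigma>) [^]\<^bsub>sec F ?x\<^esub> ((-1) ^ i :: int)) (insert (Suc n) {0..n})
      = ?f (face (Suc n) \<sigma>) [^]\<^bsub>sec F ?x\<^esub> ((-1) ^ Suc n :: int) \<otimes>\<^bsub>sec F ?x\<^esub>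
        finprod (sec F ?x) (\<lambda>i. ?f (face i \<sigma>) [^]\<^bsub>sec F ?x\<^esub> ((-1) ^ i :: int)) {0..n}"
    using c by (intro G.finprod_insert) auto
  also have "finprod (sec F ?x) (\<lambda>i. ?f (face i \<sigma>) [^]\<^bsub>sec F ?x\<^esub> ((-1) ^ i :: int)) {0..n}
      = finprod (sec F ?x) (\<lambda>i. s (face i \<sigma>) [^]\<^bsub>sec F ?x\<^esub> ((-1) ^ i :: int)) {0..n}"
    using c' f by (intro G.finprod_cong') auto
  finally have "coeval F ?x s (bdry \<sigma>) = finprod (sec F ?x) (\<lambda>i. s (face i \<sigma>) [^]\<^bsub>sec F ?x\<^esub> ((-1) ^ i :: int)) {0..n}
      \<otimes>\<^bsub>sec F ?x\<^esub> ?f (face (Suc n) \<sigma>) [^]\<^bsub>sec F ?x\<^esub> ((-1) ^ Suc n :: int)"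
    using c [of "Suc n"] c' by (simp add: G.m_comm)
  then show ?thesis
    unfolding differential_def using assms(3) ll by (simp add: simplices_last Let_def)
qed

lemma differential_closed:
  assumes "R \<subseteq> Q" "s \<in> carrier (cochains R F n)"
  shows "differential R F n s \<in> carrier (cochains R F (Suc n))"
proof -
  have "differential R F n s \<in> extensional (simplices R (Suc n))"
    by (simp add: differential_def)
  moreover have "differential R F n s \<sigma> \<in> carrier (sec F (\<sigma> ! Suc n))" if s: "\<sigma> \<in> simplices R (Suc n)" for \<sigma>
    unfolding differential_eq [OF assms s] simplices_last [OF s]
    using simplices_last_in [OF s] assms by (intro coeval_closed [OF assms(1) _ assms(2) keys_bdry_simplex [OF s]]) auto
  ultimately show ?thesis by (auto simp: cochains_def PiE_iff)
qed

lemma cochains_mult: "\<sigma> \<in> simplices R n \<Longrightarrow> (s \<otimes>\<^bsub>cochains R F n\<^esub> t) \<sigma> = s \<sigma> \<otimes>\<^bsub>sec F (last \<sigma>)\<^esub> t \<sigma>"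
  by (simp add: cochains_def simplices_last)

lemma cochains_one: "\<sigma> \<in> simplices R n \<Longrightarrow> \<one>\<^bsub>cochains R F n\<^esub> \<sigma> = \<one>\<^bsub>sec F (last \<sigma>)\<^esub>"
  by (simp add: cochains_def simplices_last)

lemma cochains_eqI:
  assumes "s \<in> carrier (cochains R F n)" "t \<in> carrier (cochains R F n)" "\<And>\<sigma>. \<sigma> \<in> simplices R n \<Longrightarrow> s \<sigma> = t \<sigma>"
  shows "s = t"
  using assms by (auto simp: cochains_def intro: PiE_ext)

lemma coeval_mult:
  assumes "R \<subseteq> Q" "x \<in> Q" "s \<in> carrier (cochains R F n)" "t \<in> carrier (cochains R F n)"
    "supp z \<subseteq> upper R n x"
  shows "coeval F x (s \<otimes>\<^bsub>cochains R F n\<^esub> t) z = coeval F x s z \<otimes>\<^bsub>sec F x\<^esub> coeval F x t z"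
proof -
  interpret G: comm_group "sec F x" using sec_group [OF assms(2)] .
  note v = coeval_values [OF assms(1,2)]
  have "coeval F x (s \<otimes>\<^bsub>cochains R F n\<^esub> t) z =
      frag_eval (sec F x) (\<lambda>\<tau>. res F (last \<tau>) x (s \<tau>) \<otimes>\<^bsub>sec F x\<^esub> res F (last \<tau>) x (t \<tau>)) z"
    unfolding coeval_def
  proof (rule G.frag_eval_cong)
    fix \<tau> assume "\<tau> \<in> supp z"
    then have t: "\<tau> \<in> simplices R n" "x \<le> last \<tau>" using assms(5) by (auto simp: upper_def)
    then have "last \<tau> \<in> Q" using simplices_last_in assms(1) by blast
    then show "res F (last \<tau>) x ((s \<otimes>\<^bsub>cochains R F n\<^esub> t) \<tau>) =
        res F (last \<tau>) x (s \<tau>) \<otimes>\<^bsub>sec F x\<^esub> res F (last \<tau>) x (t \<tau>)"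
      using res_hom [OF assms(2) _ t(2)] cochains_in [OF assms(3) t(1)] cochains_in [OF assms(4) t(1)]
      by (simp add: cochains_mult [OF t(1)] hom_mult)
  next
    show "(\<lambda>\<tau>. res F (last \<tau>) x (s \<tau>) \<otimes>\<^bsub>sec F x\<^esub> res F (last \<tau>) x (t \<tau>)) ` supp z \<subseteq> carrier (sec F x)"
      using v [OF assms(3)] v [OF assms(4)] assms(5) by (auto simp: image_subset_iff subset_iff)
  qed
  also have "\<dots> = coeval F x s z \<otimes>\<^bsub>sec F x\<^esub> coeval F x t z"
    unfolding coeval_def using v assms by (intro G.frag_eval_mult [OF assms(5)]) auto
  finally show ?thesis .
qed

lemma coeval_differential:
  assumes "R \<subseteq> Q" "x \<in> Q" "s \<in> carrier (cochains R F n)" "supp z \<subseteq> upper R (Suc n) x"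
  shows "coeval F x (differential R F n s) z = coeval F x s (frag_extend bdry z)"
proof -
  let ?f = "\<lambda>\<tau>. res F (last \<tau>) x (s \<tau>)"
  interpret G: comm_group "sec F x" using sec_group [OF assms(2)] .
  have up: "supp (bdry \<sigma>) \<subseteq> upper R n x" if "\<sigma> \<in> upper R (Suc n) x" for \<sigma>
    using keys_bdry_simplex [of \<sigma> R n] that by (auto simp: upper_def)
  have "coeval F x s (frag_extend bdry z) = frag_eval (sec F x) (\<lambda>\<sigma>. frag_eval (sec F x) ?f (bdry \<sigma>)) z"
    unfolding coeval_def
    by (rule G.frag_eval_extend [OF assms(4) up coeval_values [OF assms(1-3)]])
  moreover have "coeval F x (differential R F n s) z = frag_eval (sec F x) (\<lambda>\<sigma>. frag_eval (sec F x) ?f (bdry \<sigma>)) z"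
    unfolding coeval_def
  proof (rule G.frag_eval_cong)
    fix \<sigma> assume "\<sigma> \<in> supp z"
    then have s: "\<sigma> \<in> simplices R (Suc n)" "x \<le> last \<sigma>" using assms(4) by (auto simp: upper_def)
    let ?y = "last \<sigma>"
    have y: "?y \<in> Q" using simplices_last_in s assms(1) by blast
    have k: "supp (bdry \<sigma>) \<subseteq> upper R n ?y" by (rule keys_bdry_simplex [OF s(1)])
    have "res F ?y x (differential R F n s \<sigma>) =
        res F ?y x (frag_eval (sec F ?y) (\<lambda>\<tau>. res F (last \<tau>) ?y (s \<tau>)) (bdry \<sigma>))"
      by (simp add: differential_eq [OF assms(1,3) s(1)] coeval_def)
    also have "\<dots> = frag_eval (sec F x) (\<lambda>\<tau>. res F ?y x (res F (last \<tau>) ?y (s \<tau>))) (bdry \<sigma>)"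
      using coeval_values [OF assms(1) y assms(3)] k
      by (intro hom_frag_eval [OF sec_group [OF y] sec_group [OF assms(2)] res_hom [OF assms(2) y s(2)]]) blast
    also have "\<dots> = frag_eval (sec F x) ?f (bdry \<sigma>)"
    proof (rule G.frag_eval_cong)
      fix \<tau> assume "\<tau> \<in> supp (bdry \<sigma>)"
      then have t: "\<tau> \<in> simplices R n" "?y \<le> last \<tau>" using k by (auto simp: upper_def)
      then have "last \<tau> \<in> Q" using simplices_last_in assms(1) by blast
      then show "res F ?y x (res F (last \<tau>) ?y (s \<tau>)) = ?f \<tau>"
        using res_comp [OF assms(2) y _ s(2) t(2)] cochains_in [OF assms(3) t(1)] by simp
    next
      show "?f ` supp (bdry \<sigma>) \<subseteq> carrier (sec F x)"
        using s by (intro order_trans [OF image_mono [OF up] coeval_values [OF assms(1-3)]]) (simp add: upper_def)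
    qed
    finally show "res F ?y x (differential R F n s \<sigma>) = frag_eval (sec F x) ?f (bdry \<sigma>)" .
  next
    show "(\<lambda>\<sigma>. frag_eval (sec F x) ?f (bdry \<sigma>)) ` supp z \<subseteq> carrier (sec F x)"
      using assms(4) by (intro image_subsetI G.frag_eval_closed [OF up coeval_values [OF assms(1-3)]]) blast
  qed
  ultimately show ?thesis by simp
qed

text \<open>
  By \<open>coeval_differential\<close> this is evaluation on the boundary of a boundary.
\<close>

lemma differential_differential:
  assumes "R \<subseteq> Q" "s \<in> carrier (cochains R F n)"
  shows "differential R F (Suc n) (differential R F n s) = \<one>\<^bsub>cochains R F (Suc (Suc n))\<^esub>"
proof (rule cochains_eqI)
  interpret C: comm_group "cochains R F (Suc (Suc n))" using cochains_group [OF assms(1)] .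
  show "\<one>\<^bsub>cochains R F (Suc (Suc n))\<^esub> \<in> carrier (cochains R F (Suc (Suc n)))" by simp
  note c = differential_closed [OF assms]
  show "differential R F (Suc n) (differential R F n s) \<in> carrier (cochains R F (Suc (Suc n)))"
    by (rule differential_closed [OF assms(1) c])
  fix \<sigma> assume s: "\<sigma> \<in> simplices R (Suc (Suc n))"
  then have x: "last \<sigma> \<in> Q" using simplices_last_in assms by blast
  have "differential R F (Suc n) (differential R F n s) \<sigma> = coeval F (last \<sigma>) s (frag_extend bdry (bdry \<sigma>))"
    using s c assms x by (simp add: differential_eq coeval_differential keys_bdry_simplex)
  also have "\<dots> = \<one>\<^bsub>sec F (last \<sigma>)\<^esub>"
    by (simp add: bnd_bdry coeval_def comm_group.frag_eval_0 [OF sec_group [OF x]])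
  finally show "differential R F (Suc n) (differential R F n s) \<sigma> = \<one>\<^bsub>cochains R F (Suc (Suc n))\<^esub> \<sigma>"
    using s by (simp add: cochains_one)
qed

lemma differential_hom:
  assumes "R \<subseteq> Q" shows "differential R F n \<in> hom (cochains R F n) (cochains R F (Suc n))"
proof (rule homI)
  interpret C: comm_group "cochains R F n" using cochains_group [OF assms] .
  interpret C': comm_group "cochains R F (Suc n)" using cochains_group [OF assms] .
  show "differential R F n s \<in> carrier (cochains R F (Suc n))" if "s \<in> carrier (cochains R F n)" for s
    using differential_closed [OF assms that] .
  fix s t assume st: "s \<in> carrier (cochains R F n)" "t \<in> carrier (cochains R F n)"
  show "differential R F n (s \<otimes>\<^bsub>cochains R F n\<^esub> t) =
      differential R F n s \<otimes>\<^bsub>cochains R F (Suc n)\<^esub> differential R F n t"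
  proof (rule cochains_eqI)
    fix \<sigma> assume s: "\<sigma> \<in> simplices R (Suc n)"
    then have x: "last \<sigma> \<in> Q" using simplices_last_in assms by blast
    show "differential R F n (s \<otimes>\<^bsub>cochains R F n\<^esub> t) \<sigma> =
        (differential R F n s \<otimes>\<^bsub>cochains R F (Suc n)\<^esub> differential R F n t) \<sigma>"
      using s st assms x
      by (simp add: differential_eq cochains_mult coeval_mult keys_bdry_simplex)
  qed (use st differential_closed [OF assms] in auto)
qed

lemma restrict_simplices_closed:
  "S \<subseteq> R \<Longrightarrow> s \<in> carrier (cochains R F n) \<Longrightarrow> restrict s (simplices S n) \<in> carrier (cochains S F n)"
  using simplices_mono [of S R n] by (auto simp: cochains_def PiE_iff)

lemma restrict_simplices_hom:
  "S \<subseteq> R \<Longrightarrow> (\<lambda>s. restrict s (simplices S n)) \<in> hom (cochains R F n) (cochains S F n)"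
  using simplices_mono [of S R n]
  by (intro homI restrict_simplices_closed) (auto simp: cochains_def fun_eq_iff)

lemma coeval_restrict:
  assumes "S \<subseteq> Q" "x \<in> Q" "restrict s (simplices S n) \<in> carrier (cochains S F n)" "supp z \<subseteq> upper S n x"
  shows "coeval F x s z = coeval F x (restrict s (simplices S n)) z"
  unfolding coeval_def
proof (rule comm_group.frag_eval_cong [OF sec_group [OF assms(2)]])
  show "(\<lambda>\<tau>. res F (last \<tau>) x (restrict s (simplices S n) \<tau>)) ` supp z \<subseteq> carrier (sec F x)"
    using coeval_values [OF assms(1-3)] assms(4) by blast
qed (use assms(4) in \<open>auto simp: upper_def\<close>)

lemma differential_restrict:
  assumes "R \<subseteq> Q" "S \<subseteq> R" "s \<in> carrier (cochains R F n)"
  shows "restrict (differential R F n s) (simplices S (Suc n)) = differential S F n (restrict s (simplices S n))"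
proof (rule cochains_eqI)
  have SQ: "S \<subseteq> Q" using assms by auto
  have c: "restrict s (simplices S n) \<in> carrier (cochains S F n)"
    by (rule restrict_simplices_closed [OF assms(2,3)])
  show "differential S F n (restrict s (simplices S n)) \<in> carrier (cochains S F (Suc n))"
    by (rule differential_closed [OF SQ c])
  show "restrict (differential R F n s) (simplices S (Suc n)) \<in> carrier (cochains S F (Suc n))"
    by (rule restrict_simplices_closed [OF assms(2) differential_closed [OF assms(1,3)]])
  fix \<sigma> assume s: "\<sigma> \<in> simplices S (Suc n)"
  then have s': "\<sigma> \<in> simplices R (Suc n)" using simplices_mono [OF assms(2)] by blast
  have x: "last \<sigma> \<in> Q" using s simplices_last_in SQ by blast
  show "restrict (differential R F n s) (simplices S (Suc n)) \<sigma> = differential S F n (restrict s (simplices S n)) \<sigma>"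
    using s coeval_restrict [OF SQ x c keys_bdry_simplex [OF s]]
    by (simp add: differential_eq [OF assms(1,3) s'] differential_eq [OF SQ c s])
qed

lemma extend_cochain:
  assumes "R \<subseteq> Q" "S \<subseteq> R" "s \<in> carrier (cochains S F n)"
  obtains t where "t \<in> carrier (cochains R F n)" "restrict t (simplices S n) = s"
proof
  let ?t = "\<lambda>\<sigma>\<in>simplices R n. if \<sigma> \<in> simplices S n then s \<sigma> else \<one>\<^bsub>sec F (last \<sigma>)\<^esub>"
  have "\<one>\<^bsub>sec F (last \<sigma>)\<^esub> \<in> carrier (sec F (last \<sigma>))" if "\<sigma> \<in> simplices R n" for \<sigma>
    using that simplices_last_in assms(1) sec_grp by (metis group.is_monoid monoid.one_closed subsetD)
  then show "?t \<in> carrier (cochains R F n)"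
    using assms(3) by (auto simp: cochains_def PiE_iff simplices_last)
  show "restrict ?t (simplices S n) = s"
    using assms(3) simplices_mono [OF assms(2), of n]
    by (auto simp: cochains_def PiE_iff fun_eq_iff extensional_def)
qed

end

section \<open>Cochain complexes of abelian groups\<close>

lemma iso_same_kernel:
  assumes "group G" "group H" "group H'" "f \<in> hom G H" "g \<in> hom G H'"
    "f ` carrier G = carrier H" "g ` carrier G = carrier H'"
    "\<And>x. x \<in> carrier G \<Longrightarrow> f x = \<one>\<^bsub>H\<^esub> \<longleftrightarrow> g x = \<one>\<^bsub>H'\<^esub>"
  shows "H \<cong> H'"
proof -
  interpret G: group G by fact
  interpret f: group_hom G H f using assms by (simp add: group_hom_def group_hom_axioms_def)
  interpret g: group_hom G H' g using assms by (simp add: group_hom_def group_hom_axioms_def)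
  have k: "kernel G H f = kernel G H' g" using assms(8) by (auto simp: kernel_def)
  have "G Mod kernel G H f \<cong> H" by (rule f.FactGroup_iso [OF assms(6)])
  moreover have "G Mod kernel G H f \<cong> H'" unfolding k by (rule g.FactGroup_iso [OF assms(7)])
  ultimately show ?thesis
    using normal.factorgroup_is_group [OF f.normal_kernel] group.iso_sym iso_trans by blast
qed

lemma comm_group_carrier_update:
  assumes "comm_group G" "subgroup H G" shows "comm_group (G\<lparr>carrier := H\<rparr>)"
proof -
  interpret comm_group G by fact
  show ?thesis
    by (rule group.group_comm_groupI [OF subgroup_imp_group [OF assms(2)]])
      (use subgroup.subset [OF assms(2)] in \<open>auto intro: m_comm\<close>)
qed

definition coh_class :: "(nat \<Rightarrow> 'c monoid) \<Rightarrow> (nat \<Rightarrow> 'c \<Rightarrow> 'c) \<Rightarrow> nat \<Rightarrow> 'c \<Rightarrow> 'c set" where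
  "coh_class K d n s = coboundaries K d n #>\<^bsub>K n\<^esub> s"

abbreviation cocycle_group :: "(nat \<Rightarrow> 'c monoid) \<Rightarrow> (nat \<Rightarrow> 'c \<Rightarrow> 'c) \<Rightarrow> nat \<Rightarrow> 'c monoid" where
  "cocycle_group K d n \<equiv> (K n)\<lparr>carrier := cocycles K d n\<rparr>"

locale cochain_complex =
  fixes K :: "nat \<Rightarrow> 'c monoid" and d :: "nat \<Rightarrow> 'c \<Rightarrow> 'c"
  assumes complex_group: "comm_group (K n)"
    and d_hom: "d n \<in> hom (K n) (K (Suc n))"
    and d_d: "s \<in> carrier (K n) \<Longrightarrow> d (Suc n) (d n s) = \<one>\<^bsub>K (Suc (Suc n))\<^esub>"
begin

lemma complex_grp: "group (K n)"
  using complex_group comm_group_def by blast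

lemma d_group_hom: "group_hom (K n) (K (Suc n)) (d n)"
  using complex_grp d_hom by (simp add: group_hom_def group_hom_axioms_def)

lemma cocycles_iff: "s \<in> cocycles K d n \<longleftrightarrow> s \<in> carrier (K n) \<and> d n s = \<one>\<^bsub>K (Suc n)\<^esub>"
  by (simp add: cocycles_def kernel_def)

lemma cocycles_subgroup: "subgroup (cocycles K d n) (K n)"
  unfolding cocycles_def by (rule group_hom.subgroup_kernel [OF d_group_hom])

lemma coboundaries_subgroup: "subgroup (coboundaries K d n) (K n)"
proof (cases n)
  case 0
  then show ?thesis using group.triv_subgroup [OF complex_grp] by (simp add: coboundaries_def)
next
  case (Suc m)
  then show ?thesis
    using group_hom.subgroup_img_is_subgroup [OF d_group_hom group.subgroup_self [OF complex_grp], of m]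
    by (simp add: coboundaries_def)
qed

lemma coboundaries_cocycles: "coboundaries K d n \<subseteq> cocycles K d n"
proof (cases n)
  case 0
  then show ?thesis using subgroup.one_closed [OF cocycles_subgroup] by (simp add: coboundaries_def)
next
  case (Suc m)
  then show ?thesis by (auto simp: coboundaries_def cocycles_iff d_d hom_in_carrier [OF d_hom])
qed

lemma cocycle_comm_group: "comm_group (cocycle_group K d n)"
  by (rule comm_group_carrier_update [OF complex_group cocycles_subgroup])

lemma coboundaries_normal: "coboundaries K d n \<lhd> cocycle_group K d n"
  using comm_group.normal_iff_subgroup [OF cocycle_comm_group]
    group.subgroup_incl [OF complex_grp coboundaries_subgroup cocycles_subgroup coboundaries_cocycles] by blast

lemma cohomology_comm_group: "comm_group (cohomology K d n)"
  unfolding cohomology_def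
  by (rule comm_group.abelian_FactGroup [OF cocycle_comm_group normal_imp_subgroup [OF coboundaries_normal]])

lemma coh_class_eq: "coh_class K d n = r_coset (cocycle_group K d n) (coboundaries K d n)"
  by (simp add: coh_class_def r_coset_def fun_eq_iff)

lemma coh_class_hom: "coh_class K d n \<in> hom (cocycle_group K d n) (cohomology K d n)"
  unfolding coh_class_eq cohomology_def by (rule normal.r_coset_hom_Mod [OF coboundaries_normal])

lemma carrier_cohomology: "carrier (cohomology K d n) = coh_class K d n ` cocycles K d n"
  unfolding coh_class_eq cohomology_def carrier_FactGroup by simp

lemma one_cohomology: "\<one>\<^bsub>cohomology K d n\<^esub> = coboundaries K d n"
  by (simp add: cohomology_def)

lemma coh_class_mult:
  assumes "s \<in> cocycles K d n" "t \<in> cocycles K d n"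
  shows "coh_class K d n (s \<otimes>\<^bsub>K n\<^esub> t) = coh_class K d n s \<otimes>\<^bsub>cohomology K d n\<^esub> coh_class K d n t"
  using hom_mult [OF coh_class_hom, of s n t] assms by simp

lemma coh_class_one_iff:
  assumes "s \<in> cocycles K d n"
  shows "coh_class K d n s = \<one>\<^bsub>cohomology K d n\<^esub> \<longleftrightarrow> s \<in> coboundaries K d n"
proof -
  have c: "s \<in> carrier (K n)" using assms by (simp add: cocycles_iff)
  show ?thesis
    unfolding one_cohomology coh_class_def
    using group.coset_join1 [OF complex_grp _ c coboundaries_subgroup]
      group.coset_join2 [OF complex_grp c coboundaries_subgroup] by blast
qed

lemma coh_class_self: "s \<in> cocycles K d n \<Longrightarrow> s \<in> coh_class K d n s"
  unfolding coh_class_def by (rule group.rcos_self [OF complex_grp _ coboundaries_subgroup]) (simp add: cocycles_iff)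

lemma coh_class_repr:
  assumes "t \<in> coh_class K d n s" "s \<in> cocycles K d n"
  shows "t \<in> cocycles K d n" "coh_class K d n t = coh_class K d n s"
proof -
  have c: "s \<in> carrier (K n)" using assms by (simp add: cocycles_iff)
  show "coh_class K d n t = coh_class K d n s"
    using group.repr_independence [OF complex_grp assms(1)[unfolded coh_class_def] c coboundaries_subgroup]
    by (simp add: coh_class_def)
  obtain b where "b \<in> coboundaries K d n" "t = b \<otimes>\<^bsub>K n\<^esub> s"
    using assms(1) by (auto simp: coh_class_def r_coset_def)
  then show "t \<in> cocycles K d n"
    using subgroup.m_closed [OF cocycles_subgroup _ assms(2)] coboundaries_cocycles by blast
qed

lemma trivial_cohomology:
  "trivial_group (cohomology K d n) \<longleftrightarrow> cocycles K d n \<subseteq> coboundaries K d n"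
proof -
  have "trivial_group (cohomology K d n) \<longleftrightarrow> carrier (cohomology K d n) \<subseteq> {\<one>\<^bsub>cohomology K d n\<^esub>}"
    using cohomology_comm_group comm_group.axioms(2) by (intro group.trivial_group_subset) blast
  also have "\<dots> \<longleftrightarrow> cocycles K d n \<subseteq> coboundaries K d n"
    unfolding carrier_cohomology using coh_class_one_iff by (auto simp: image_subset_iff)
  finally show ?thesis .
qed

lemma cohomology_iso:
  assumes "group H" "\<phi> \<in> hom (cocycle_group K d n) H" "\<phi> ` cocycles K d n = carrier H"
    "\<And>s. s \<in> cocycles K d n \<Longrightarrow> \<phi> s = \<one>\<^bsub>H\<^esub> \<longleftrightarrow> s \<in> coboundaries K d n"
  shows "cohomology K d n \<cong> H"
proof (rule iso_same_kernel [OF _ _ assms(1) coh_class_hom assms(2)])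
  show "group (cocycle_group K d n)" "group (cohomology K d n)"
    using cocycle_comm_group cohomology_comm_group comm_group.axioms(2) by blast+
qed (use assms(3,4) coh_class_one_iff carrier_cohomology in auto)

end

context presheaf_on begin

lemma cochains_complex:
  assumes "R \<subseteq> Q" shows "cochain_complex (cochains R F) (differential R F)"
  using assms cochains_group differential_hom differential_differential by (simp add: cochain_complex_def)

lemma rel_cochains_iff:
  assumes "S \<subseteq> R"
  shows "s \<in> carrier (rel_cochains R S F n) \<longleftrightarrow>
    s \<in> carrier (cochains R F n) \<and> (\<forall>\<sigma>\<in>simplices S n. s \<sigma> = \<one>\<^bsub>sec F (last \<sigma>)\<^esub>)"
  by (auto simp: rel_cochains_def kernel_def cochains_def fun_eq_iff simplices_last restrict_def)

lemma rel_cochains_subgroup: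
  assumes "R \<subseteq> Q" "S \<subseteq> R" shows "subgroup (carrier (rel_cochains R S F n)) (cochains R F n)"
proof -
  interpret group_hom "cochains R F n" "cochains S F n" "\<lambda>s. restrict s (simplices S n)"
    using cochains_group [OF assms(1), of n] cochains_group [of S n] assms restrict_simplices_hom [OF assms(2), of n]
    by (auto simp: group_hom_def group_hom_axioms_def comm_group_def)
  show ?thesis unfolding rel_cochains_def using subgroup_kernel by simp
qed

lemma rel_cochains_eq: "rel_cochains R S F n = (cochains R F n)\<lparr>carrier := carrier (rel_cochains R S F n)\<rparr>"
  by (simp add: rel_cochains_def)

lemma mult_rel_cochains [simp]: "monoid.mult (rel_cochains R S F n) = monoid.mult (cochains R F n)"
  and one_rel_cochains [simp]: "\<one>\<^bsub>rel_cochains R S F n\<^esub> = \<one>\<^bsub>cochains R F n\<^esub>"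
  by (simp_all add: rel_cochains_def)

lemma rel_cochains_complex:
  assumes "R \<subseteq> Q" "S \<subseteq> R" shows "cochain_complex (rel_cochains R S F) (differential R F)"
proof (rule cochain_complex.intro)
  show "comm_group (rel_cochains R S F n)" for n
    by (subst rel_cochains_eq, rule comm_group_carrier_update [OF cochains_group rel_cochains_subgroup]) fact+
  have SQ: "S \<subseteq> Q" using assms by auto
  have sub: "s \<in> carrier (cochains R F n)" if "s \<in> carrier (rel_cochains R S F n)" for s n
    using that rel_cochains_iff [OF assms(2)] by blast
  show "differential R F n \<in> hom (rel_cochains R S F n) (rel_cochains R S F (Suc n))" for n
  proof (rule homI)
    fix s assume s: "s \<in> carrier (rel_cochains R S F n)"
    then have r: "restrict s (simplices S n) = \<one>\<^bsub>cochains S F n\<^esub>"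
      by (simp add: rel_cochains_def kernel_def)
    have "restrict (differential R F n s) (simplices S (Suc n)) = \<one>\<^bsub>cochains S F (Suc n)\<^esub>"
      unfolding differential_restrict [OF assms sub [OF s]] r
      by (rule group_hom.hom_one [OF cochain_complex.d_group_hom [OF cochains_complex [OF SQ]]])
    then show "differential R F n s \<in> carrier (rel_cochains R S F (Suc n))"
      using differential_closed [OF assms(1) sub [OF s]] by (simp add: rel_cochains_def kernel_def)
  next
    fix s t assume "s \<in> carrier (rel_cochains R S F n)" "t \<in> carrier (rel_cochains R S F n)"
    then show "differential R F n (s \<otimes>\<^bsub>rel_cochains R S F n\<^esub> t) =
        differential R F n s \<otimes>\<^bsub>rel_cochains R S F (Suc n)\<^esub> differential R F n t"
      using hom_mult [OF differential_hom [OF assms(1)]] sub by simp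
  qed
  show "differential R F (Suc n) (differential R F n s) = \<one>\<^bsub>rel_cochains R S F (Suc (Suc n))\<^esub>"
    if "s \<in> carrier (rel_cochains R S F n)" for s n
    using differential_differential [OF assms(1) sub [OF that]] by simp
qed

end

section \<open>Cellular cohomology computes cohomology\<close>

text \<open>
  The indices are shifted: \<open>R (Suc k)\<close> plays the role of the \<open>k\<close>-skeleton, so that the empty
  skeleton has a natural number as index.
\<close>

locale filtered_presheaf = presheaf_on Q F for Q :: "'a::order set" and F :: "('a, 'b) presheaf" +
  fixes R :: "nat \<Rightarrow> 'a set" and N :: nat
  assumes R_0: "R 0 = {}" and R_Suc: "R k \<subseteq> R (Suc k)" and R_sub: "R k \<subseteq> Q" and R_top: "N \<le> k \<Longrightarrow> R k = Q"
    and vanish: "i \<noteq> k \<Longrightarrow> trivial_group (HS_rel (R (Suc k)) (R k) F i)"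
begin

abbreviation "C \<equiv> cochains Q F"
abbreviation "D \<equiv> differential Q F"
abbreviation "rel k \<equiv> rel_cochains (R (Suc k)) (R k) F"
abbreviation "Dk k \<equiv> differential (R (Suc k)) F"
abbreviation "restr k n s \<equiv> restrict s (simplices (R k) n)"

text \<open>
  The filtration of the cochains on \<open>Q\<close> by the skeleton on which they vanish. Relative cochains of
  successive skeleta are the quotients of successive steps (\<open>restr_rel\<close>, \<open>rel_lift\<close>), and all
  arguments below take place in the cochain groups of \<open>Q\<close>.
\<close>

definition Fil :: "nat \<Rightarrow> nat \<Rightarrow> ('a list \<Rightarrow> 'b) set" where
  "Fil k n = carrier (rel_cochains Q (R k) F n)"

definition Cob :: "nat \<Rightarrow> nat \<Rightarrow> ('a list \<Rightarrow> 'b) set" where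
  "Cob k n = coboundaries (rel_cochains Q (R k) F) D n"

sublocale CC: cochain_complex C D
  by (rule cochains_complex) simp

lemma Jc: "cochain_complex (rel_cochains Q (R k) F) D"
  by (rule rel_cochains_complex [OF order_refl R_sub])

lemma relc: "cochain_complex (rel k) (Dk k)"
  by (rule rel_cochains_complex [OF R_sub R_Suc])

lemma Cg: "comm_group (C n)" by (rule cochains_group) simp

lemma Cgrp: "group (C n)" using Cg comm_group_def by blast

lemma Fil_subgroup: "subgroup (Fil k n) (C n)"
  unfolding Fil_def by (rule rel_cochains_subgroup [OF order_refl R_sub])

lemma Fil_iff: "s \<in> Fil k n \<longleftrightarrow> s \<in> carrier (C n) \<and> (\<forall>\<sigma>\<in>simplices (R k) n. s \<sigma> = \<one>\<^bsub>sec F (last \<sigma>)\<^esub>)"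
  unfolding Fil_def by (rule rel_cochains_iff [OF R_sub])

lemma Fil_carrier: "s \<in> Fil k n \<Longrightarrow> s \<in> carrier (C n)" by (simp add: Fil_iff)

lemma Fil_restr_iff: "s \<in> Fil k n \<longleftrightarrow> s \<in> carrier (C n) \<and> restr k n s = \<one>\<^bsub>cochains (R k) F n\<^esub>"
  by (simp add: Fil_def rel_cochains_def kernel_def)

lemma Fil_Suc: "Fil (Suc k) n \<subseteq> Fil k n"
  using subsetD [OF simplices_mono [OF R_Suc]] by (simp add: Fil_iff subset_iff)

lemma Fil_0: "Fil 0 n = carrier (C n)"
  using R_0 by (auto simp: Fil_iff simplices_def)

lemma Fil_top: "N \<le> k \<Longrightarrow> Fil k n = {\<one>\<^bsub>C n\<^esub>}"
proof (intro equalityI subsetI)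
  have one: "\<one>\<^bsub>C n\<^esub> \<in> carrier (C n)"
    by (rule subgroup.one_closed [OF group.subgroup_self [OF Cgrp]])
  fix s assume "N \<le> k" "s \<in> Fil k n"
  then have "s \<in> carrier (C n)" "\<forall>\<sigma>\<in>simplices Q n. s \<sigma> = \<one>\<^bsub>sec F (last \<sigma>)\<^esub>"
    using R_top by (simp_all add: Fil_iff)
  then have "s = \<one>\<^bsub>C n\<^esub>" using one by (intro cochains_eqI [of s Q n]) (simp_all add: cochains_one)
  then show "s \<in> {\<one>\<^bsub>C n\<^esub>}" by simp
next
  fix s assume "s \<in> {\<one>\<^bsub>C n\<^esub>}"
  then show "s \<in> Fil k n" using subgroup.one_closed [OF Fil_subgroup [of k n]] by simp
qed

lemma D_closed: "s \<in> carrier (C n) \<Longrightarrow> D n s \<in> carrier (C (Suc n))"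
  by (rule differential_closed) simp_all

lemma D_mult: "s \<in> carrier (C n) \<Longrightarrow> t \<in> carrier (C n) \<Longrightarrow> D n (s \<otimes>\<^bsub>C n\<^esub> t) = D n s \<otimes>\<^bsub>C (Suc n)\<^esub> D n t"
  using hom_mult [OF CC.d_hom] .

lemma D_inv: "s \<in> carrier (C n) \<Longrightarrow> D n (inv\<^bsub>C n\<^esub> s) = inv\<^bsub>C (Suc n)\<^esub> D n s"
  using group_hom.hom_inv [OF CC.d_group_hom] .

lemma Cob_0: "Cob 0 n = coboundaries C D n"
  using Fil_0 [unfolded Fil_def] by (cases n) (simp_all add: Cob_def coboundaries_def)

lemma Cob_Suc_deg: "Cob k (Suc n) = D n ` Fil k n"
  by (simp add: Cob_def Fil_def coboundaries_def)

lemma Cob_zero_deg: "Cob k 0 = {\<one>\<^bsub>C 0\<^esub>}"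
  by (simp add: Cob_def coboundaries_def)

lemma Cob_Fil: "Cob k n \<subseteq> Fil k n"
  using cochain_complex.coboundaries_cocycles [OF Jc, of k n] cochain_complex.cocycles_iff [OF Jc]
  by (auto simp: Cob_def Fil_def)

lemma Cob_cocycle: "b \<in> Cob k n \<Longrightarrow> D n b = \<one>\<^bsub>C (Suc n)\<^esub>"
  using cochain_complex.coboundaries_cocycles [OF Jc, of k n] cochain_complex.cocycles_iff [OF Jc]
  by (auto simp: Cob_def)

lemma Cob_subgroup: "subgroup (Cob k n) (C n)"
proof -
  have "subgroup (Cob k n) (rel_cochains Q (R k) F n)"
    unfolding Cob_def by (rule cochain_complex.coboundaries_subgroup [OF Jc])
  then have "subgroup (Cob k n) ((C n)\<lparr>carrier := Fil k n\<rparr>)"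
    unfolding Fil_def rel_cochains_eq [symmetric] .
  then show ?thesis using group.incl_subgroup [OF Cgrp Fil_subgroup] by blast
qed

lemma Cob_antimono: "Cob (Suc k) n \<subseteq> Cob k n"
  using Fil_Suc by (cases n) (auto simp: Cob_Suc_deg Cob_zero_deg)

lemma Cob_antimono0: "Cob k n \<subseteq> Cob 0 n"
  using Cob_antimono by (induction k) auto

lemma Cob_D: "s \<in> carrier (C n) \<Longrightarrow> D n s \<in> Cob 0 (Suc n)"
  by (auto simp: Cob_Suc_deg Fil_0)

lemma restr_rel: "s \<in> Fil k n \<Longrightarrow> restr (Suc k) n s \<in> carrier (rel k n)"
  unfolding rel_cochains_iff [OF R_Suc]
  using restrict_simplices_closed [OF R_sub, of s n "Suc k"] simplices_mono [OF R_Suc, of k n]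
  by (auto simp: Fil_iff)

lemma restr_D: "s \<in> carrier (C n) \<Longrightarrow> restr k (Suc n) (D n s) = differential (R k) F n (restr k n s)"
  by (rule differential_restrict [OF order_refl R_sub])

lemma rel_lift:
  assumes "t \<in> carrier (rel k n)" obtains s where "s \<in> Fil k n" "restr (Suc k) n s = t"
proof -
  have t: "t \<in> carrier (cochains (R (Suc k)) F n)" "\<And>\<sigma>. \<sigma> \<in> simplices (R k) n \<Longrightarrow> t \<sigma> = \<one>\<^bsub>sec F (last \<sigma>)\<^esub>"
    using assms rel_cochains_iff [OF R_Suc] by blast+
  obtain s where s: "s \<in> carrier (C n)" "restr (Suc k) n s = t"
    using extend_cochain [OF order_refl R_sub t(1)] by blast
  then have "s \<in> Fil k n" using t(2) simplices_mono [OF R_Suc, of k n] by (fastforce simp: Fil_iff)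
  then show ?thesis using s that by blast
qed

lemma restr_mult:
  "s \<in> carrier (C n) \<Longrightarrow> t \<in> carrier (C n) \<Longrightarrow>
    restr k n (s \<otimes>\<^bsub>C n\<^esub> t) = restr k n s \<otimes>\<^bsub>cochains (R k) F n\<^esub> restr k n t"
  using hom_mult [OF restrict_simplices_hom [OF R_sub]] .

lemma restr_eq_iff:
  assumes "s \<in> carrier (C n)" "t \<in> carrier (C n)"
  shows "restr k n s = restr k n t \<longleftrightarrow> s \<otimes>\<^bsub>C n\<^esub> inv\<^bsub>C n\<^esub> t \<in> Fil k n"
proof -
  interpret h: group_hom "C n" "cochains (R k) F n" "restr k n"
    using Cgrp cochains_group [OF R_sub] restrict_simplices_hom [OF R_sub, of k n]
    by (auto simp: group_hom_def group_hom_axioms_def comm_group_def)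
  show ?thesis using assms by (simp add: Fil_restr_iff del: h.hom_mult) (simp add: h.H.inv_solve_right' flip: h.H.r_inv)
qed

end

context filtered_presheaf begin

lemma restr_cocycle:
  assumes "s \<in> Fil k i"
  shows "restr (Suc k) i s \<in> cocycles (rel k) (Dk k) i \<longleftrightarrow> D i s \<in> Fil (Suc k) (Suc i)"
proof -
  have c: "s \<in> carrier (C i)" using assms by (rule Fil_carrier)
  show ?thesis
    using restr_rel [OF assms] D_closed [OF c]
    by (simp add: cochain_complex.cocycles_iff [OF relc] Fil_restr_iff restr_D [OF c])
qed

text \<open>
  A primitive on the skeleton can be extended to \<open>Q\<close>, and two cochains have the same restriction iff
  they differ by the next step of the filtration.
\<close>

lemma restr_coboundary:
  assumes "s \<in> Fil k i"
  shows "restr (Suc k) i s \<in> coboundaries (rel k) (Dk k) i \<longleftrightarrow> (\<exists>b\<in>Cob k i. s \<otimes>\<^bsub>C i\<^esub> inv\<^bsub>C i\<^esub> b \<in> Fil (Suc k) i)"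
proof (cases i)
  case 0
  interpret Ci: comm_group "C i" by (rule Cg)
  show ?thesis
    using assms Fil_carrier [OF assms] unfolding 0
    by (simp add: coboundaries_def Cob_zero_deg Fil_restr_iff Ci.inv_one[unfolded 0] Ci.r_one[unfolded 0])
next
  case (Suc m)
  have c: "s \<in> carrier (C (Suc m))" using assms Fil_carrier Suc by blast
  have eq: "restr (Suc k) (Suc m) s = Dk k m (restr (Suc k) m t) \<longleftrightarrow>
      s \<otimes>\<^bsub>C (Suc m)\<^esub> inv\<^bsub>C (Suc m)\<^esub> D m t \<in> Fil (Suc k) (Suc m)" if "t \<in> Fil k m" for t
    using restr_eq_iff [OF c D_closed [OF Fil_carrier [OF that]], of "Suc k"] restr_D [OF Fil_carrier [OF that]] by simp
  show ?thesis
  proof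
    assume "restr (Suc k) i s \<in> coboundaries (rel k) (Dk k) i"
    then obtain t' where "t' \<in> carrier (rel k m)" "restr (Suc k) (Suc m) s = Dk k m t'"
      by (auto simp: Suc coboundaries_def)
    moreover then obtain t where "t \<in> Fil k m" "restr (Suc k) m t = t'" using rel_lift by blast
    ultimately show "\<exists>b\<in>Cob k i. s \<otimes>\<^bsub>C i\<^esub> inv\<^bsub>C i\<^esub> b \<in> Fil (Suc k) i"
      using eq by (auto simp: Suc Cob_Suc_deg)
  next
    assume "\<exists>b\<in>Cob k i. s \<otimes>\<^bsub>C i\<^esub> inv\<^bsub>C i\<^esub> b \<in> Fil (Suc k) i"
    then obtain t where "t \<in> Fil k m" "restr (Suc k) (Suc m) s = Dk k m (restr (Suc k) m t)"
      using eq by (auto simp: Suc Cob_Suc_deg)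
    then show "restr (Suc k) i s \<in> coboundaries (rel k) (Dk k) i"
      using restr_rel by (auto simp: Suc coboundaries_def)
  qed
qed

text \<open>
  Off the diagonal the relative cohomology vanishes, so a cochain that is a cocycle modulo the next
  step of the filtration can be moved into that step.
\<close>

lemma push_step:
  assumes "i \<noteq> k" "s \<in> Fil k i" "D i s \<in> Fil (Suc k) (Suc i)"
  shows "\<exists>b\<in>Cob k i. s \<otimes>\<^bsub>C i\<^esub> inv\<^bsub>C i\<^esub> b \<in> Fil (Suc k) i"
proof -
  have "cocycles (rel k) (Dk k) i \<subseteq> coboundaries (rel k) (Dk k) i"
    using vanish [OF assms(1)] cochain_complex.trivial_cohomology [OF relc] by (simp add: HS_rel_def)
  then show ?thesis using restr_cocycle [OF assms(2)] restr_coboundary [OF assms(2)] assms(3) by blast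
qed

lemma Cob_carrier: "b \<in> Cob k n \<Longrightarrow> b \<in> carrier (C n)"
  using Cob_Fil Fil_carrier by blast

lemma D_diff:
  assumes "s \<in> carrier (C n)" "t \<in> carrier (C n)"
  shows "D n (s \<otimes>\<^bsub>C n\<^esub> inv\<^bsub>C n\<^esub> t) = D n s \<otimes>\<^bsub>C (Suc n)\<^esub> inv\<^bsub>C (Suc n)\<^esub> D n t"
  using assms group.inv_closed [OF Cgrp] by (simp add: D_mult D_inv)

lemma D_diff_Cob:
  assumes "s \<in> carrier (C n)" "b \<in> Cob k n" shows "D n (s \<otimes>\<^bsub>C n\<^esub> inv\<^bsub>C n\<^esub> b) = D n s"
proof -
  interpret C': comm_group "C (Suc n)" by (rule Cg)
  show ?thesis
    using assms Cob_carrier [OF assms(2)] D_closed [OF assms(1)] by (simp add: D_diff Cob_cocycle)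
qed

lemma diff_closed: "s \<in> carrier (C n) \<Longrightarrow> t \<in> carrier (C n) \<Longrightarrow> s \<otimes>\<^bsub>C n\<^esub> inv\<^bsub>C n\<^esub> t \<in> carrier (C n)"
  using group.is_monoid [OF Cgrp] group.inv_closed [OF Cgrp] by (simp add: monoid.m_closed)

lemma diff_add_cancel_C: "s \<in> carrier (C n) \<Longrightarrow> t \<in> carrier (C n) \<Longrightarrow> s \<otimes>\<^bsub>C n\<^esub> inv\<^bsub>C n\<^esub> t \<otimes>\<^bsub>C n\<^esub> t = s"
proof -
  interpret Cn: comm_group "C n" by (rule Cg)
  show "s \<in> carrier (C n) \<Longrightarrow> t \<in> carrier (C n) \<Longrightarrow> s \<otimes>\<^bsub>C n\<^esub> inv\<^bsub>C n\<^esub> t \<otimes>\<^bsub>C n\<^esub> t = s"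
    by (simp add: Cn.m_assoc)
qed

lemma subgroup_diff:
  assumes "subgroup H (C n)" "s \<in> H" "t \<in> H" shows "s \<otimes>\<^bsub>C n\<^esub> inv\<^bsub>C n\<^esub> t \<in> H"
  using assms by (simp add: subgroup.m_closed subgroup.m_inv_closed)

text \<open>
  Below the diagonal the steps continue until the filtration reaches zero.
\<close>

lemma low_degree_coboundary:
  assumes "s \<in> Fil k i" "D i s = \<one>\<^bsub>C (Suc i)\<^esub>" "i < k"
  shows "s \<in> Cob k i"
  using assms
proof (induction "N - k" arbitrary: k s)
  case 0
  then have "s = \<one>\<^bsub>C i\<^esub>" using Fil_top [of k i] by simp
  then show ?case using subgroup.one_closed [OF Cob_subgroup] by simp
next
  case (Suc m)
  have c: "s \<in> carrier (C i)" using Suc.prems Fil_carrier by blast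
  have "D i s \<in> Fil (Suc k) (Suc i)" using Suc.prems subgroup.one_closed [OF Fil_subgroup] by simp
  then obtain b where b: "b \<in> Cob k i" "s \<otimes>\<^bsub>C i\<^esub> inv\<^bsub>C i\<^esub> b \<in> Fil (Suc k) i"
    using push_step [of i k s] Suc.prems by blast
  have "s \<otimes>\<^bsub>C i\<^esub> inv\<^bsub>C i\<^esub> b \<in> Cob (Suc k) i"
    using Suc.hyps(2) Suc.prems b D_diff_Cob [OF c b(1)] by (intro Suc.hyps(1)) auto
  then have "s \<otimes>\<^bsub>C i\<^esub> inv\<^bsub>C i\<^esub> b \<otimes>\<^bsub>C i\<^esub> b \<in> Cob k i"
    using Cob_antimono b(1) subgroup.m_closed [OF Cob_subgroup] by blast
  then show ?case using diff_add_cancel_C [OF c Cob_carrier [OF b(1)]] by simp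
qed

text \<open>
  Above the diagonal the steps start with the whole complex and stop at the diagonal.
\<close>

lemma high_degree_push:
  assumes "s \<in> carrier (C i)" "D i s \<in> Fil k (Suc i)" "k \<le> i"
  shows "\<exists>b\<in>Cob 0 i. s \<otimes>\<^bsub>C i\<^esub> inv\<^bsub>C i\<^esub> b \<in> Fil k i"
  using assms
proof (induction k)
  case 0
  show ?case
  proof
    show "\<one>\<^bsub>C i\<^esub> \<in> Cob 0 i" using subgroup.one_closed [OF Cob_subgroup] .
    then show "s \<otimes>\<^bsub>C i\<^esub> inv\<^bsub>C i\<^esub> \<one>\<^bsub>C i\<^esub> \<in> Fil 0 i"
      using 0 diff_closed Cob_carrier by (simp add: Fil_0)
  qed
next
  case (Suc k)
  interpret Ci: comm_group "C i" by (rule Cg)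
  obtain b where b: "b \<in> Cob 0 i" "s \<otimes>\<^bsub>C i\<^esub> inv\<^bsub>C i\<^esub> b \<in> Fil k i"
    using Suc Fil_Suc by fastforce
  have "D i (s \<otimes>\<^bsub>C i\<^esub> inv\<^bsub>C i\<^esub> b) \<in> Fil (Suc k) (Suc i)"
    using D_diff_Cob [OF Suc.prems(1) b(1)] Suc.prems by simp
  then obtain b' where b': "b' \<in> Cob k i" "s \<otimes>\<^bsub>C i\<^esub> inv\<^bsub>C i\<^esub> b \<otimes>\<^bsub>C i\<^esub> inv\<^bsub>C i\<^esub> b' \<in> Fil (Suc k) i"
    using push_step [of i k] b(2) Suc.prems by fastforce
  have "s \<otimes>\<^bsub>C i\<^esub> inv\<^bsub>C i\<^esub> b \<otimes>\<^bsub>C i\<^esub> inv\<^bsub>C i\<^esub> b' = s \<otimes>\<^bsub>C i\<^esub> inv\<^bsub>C i\<^esub> (b \<otimes>\<^bsub>C i\<^esub> b')"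
    using Suc.prems(1) Cob_carrier [OF b(1)] Cob_carrier [OF b'(1)] by (simp add: Ci.inv_mult Ci.m_assoc)
  moreover have "b \<otimes>\<^bsub>C i\<^esub> b' \<in> Cob 0 i"
    using b(1) b'(1) Cob_antimono0 subgroup.m_closed [OF Cob_subgroup] by blast
  ultimately show ?case using b'(2) by metis
qed

text \<open>
  The cochains on \<open>Q\<close> whose restriction represents a cellular cochain.
\<close>

definition Lift :: "nat \<Rightarrow> ('a list \<Rightarrow> 'b) set" where
  "Lift n = {s \<in> Fil n n. D n s \<in> Fil (Suc n) (Suc n)}"

abbreviation E :: "nat \<Rightarrow> ('a list \<Rightarrow> 'b) set monoid" where
  "E n \<equiv> cohomology (rel n) (Dk n) n"

definition cell_class :: "nat \<Rightarrow> ('a list \<Rightarrow> 'b) \<Rightarrow> ('a list \<Rightarrow> 'b) set" where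
  "cell_class n s = coh_class (rel n) (Dk n) n (restr (Suc n) n s)"

abbreviation cell_conn :: "nat \<Rightarrow> ('a list \<Rightarrow> 'b) set \<Rightarrow> ('a list \<Rightarrow> 'b) set" where
  "cell_conn n \<equiv> connecting (rel (Suc n)) (rel_cochains (R (Suc (Suc n))) (R n) F) (Dk (Suc n)) (\<lambda>m. restr (Suc n) m) n"

lemma Lift_carrier: "s \<in> Lift n \<Longrightarrow> s \<in> carrier (C n)"
  using Fil_carrier by (auto simp: Lift_def)

lemma Lift_subgroup: "subgroup (Lift n) (C n)"
proof (rule group.subgroupI [OF Cgrp])
  show "Lift n \<subseteq> carrier (C n)" using Lift_carrier by blast
  have "\<one>\<^bsub>C n\<^esub> \<in> Lift n"
    using subgroup.one_closed [OF Fil_subgroup] group_hom.hom_one [OF CC.d_group_hom] by (simp add: Lift_def)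
  then show "Lift n \<noteq> {}" by blast
next
  fix s t assume s: "s \<in> Lift n" and t: "t \<in> Lift n"
  then show "s \<otimes>\<^bsub>C n\<^esub> t \<in> Lift n"
    using subgroup.m_closed [OF Fil_subgroup] Lift_carrier [OF s] Lift_carrier [OF t] by (simp add: Lift_def D_mult)
next
  fix s assume s: "s \<in> Lift n"
  then show "inv\<^bsub>C n\<^esub> s \<in> Lift n"
    using subgroup.m_inv_closed [OF Fil_subgroup] Lift_carrier [OF s] by (simp add: Lift_def D_inv)
qed

lemma Lift_cocycle: "s \<in> Lift n \<Longrightarrow> restr (Suc n) n s \<in> cocycles (rel n) (Dk n) n"
  using restr_cocycle [of s n n] by (simp add: Lift_def)

lemma E_group: "comm_group (E n)" "group (E n)"
  using cochain_complex.cohomology_comm_group [OF relc] by (auto simp: comm_group_def)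

lemma cell_class_mult:
  assumes "s \<in> Lift n" "t \<in> Lift n" shows "cell_class n (s \<otimes>\<^bsub>C n\<^esub> t) = cell_class n s \<otimes>\<^bsub>E n\<^esub> cell_class n t"
  using cochain_complex.coh_class_mult [OF relc Lift_cocycle [OF assms(1)] Lift_cocycle [OF assms(2)]] assms
  by (simp add: cell_class_def restr_mult Lift_carrier)

lemma cell_class_closed: "s \<in> Lift n \<Longrightarrow> cell_class n s \<in> carrier (E n)"
  using Lift_cocycle by (simp add: cell_class_def cochain_complex.carrier_cohomology [OF relc])

lemma cell_class_hom: "cell_class n \<in> hom ((C n)\<lparr>carrier := Lift n\<rparr>) (E n)"
  by (rule homI) (simp_all add: cell_class_mult cell_class_closed)

lemma cell_class_one: "cell_class n \<one>\<^bsub>C n\<^esub> = \<one>\<^bsub>E n\<^esub>"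
  using hom_one [OF cell_class_hom group.subgroup_imp_group [OF Cgrp Lift_subgroup] E_group(2)] by simp

lemma cell_class_surj: "carrier (E n) = cell_class n ` Lift n"
proof
  show "carrier (E n) \<subseteq> cell_class n ` Lift n"
  proof
    fix c assume "c \<in> carrier (E n)"
    then obtain t where t: "t \<in> cocycles (rel n) (Dk n) n" "c = coh_class (rel n) (Dk n) n t"
      by (auto simp: cochain_complex.carrier_cohomology [OF relc])
    then obtain s where s: "s \<in> Fil n n" "restr (Suc n) n s = t"
      using rel_lift [of t n n] by (auto simp: cochain_complex.cocycles_iff [OF relc])
    then have "s \<in> Lift n" using restr_cocycle [of s n n] t by (simp add: Lift_def)
    then show "c \<in> cell_class n ` Lift n" using s t by (auto simp: cell_class_def)
  qed
qed (use cell_class_closed in auto)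

lemma cell_class_one_iff:
  assumes "s \<in> Lift n"
  shows "cell_class n s = \<one>\<^bsub>E n\<^esub> \<longleftrightarrow> (\<exists>b\<in>Cob n n. s \<otimes>\<^bsub>C n\<^esub> inv\<^bsub>C n\<^esub> b \<in> Fil (Suc n) n)"
  using cochain_complex.coh_class_one_iff [OF relc Lift_cocycle [OF assms]] restr_coboundary [of s n n] assms
  by (simp add: cell_class_def Lift_def)

lemma cell_class_eq_iff:
  assumes "s \<in> Lift n" "t \<in> Lift n"
  shows "cell_class n s = cell_class n t \<longleftrightarrow> cell_class n (s \<otimes>\<^bsub>C n\<^esub> inv\<^bsub>C n\<^esub> t) = \<one>\<^bsub>E n\<^esub>"
proof -
  have w: "s \<otimes>\<^bsub>C n\<^esub> inv\<^bsub>C n\<^esub> t \<in> Lift n" using subgroup_diff [OF Lift_subgroup assms] .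
  have "cell_class n s = cell_class n (s \<otimes>\<^bsub>C n\<^esub> inv\<^bsub>C n\<^esub> t) \<otimes>\<^bsub>E n\<^esub> cell_class n t"
    using cell_class_mult [OF w assms(2)] diff_add_cancel_C [of s n t] assms Lift_carrier by simp
  then show ?thesis
    using group.r_cancel_one [OF E_group(2) cell_class_closed [OF assms(2)] cell_class_closed [OF w]] by simp
qed

lemma cell_class_eqI:
  assumes "s \<in> Lift n" "t \<in> Lift n" "s \<otimes>\<^bsub>C n\<^esub> inv\<^bsub>C n\<^esub> t \<in> Fil (Suc n) n"
  shows "cell_class n s = cell_class n t"
  using restr_eq_iff [of s n t "Suc n"] assms Lift_carrier by (simp add: cell_class_def)

lemma D_Lift:
  assumes "s \<in> carrier (C n)" "D n s \<in> Fil (Suc n) (Suc n)" shows "D n s \<in> Lift (Suc n)"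
  using assms subgroup.one_closed [OF Fil_subgroup] CC.d_d [OF assms(1)] by (simp add: Lift_def)

lemma D_Lift_of: "s \<in> Lift n \<Longrightarrow> D n s \<in> Lift (Suc n)"
  using D_Lift [OF Lift_carrier] by (simp add: Lift_def)

text \<open>
  The class of \<open>D n s\<close> depends only on that of \<open>s\<close>, since changing \<open>s\<close> within its class changes
  \<open>D n s\<close> by the coboundary of an element of \<open>Fil (Suc n) n\<close>.
\<close>

lemma cell_class_D_eq:
  assumes "s \<in> Lift n" "t \<in> Lift n" "cell_class n s = cell_class n t"
  shows "cell_class (Suc n) (D n s) = cell_class (Suc n) (D n t)"
proof -
  interpret C': comm_group "C (Suc n)" by (rule Cg)
  let ?u = "s \<otimes>\<^bsub>C n\<^esub> inv\<^bsub>C n\<^esub> t"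
  have c: "s \<in> carrier (C n)" "t \<in> carrier (C n)" using assms Lift_carrier by auto
  have w: "?u \<in> Lift n" using subgroup_diff [OF Lift_subgroup assms(1,2)] .
  then obtain b where b: "b \<in> Cob n n" "?u \<otimes>\<^bsub>C n\<^esub> inv\<^bsub>C n\<^esub> b \<in> Fil (Suc n) n"
    using cell_class_eq_iff [OF assms(1,2)] cell_class_one_iff [OF w] assms(3) by blast
  have "D n ?u = D n (?u \<otimes>\<^bsub>C n\<^esub> inv\<^bsub>C n\<^esub> b)" using D_diff_Cob [OF Lift_carrier [OF w] b(1)] by simp
  then have Bu: "D n ?u \<in> Cob (Suc n) (Suc n)" using b(2) by (auto simp: Cob_Suc_deg)
  have Lift: "D n s \<in> Lift (Suc n)" "D n t \<in> Lift (Suc n)" "D n ?u \<in> Lift (Suc n)"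
    using assms w D_Lift_of by auto
  have "D n ?u \<otimes>\<^bsub>C (Suc n)\<^esub> inv\<^bsub>C (Suc n)\<^esub> D n ?u \<in> Fil (Suc (Suc n)) (Suc n)"
    using subgroup.one_closed [OF Fil_subgroup] Lift_carrier [OF Lift(3)] by simp
  then have "cell_class (Suc n) (D n ?u) = \<one>\<^bsub>E (Suc n)\<^esub>" using cell_class_one_iff [OF Lift(3)] Bu by blast
  then show ?thesis using cell_class_eq_iff [OF Lift(1,2)] D_diff [OF c] by simp
qed

lemma restr_restr: "restr (Suc n) n (restr (Suc (Suc n)) n s) = restr (Suc n) n s"
  using simplices_mono [OF R_Suc, of "Suc n" n] by (simp add: inf_absorb2)

text \<open>
  On representatives defined on all of \<open>Q\<close> the connecting homomorphism is the differential.
\<close>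

lemma cell_conn_cell_class:
  assumes "s \<in> Lift n" shows "cell_conn n (cell_class n s) = cell_class (Suc n) (D n s)"
  unfolding connecting_def
proof (rule the_equality)
  have RR: "R n \<subseteq> R (Suc (Suc n))" using R_Suc by blast
  have k: "coboundaries (rel (Suc n)) (Dk (Suc n)) (Suc n) #>\<^bsub>rel (Suc n) (Suc n)\<^esub> Dk (Suc n) n (restr (Suc (Suc n)) n t)
      = cell_class (Suc n) (D n t)" if "t \<in> carrier (C n)" for t
    using restr_D [OF that, of "Suc (Suc n)"] by (simp add: cell_class_def coh_class_def)
  have c: "s \<in> carrier (C n)" using assms Lift_carrier by blast
  let ?b = "restr (Suc (Suc n)) n s"
  have "?b \<in> carrier (rel_cochains (R (Suc (Suc n))) (R n) F n)"
    using assms restrict_simplices_closed [OF R_sub c] subsetD [OF simplices_mono [OF RR]]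
    by (auto simp: rel_cochains_iff [OF RR] Lift_def Fil_iff)
  moreover have "restr (Suc n) n ?b \<in> cell_class n s"
    unfolding restr_restr cell_class_def by (rule cochain_complex.coh_class_self [OF relc Lift_cocycle [OF assms]])
  ultimately show "\<exists>b\<in>carrier (rel_cochains (R (Suc (Suc n))) (R n) F n). restr (Suc n) n b \<in> cell_class n s \<and>
      cell_class (Suc n) (D n s) = coboundaries (rel (Suc n)) (Dk (Suc n)) (Suc n) #>\<^bsub>rel (Suc n) (Suc n)\<^esub> Dk (Suc n) n b"
    using k [OF c] by metis
  fix \<kappa>
  assume "\<exists>b\<in>carrier (rel_cochains (R (Suc (Suc n))) (R n) F n). restr (Suc n) n b \<in> cell_class n s \<and>
      \<kappa> = coboundaries (rel (Suc n)) (Dk (Suc n)) (Suc n) #>\<^bsub>rel (Suc n) (Suc n)\<^esub> Dk (Suc n) n b"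
  then obtain b where b: "b \<in> carrier (rel_cochains (R (Suc (Suc n))) (R n) F n)" "restr (Suc n) n b \<in> cell_class n s"
    "\<kappa> = coboundaries (rel (Suc n)) (Dk (Suc n)) (Suc n) #>\<^bsub>rel (Suc n) (Suc n)\<^esub> Dk (Suc n) n b" by blast
  then have b': "b \<in> carrier (cochains (R (Suc (Suc n))) F n)" "\<And>\<sigma>. \<sigma> \<in> simplices (R n) n \<Longrightarrow> b \<sigma> = \<one>\<^bsub>sec F (last \<sigma>)\<^esub>"
    using rel_cochains_iff [OF RR] by blast+
  obtain t where t: "t \<in> carrier (C n)" "restr (Suc (Suc n)) n t = b"
    using extend_cochain [OF order_refl R_sub b'(1)] by blast
  then have tJ: "t \<in> Fil n n"
    using b'(2) subsetD [OF simplices_mono [OF RR]] by (fastforce simp: Fil_iff)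
  have tr: "restr (Suc n) n t \<in> coh_class (rel n) (Dk n) n (restr (Suc n) n s)"
    using b(2) restr_restr [of t n] t(2) by (simp add: cell_class_def)
  note rep = cochain_complex.coh_class_repr [OF relc tr Lift_cocycle [OF assms]]
  then have tW: "t \<in> Lift n" using restr_cocycle [OF tJ] tJ by (simp add: Lift_def)
  have "cell_class n t = cell_class n s" using rep(2) by (simp add: cell_class_def)
  then have "cell_class (Suc n) (D n t) = cell_class (Suc n) (D n s)" by (rule cell_class_D_eq [OF tW assms])
  then show "\<kappa> = cell_class (Suc n) (D n s)" using k [OF t(1)] t(2) b(3) by simp
qed

lemma EC: "cochain_complex E cell_conn"
proof (rule cochain_complex.intro)
  show "comm_group (E n)" for n by (rule E_group)
  show "cell_conn n \<in> hom (E n) (E (Suc n))" for n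
  proof (rule homI)
    fix c assume "c \<in> carrier (E n)"
    then show "cell_conn n c \<in> carrier (E (Suc n))" using D_Lift_of cell_conn_cell_class cell_class_closed by (auto simp: cell_class_surj)
  next
    fix c c' assume "c \<in> carrier (E n)" "c' \<in> carrier (E n)"
    then obtain s t where st: "s \<in> Lift n" "t \<in> Lift n" "c = cell_class n s" "c' = cell_class n t" by (auto simp: cell_class_surj)
    have "cell_conn n (c \<otimes>\<^bsub>E n\<^esub> c') = cell_class (Suc n) (D n (s \<otimes>\<^bsub>C n\<^esub> t))"
      using st subgroup.m_closed [OF Lift_subgroup] by (simp add: cell_conn_cell_class flip: cell_class_mult)
    also have "\<dots> = cell_conn n c \<otimes>\<^bsub>E (Suc n)\<^esub> cell_conn n c'"
      using st D_Lift_of Lift_carrier by (simp add: cell_conn_cell_class D_mult cell_class_mult)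
    finally show "cell_conn n (c \<otimes>\<^bsub>E n\<^esub> c') = cell_conn n c \<otimes>\<^bsub>E (Suc n)\<^esub> cell_conn n c'" .
  qed
  show "cell_conn (Suc n) (cell_conn n c) = \<one>\<^bsub>E (Suc (Suc n))\<^esub>" if cE: "c \<in> carrier (E n)" for c n
  proof -
    obtain s where s: "s \<in> Lift n" "c = cell_class n s" using cE by (auto simp: cell_class_surj)
    then have "cell_conn (Suc n) (cell_conn n c) = cell_class (Suc (Suc n)) (D (Suc n) (D n s))"
      using D_Lift_of by (simp add: cell_conn_cell_class)
    also have "\<dots> = cell_class (Suc (Suc n)) \<one>\<^bsub>C (Suc (Suc n))\<^esub>"
      using s Lift_carrier CC.d_d by simp
    also have "\<dots> = \<one>\<^bsub>E (Suc (Suc n))\<^esub>"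
      by (rule cell_class_one)
    finally show ?thesis .
  qed
qed

text \<open>
  Let \<open>M\<close> be the group of cocycles of degree \<open>n\<close> in \<open>Fil n\<close>. Every cocycle is cohomologous to one in
  \<open>M\<close> by \<open>high_degree_push\<close>, and every cellular cocycle comes from \<open>M\<close> by \<open>low_degree_coboundary\<close>.
  The same two facts show that an element of \<open>M\<close> is a coboundary iff its cellular class is one.
\<close>

theorem cohomology_iso_cellular: "cohomology C D n \<cong> cohomology E cell_conn n"
proof -
  interpret Cn: comm_group "C n" by (rule Cg)
  define M where "M = {s \<in> Fil n n. D n s = \<one>\<^bsub>C (Suc n)\<^esub>}"
  have MJ: "M = Fil n n \<inter> cocycles C D n" using Fil_carrier by (auto simp: M_def CC.cocycles_iff)
  then have Msub: "subgroup M (C n)" by (simp add: subgroup_Int Fil_subgroup CC.cocycles_subgroup)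
  have MW: "s \<in> Lift n" if "s \<in> M" for s
    using that subgroup.one_closed [OF Fil_subgroup] by (simp add: M_def Lift_def)
  have Mz: "s \<in> cocycles C D n" if "s \<in> M" for s using that MJ by blast
  have one_Lift: "cell_conn n (cell_class n s) = \<one>\<^bsub>E (Suc n)\<^esub> \<longleftrightarrow> cell_class (Suc n) (D n s) = \<one>\<^bsub>E (Suc n)\<^esub>" if "s \<in> Lift n" for s
    using cell_conn_cell_class [OF that] by simp
  have cz: "cell_class n s \<in> cocycles E cell_conn n" if "s \<in> M" for s
    using that cell_conn_cell_class [OF MW [OF that]] cell_class_closed [OF MW [OF that]]
    by (simp add: cochain_complex.cocycles_iff [OF EC] M_def cell_class_one)
  let ?MG = "(C n)\<lparr>carrier := M\<rparr>"
  show ?thesis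
  proof (rule iso_same_kernel [of ?MG _ _ "coh_class C D n" "\<lambda>s. coh_class E cell_conn n (cell_class n s)"])
    show "group ?MG" by (rule group.subgroup_imp_group [OF Cgrp Msub])
    show "group (cohomology C D n)" "group (cohomology E cell_conn n)"
      using CC.cohomology_comm_group cochain_complex.cohomology_comm_group [OF EC]
      by (auto simp: comm_group_def)
    show "coh_class C D n \<in> hom ?MG (cohomology C D n)"
      by (rule homI) (use Mz CC.coh_class_mult CC.carrier_cohomology in auto)
    show "(\<lambda>s. coh_class E cell_conn n (cell_class n s)) \<in> hom ?MG (cohomology E cell_conn n)"
      by (rule homI)
        (use cz MW in \<open>auto simp: cell_class_mult cochain_complex.coh_class_mult [OF EC] cochain_complex.carrier_cohomology [OF EC]\<close>)
    show "coh_class C D n ` carrier ?MG = carrier (cohomology C D n)"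
    proof (intro equalityI subsetI)
      fix c assume "c \<in> carrier (cohomology C D n)"
      then obtain s where s: "s \<in> cocycles C D n" "c = coh_class C D n s" by (auto simp: CC.carrier_cohomology)
      then have sc: "s \<in> carrier (C n)" "D n s = \<one>\<^bsub>C (Suc n)\<^esub>" by (auto simp: CC.cocycles_iff)
      then obtain b where b: "b \<in> Cob 0 n" "s \<otimes>\<^bsub>C n\<^esub> inv\<^bsub>C n\<^esub> b \<in> Fil n n"
        using high_degree_push [of s n n] subgroup.one_closed [OF Fil_subgroup] by fastforce
      let ?t = "s \<otimes>\<^bsub>C n\<^esub> inv\<^bsub>C n\<^esub> b"
      have tM: "?t \<in> M" using b D_diff_Cob [OF sc(1) b(1)] sc(2) by (simp add: M_def)
      have bz: "b \<in> cocycles C D n" "coh_class C D n b = \<one>\<^bsub>cohomology C D n\<^esub>"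
        using b(1) CC.coboundaries_cocycles CC.coh_class_one_iff unfolding Cob_0 by blast+
      have "c = coh_class C D n (?t \<otimes>\<^bsub>C n\<^esub> b)" using s(2) diff_add_cancel_C [OF sc(1) Cob_carrier [OF b(1)]] by simp
      also have "\<dots> = coh_class C D n ?t \<otimes>\<^bsub>cohomology C D n\<^esub> \<one>\<^bsub>cohomology C D n\<^esub>"
        using CC.coh_class_mult [OF Mz [OF tM] bz(1)] bz(2) by simp
      also have "\<dots> = coh_class C D n ?t"
        using comm_group.axioms(2) [OF CC.cohomology_comm_group] Mz [OF tM]
        by (simp add: group.is_monoid monoid.r_one CC.carrier_cohomology)
      finally show "c \<in> coh_class C D n ` carrier ?MG" using tM by simp
    qed (use Mz in \<open>auto simp: CC.carrier_cohomology\<close>)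
    show "(\<lambda>s. coh_class E cell_conn n (cell_class n s)) ` carrier ?MG = carrier (cohomology E cell_conn n)"
    proof (intro equalityI subsetI)
      fix c assume "c \<in> carrier (cohomology E cell_conn n)"
      then obtain e where e: "e \<in> cocycles E cell_conn n" "c = coh_class E cell_conn n e"
        by (auto simp: cochain_complex.carrier_cohomology [OF EC])
      then obtain s where s: "s \<in> Lift n" "e = cell_class n s"
        by (auto simp: cochain_complex.cocycles_iff [OF EC] cell_class_surj)
      have sc: "s \<in> carrier (C n)" using s Lift_carrier by blast
      have DsW: "D n s \<in> Lift (Suc n)" using s D_Lift_of by blast
      have "cell_class (Suc n) (D n s) = \<one>\<^bsub>E (Suc n)\<^esub>"
        using e s one_Lift by (simp add: cochain_complex.cocycles_iff [OF EC])
      then obtain t where t: "t \<in> Fil (Suc n) n" "D n s \<otimes>\<^bsub>C (Suc n)\<^esub> inv\<^bsub>C (Suc n)\<^esub> D n t \<in> Fil (Suc (Suc n)) (Suc n)"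
        using cell_class_one_iff [OF DsW] by (auto simp: Cob_Suc_deg)
      have tc: "t \<in> carrier (C n)" using t Fil_carrier by blast
      let ?s' = "s \<otimes>\<^bsub>C n\<^esub> inv\<^bsub>C n\<^esub> t"
      have s'c: "?s' \<in> carrier (C n)" using diff_closed [OF sc tc] .
      have "D n ?s' \<in> Cob (Suc (Suc n)) (Suc n)"
        using t(2) D_diff [OF sc tc] CC.d_d [OF s'c] by (intro low_degree_coboundary) auto
      then obtain u where u: "u \<in> Fil (Suc (Suc n)) n" "D n ?s' = D n u" by (auto simp: Cob_Suc_deg)
      have uc: "u \<in> carrier (C n)" using u Fil_carrier by blast
      let ?s'' = "?s' \<otimes>\<^bsub>C n\<^esub> inv\<^bsub>C n\<^esub> u"
      have tJ: "t \<otimes>\<^bsub>C n\<^esub> u \<in> Fil (Suc n) n"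
        using t(1) u(1) Fil_Suc subgroup.m_closed [OF Fil_subgroup] by blast
      have eq: "s \<otimes>\<^bsub>C n\<^esub> inv\<^bsub>C n\<^esub> ?s'' = t \<otimes>\<^bsub>C n\<^esub> u"
      proof -
        have "s \<otimes>\<^bsub>C n\<^esub> inv\<^bsub>C n\<^esub> ?s'' = s \<otimes>\<^bsub>C n\<^esub> (inv\<^bsub>C n\<^esub> s \<otimes>\<^bsub>C n\<^esub> (t \<otimes>\<^bsub>C n\<^esub> u))"
          using sc tc uc by (simp add: Cn.inv_mult Cn.m_assoc)
        also have "\<dots> = s \<otimes>\<^bsub>C n\<^esub> inv\<^bsub>C n\<^esub> s \<otimes>\<^bsub>C n\<^esub> (t \<otimes>\<^bsub>C n\<^esub> u)"
          using sc tc uc by (intro Cn.m_assoc [symmetric]) auto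
        also have "\<dots> = t \<otimes>\<^bsub>C n\<^esub> u" using sc tc uc by simp
        finally show ?thesis .
      qed
      have "u \<in> Fil n n" "t \<in> Fil n n" using t(1) u(1) subsetD [OF Fil_Suc] by blast+
      then have "?s'' \<in> Fil n n"
        using s by (intro subgroup_diff [OF Fil_subgroup]) (auto simp: Lift_def)
      moreover have "D n ?s'' = \<one>\<^bsub>C (Suc n)\<^esub>"
        using D_diff [OF s'c uc] u(2) group.r_inv [OF Cgrp D_closed [OF uc]] by simp
      ultimately have M: "?s'' \<in> M" by (simp add: M_def)
      have "cell_class n s = cell_class n ?s''" using tJ eq by (intro cell_class_eqI [OF s(1) MW [OF M]]) simp
      then show "c \<in> (\<lambda>s. coh_class E cell_conn n (cell_class n s)) ` carrier ?MG" using M e s by auto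
    qed (use cz in \<open>auto simp: cochain_complex.carrier_cohomology [OF EC]\<close>)
    fix s assume "s \<in> carrier ?MG"
    then have s: "s \<in> M" by simp
    have sc: "s \<in> carrier (C n)" "D n s = \<one>\<^bsub>C (Suc n)\<^esub>" "s \<in> Fil n n" using s by (auto simp: M_def Fil_carrier)
    have A: "coh_class C D n s = \<one>\<^bsub>cohomology C D n\<^esub> \<longleftrightarrow> s \<in> Cob 0 n"
      unfolding Cob_0 by (rule CC.coh_class_one_iff [OF Mz [OF s]])
    have B: "coh_class E cell_conn n (cell_class n s) = \<one>\<^bsub>cohomology E cell_conn n\<^esub> \<longleftrightarrow> cell_class n s \<in> coboundaries E cell_conn n"
      by (rule cochain_complex.coh_class_one_iff [OF EC cz [OF s]])
    have low: "u \<in> Cob 0 n" if "u \<in> Fil (Suc n) n" "D n u = \<one>\<^bsub>C (Suc n)\<^esub>" for u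
      using low_degree_coboundary [of u "Suc n" n] that Cob_antimono0 by blast
    have "cell_class n s \<in> coboundaries E cell_conn n \<longleftrightarrow> s \<in> Cob 0 n"
    proof
      assume "cell_class n s \<in> coboundaries E cell_conn n"
      then obtain a where a: "a \<in> Cob 0 n" "a \<in> Lift n" "cell_class n s = cell_class n a"
      proof (cases n)
        case 0
        then have "cell_class n s = \<one>\<^bsub>E n\<^esub>" using \<open>cell_class n s \<in> _\<close> by (simp add: coboundaries_def)
        also have "\<dots> = cell_class n \<one>\<^bsub>C n\<^esub>"
          by (simp add: cell_class_one)
        finally show ?thesis
          using that [of "\<one>\<^bsub>C n\<^esub>"] subgroup.one_closed [OF Cob_subgroup] subgroup.one_closed [OF Lift_subgroup] by blast
      next
        case (Suc m)
        then obtain t where t: "t \<in> Lift m" "cell_class n s = cell_class n (D m t)"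
          using \<open>cell_class n s \<in> _\<close> cell_conn_cell_class by (auto simp: coboundaries_def cell_class_surj)
        have "D m t \<in> Lift n" using t Suc Lift_carrier D_Lift [of t m] by (simp add: Lift_def)
        then show ?thesis using that t Cob_D [OF Lift_carrier [OF t(1)]] Suc by blast
      qed
      let ?u = "s \<otimes>\<^bsub>C n\<^esub> inv\<^bsub>C n\<^esub> a"
      have uW: "?u \<in> Lift n" using subgroup_diff [OF Lift_subgroup MW [OF s] a(2)] .
      have "cell_class n ?u = \<one>\<^bsub>E n\<^esub>" using cell_class_eq_iff [OF MW [OF s] a(2)] a(3) by simp
      then obtain b where b: "b \<in> Cob n n" "?u \<otimes>\<^bsub>C n\<^esub> inv\<^bsub>C n\<^esub> b \<in> Fil (Suc n) n"
        using cell_class_one_iff [OF uW] by blast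
      have "D n (?u \<otimes>\<^bsub>C n\<^esub> inv\<^bsub>C n\<^esub> b) = \<one>\<^bsub>C (Suc n)\<^esub>"
        using D_diff_Cob [OF Lift_carrier [OF uW] b(1)] D_diff_Cob [OF sc(1) a(1)] sc(2) by simp
      then have "?u \<otimes>\<^bsub>C n\<^esub> inv\<^bsub>C n\<^esub> b \<in> Cob 0 n" using low b(2) by blast
      then have "?u \<otimes>\<^bsub>C n\<^esub> inv\<^bsub>C n\<^esub> b \<otimes>\<^bsub>C n\<^esub> b \<in> Cob 0 n"
        using b(1) Cob_antimono0 subgroup.m_closed [OF Cob_subgroup] by blast
      then have "?u \<in> Cob 0 n" using diff_add_cancel_C [OF Lift_carrier [OF uW] Cob_carrier [OF b(1)]] by simp
      then have "?u \<otimes>\<^bsub>C n\<^esub> a \<in> Cob 0 n" using a(1) subgroup.m_closed [OF Cob_subgroup] by blast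
      then show "s \<in> Cob 0 n" using diff_add_cancel_C [OF sc(1) Cob_carrier [OF a(1)]] by simp
    next
      assume sB: "s \<in> Cob 0 n"
      show "cell_class n s \<in> coboundaries E cell_conn n"
      proof (cases n)
        case 0
        then have "s = \<one>\<^bsub>C n\<^esub>" using sB by (simp add: Cob_zero_deg)
        then have "cell_class n s = \<one>\<^bsub>E n\<^esub>"
          by (simp add: cell_class_one)
        then show ?thesis using 0 by (simp add: coboundaries_def)
      next
        case (Suc m)
        then obtain t where t: "t \<in> carrier (C m)" "s = D m t" using sB by (auto simp: Cob_Suc_deg Fil_0)
        have Dt: "D m t \<in> Fil (Suc m) (Suc m)" using sc(3) t(2) Suc by simp
        then obtain b where b: "b \<in> Cob 0 m" "t \<otimes>\<^bsub>C m\<^esub> inv\<^bsub>C m\<^esub> b \<in> Fil m m"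
          using high_degree_push [OF t(1), of m] Fil_Suc by blast
        let ?t = "t \<otimes>\<^bsub>C m\<^esub> inv\<^bsub>C m\<^esub> b"
        have eq: "D m ?t = s" using D_diff_Cob [OF t(1) b(1)] t(2) by simp
        then have tW: "?t \<in> Lift m" using b(2) Dt t(2) by (simp add: Lift_def)
        then have "cell_class n s = cell_conn m (cell_class m ?t)" using cell_conn_cell_class [OF tW] eq Suc by simp
        then show ?thesis using cell_class_closed [OF tW] Suc by (simp add: coboundaries_def)
      qed
    qed
    then show "coh_class C D n s = \<one>\<^bsub>cohomology C D n\<^esub> \<longleftrightarrow> coh_class E cell_conn n (cell_class n s) = \<one>\<^bsub>cohomology E cell_conn n\<^esub>"
      using A B by blast
  qed
qed

end

section \<open>Tensor products with free abelian groups\<close>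

lemma sum_group_finite:
  assumes "finite I" "\<And>i. i \<in> I \<Longrightarrow> group (G i)" shows "sum_group I G = product_group I G"
proof -
  have "carrier (sum_group I G) = carrier (product_group I G)"
    using assms by (subst carrier_sum_group) auto
  then show ?thesis by (simp add: sum_group_def product_group_def subgroup_generated_def)
qed

lemma product_group_hom:
  assumes "\<And>i. i \<in> I \<Longrightarrow> f i \<in> hom G (H i)"
  shows "(\<lambda>x. \<lambda>i\<in>I. f i x) \<in> hom G (product_group I H)"
  using assms by (auto simp: hom_def fun_eq_iff Pi_iff)

lemma hom_free_eq_frag_eval:
  assumes "comm_group G" "f \<in> hom (free_Abelian_group S) G" "supp z \<subseteq> S"
  shows "f z = frag_eval G (\<lambda>i. f (frag_of i)) z"
proof -
  interpret Gc: comm_group G by fact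
  interpret f: group_hom "free_Abelian_group S" G f
    using assms(2) Gc.group_axioms by (simp add: group_hom_def group_hom_axioms_def)
  have c: "(\<lambda>i. f (frag_of i)) ` S \<subseteq> carrier G"
    by (intro image_subsetI f.hom_closed) simp
  have "supp z \<subseteq> S \<and> f z = frag_eval G (\<lambda>i. f (frag_of i)) z"
    using assms(3)
  proof (induction z rule: frag_induction)
    case zero
    then show ?case using f.hom_one by simp
  next
    case (one x)
    then show ?case using c by (auto simp: Gc.frag_eval_of)
  next
    case (diff a b)
    then have k: "supp a \<subseteq> S" "supp b \<subseteq> S" by auto
    have "f (a - b) = f (a \<otimes>\<^bsub>free_Abelian_group S\<^esub> inv\<^bsub>free_Abelian_group S\<^esub> b)" using k by simp
    also have "\<dots> = f a \<otimes>\<^bsub>G\<^esub> inv\<^bsub>G\<^esub> f b"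
    proof -
      have "inv\<^bsub>free_Abelian_group S\<^esub> b \<in> carrier (free_Abelian_group S)" using k by simp
      then have "f (a \<otimes>\<^bsub>free_Abelian_group S\<^esub> inv\<^bsub>free_Abelian_group S\<^esub> b) =
          f a \<otimes>\<^bsub>G\<^esub> f (inv\<^bsub>free_Abelian_group S\<^esub> b)"
        using k by (intro f.hom_mult) auto
      also have "f (inv\<^bsub>free_Abelian_group S\<^esub> b) = inv\<^bsub>G\<^esub> f b" using k by (intro f.hom_inv) auto
      finally show ?thesis .
    qed
    finally show ?case using diff k keys_diff_subset [OF k] by (simp add: Gc.frag_eval_diff [OF k c])
  qed
  then show ?thesis by simp
qed

text \<open>
  Let \<open>e\<close> be the basis of \<open>A\<close>. The map \<open>\<theta>\<close> sends a pair \<open>(a, h)\<close> to the powers of \<open>h\<close> by the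
  coordinates of \<open>a\<close>, and \<open>\<Gamma>\<close> reassembles a tensor from such a family. By bilinearity \<open>\<Gamma> \<circ> \<theta>\<close>
  agrees on generators with the projection \<open>\<kappa>\<close> to the tensor product, so an element killed by \<open>\<theta>\<close>
  is a consequence of the relations.
\<close>

lemma tensor_free:
  fixes A :: "'c monoid" and H :: "'e monoid"
  assumes A: "comm_group A" and H: "comm_group H" and I: "finite I" and iso: "A \<cong> free_Abelian_group I"
  shows "tensor_group A H \<cong> product_group I (\<lambda>_. H)" "comm_group (tensor_group A H)"
proof -
  interpret A: comm_group A by fact
  interpret H: comm_group H by fact
  let ?L = "free_Abelian_group (carrier A \<times> carrier H)"
  interpret L: comm_group ?L by (rule abelian_free_Abelian_group)
  define Rel where "Rel = {frag_of (g \<otimes>\<^bsub>A\<^esub> g', h) - frag_of (g, h) - frag_of (g', h) | g g' h.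
            g \<in> carrier A \<and> g' \<in> carrier A \<and> h \<in> carrier H} \<union>
         {frag_of (g, h \<otimes>\<^bsub>H\<^esub> h') - frag_of (g, h) - frag_of (g, h') | g h h'.
            g \<in> carrier A \<and> h \<in> carrier H \<and> h' \<in> carrier H}"
  define U where "U = generate ?L Rel"
  have T: "tensor_group A H = ?L Mod U"
    by (simp add: tensor_group_def U_def Rel_def Let_def)
  have Rel_sub: "Rel \<subseteq> carrier ?L"
  proof -
    have "frag_of p - frag_of q - frag_of r \<in> carrier ?L"
      if "p \<in> carrier A \<times> carrier H" "q \<in> carrier A \<times> carrier H" "r \<in> carrier A \<times> carrier H" for p q r
      using that keys_diff_subset [OF keys_diff_subset, of "frag_of p" "carrier A \<times> carrier H" "frag_of q" "frag_of r"]
      by simp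
    then show ?thesis unfolding Rel_def by (intro Un_least subsetI; elim CollectE exE conjE) simp_all
  qed
  have U: "subgroup U ?L" unfolding U_def by (rule L.generate_is_subgroup [OF Rel_sub])
  have Un: "U \<lhd> ?L" using U L.normal_iff_subgroup by blast
  interpret T: comm_group "?L Mod U" by (rule L.abelian_FactGroup [OF U])
  show "comm_group (tensor_group A H)" unfolding T by (rule T.comm_group_axioms)
  define \<kappa> where "\<kappa> = (\<lambda>z. U #>\<^bsub>?L\<^esub> z)"
  have \<kappa>: "\<kappa> \<in> hom ?L (?L Mod U)" unfolding \<kappa>_def by (rule normal.r_coset_hom_Mod [OF Un])
  have \<kappa>_one: "\<kappa> z = \<one>\<^bsub>?L Mod U\<^esub> \<longleftrightarrow> z \<in> U" if "z \<in> carrier ?L" for z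
    unfolding \<kappa>_def one_FactGroup using L.coset_join1 [OF _ that U] L.coset_join2 [OF that U] by blast
  define br where "br = (\<lambda>a h. \<kappa> (frag_of (a, h)))"
  have kap_eq: "\<kappa> u = \<kappa> v \<otimes>\<^bsub>?L Mod U\<^esub> \<kappa> w" if "u - v - w \<in> U" "supp u \<subseteq> carrier A \<times> carrier H"
    "supp v \<subseteq> carrier A \<times> carrier H" "supp w \<subseteq> carrier A \<times> carrier H" for u v w
  proof -
    have k: "u - v - w \<in> carrier ?L" "v + w \<in> carrier ?L" "v \<in> carrier ?L" "w \<in> carrier ?L"
      using that keys_diff_subset [OF keys_diff_subset [OF that(2,3)] that(4)] keys_add_subset [OF that(3,4)] by auto
    have "\<kappa> u = \<kappa> ((u - v - w) \<otimes>\<^bsub>?L\<^esub> (v + w))" by simp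
    also have "\<dots> = \<kappa> (u - v - w) \<otimes>\<^bsub>?L Mod U\<^esub> \<kappa> (v + w)" by (rule hom_mult [OF \<kappa> k(1,2)])
    also have "\<kappa> (u - v - w) = \<one>\<^bsub>?L Mod U\<^esub>" using \<kappa>_one [OF k(1)] that(1) by blast
    also have "\<one>\<^bsub>?L Mod U\<^esub> \<otimes>\<^bsub>?L Mod U\<^esub> \<kappa> (v + w) = \<kappa> (v \<otimes>\<^bsub>?L\<^esub> w)"
      using hom_in_carrier [OF \<kappa> k(2)] by (simp del: mult_FactGroup one_FactGroup)
    also have "\<dots> = \<kappa> v \<otimes>\<^bsub>?L Mod U\<^esub> \<kappa> w" by (rule hom_mult [OF \<kappa> k(3,4)])
    finally show ?thesis .
  qed
  have br_closed: "br a h \<in> carrier (?L Mod U)" if "a \<in> carrier A" "h \<in> carrier H" for a h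
    unfolding br_def using that by (intro hom_in_carrier [OF \<kappa>]) simp
  have br1: "(\<lambda>a. br a h) \<in> hom A (?L Mod U)" if h: "h \<in> carrier H" for h
  proof (rule homI)
    fix a a' assume a: "a \<in> carrier A" "a' \<in> carrier A"
    then have "frag_of (a \<otimes>\<^bsub>A\<^esub> a', h) - frag_of (a, h) - frag_of (a', h) \<in> U"
      unfolding U_def Rel_def using h by (intro generate.incl) blast
    then show "br (a \<otimes>\<^bsub>A\<^esub> a') h = br a h \<otimes>\<^bsub>?L Mod U\<^esub> br a' h"
      unfolding br_def using a h by (intro kap_eq) auto
  qed (use br_closed h in auto)
  have br2: "br a \<in> hom H (?L Mod U)" if a: "a \<in> carrier A" for a
  proof (rule homI)
    fix h h' assume h: "h \<in> carrier H" "h' \<in> carrier H"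
    then have "frag_of (a, h \<otimes>\<^bsub>H\<^esub> h') - frag_of (a, h) - frag_of (a, h') \<in> U"
      unfolding U_def Rel_def using a by (intro generate.incl) blast
    then show "br a (h \<otimes>\<^bsub>H\<^esub> h') = br a h \<otimes>\<^bsub>?L Mod U\<^esub> br a h'"
      unfolding br_def using a h by (intro kap_eq) auto
  qed (use br_closed a in auto)
  obtain \<alpha> where \<alpha>: "\<alpha> \<in> iso A (free_Abelian_group I)" using iso by (auto simp: is_iso_def)
  then have \<alpha>h: "\<alpha> \<in> hom A (free_Abelian_group I)" by (simp add: iso_def)
  define \<beta> where "\<beta> = inv_into (carrier A) \<alpha>"
  have "\<beta> \<in> iso (free_Abelian_group I) A" unfolding \<beta>_def by (rule A.iso_set_sym [OF \<alpha>])
  then have \<beta>h: "\<beta> \<in> hom (free_Abelian_group I) A" by (simp add: iso_def)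
  have \<beta>\<alpha>: "\<beta> (\<alpha> a) = a" if "a \<in> carrier A" for a
    unfolding \<beta>_def using \<alpha> that by (intro inv_into_f_f) (auto simp: iso_def bij_betw_def)
  have \<alpha>\<beta>: "\<alpha> (\<beta> z) = z" if "supp z \<subseteq> I" for z
  proof -
    have "z \<in> \<alpha> ` carrier A" using \<alpha> that by (auto simp: iso_def bij_betw_def)
    then show ?thesis unfolding \<beta>_def by (rule f_inv_into_f)
  qed
  define e where "e = (\<lambda>i. \<beta> (frag_of i))"
  have e: "e i \<in> carrier A" if "i \<in> I" for i unfolding e_def using that by (intro hom_in_carrier [OF \<beta>h]) simp
  have \<alpha>k: "supp (\<alpha> a) \<subseteq> I" if "a \<in> carrier A" for a using hom_in_carrier [OF \<alpha>h that] by simp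
  define co where "co = (\<lambda>i (a, h). h [^]\<^bsub>H\<^esub> coef (\<alpha> a) i)"
  have co_c: "co i ` (carrier A \<times> carrier H) \<subseteq> carrier H" for i by (auto simp: co_def)
  define \<theta> where "\<theta> = (\<lambda>z. \<lambda>i\<in>I. frag_eval H (co i) z)"
  have \<theta>: "\<theta> \<in> hom ?L (product_group I (\<lambda>_. H))"
    unfolding \<theta>_def by (rule product_group_hom) (rule H.frag_eval_hom [OF co_c])
  define \<Gamma> where "\<Gamma> = (\<lambda>g. finprod (?L Mod U) (\<lambda>i. br (e i) (g i)) I)"
  have \<Gamma>: "\<Gamma> \<in> hom (product_group I (\<lambda>_. H)) (?L Mod U)"
  proof (rule homI)
    fix g assume g: "g \<in> carrier (product_group I (\<lambda>_. H))"
    then show "\<Gamma> g \<in> carrier (?L Mod U)" unfolding \<Gamma>_def using br_closed e by (intro T.finprod_closed) auto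
    fix g' assume g': "g' \<in> carrier (product_group I (\<lambda>_. H))"
    have gi: "g i \<in> carrier H" "g' i \<in> carrier H" if "i \<in> I" for i using g g' that by auto
    have "\<Gamma> (g \<otimes>\<^bsub>product_group I (\<lambda>_. H)\<^esub> g') =
        finprod (?L Mod U) (\<lambda>i. br (e i) (g i) \<otimes>\<^bsub>?L Mod U\<^esub> br (e i) (g' i)) I"
      unfolding \<Gamma>_def
    proof (rule T.finprod_cong')
      show "br (e i) ((g \<otimes>\<^bsub>product_group I (\<lambda>_. H)\<^esub> g') i) = br (e i) (g i) \<otimes>\<^bsub>?L Mod U\<^esub> br (e i) (g' i)"
        if "i \<in> I" for i
        using hom_mult [OF br2 [OF e [OF that]] gi [OF that]] that by simp
      show "(\<lambda>i. br (e i) (g i) \<otimes>\<^bsub>?L Mod U\<^esub> br (e i) (g' i)) \<in> I \<rightarrow> carrier (?L Mod U)"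
        by (intro Pi_I T.m_closed br_closed e gi)
    qed simp
    also have "\<dots> = \<Gamma> g \<otimes>\<^bsub>?L Mod U\<^esub> \<Gamma> g'"
      unfolding \<Gamma>_def using br_closed e gi by (intro T.finprod_multf) auto
    finally show "\<Gamma> (g \<otimes>\<^bsub>product_group I (\<lambda>_. H)\<^esub> g') = \<Gamma> g \<otimes>\<^bsub>?L Mod U\<^esub> \<Gamma> g'" .
  qed
  have gen: "\<kappa> (frag_of (a, h)) = \<Gamma> (\<theta> (frag_of (a, h)))" if a: "a \<in> carrier A" and h: "h \<in> carrier H" for a h
  proof -
    let ?f = "\<lambda>z. br (\<beta> z) h"
    have "(\<lambda>a. br a h) \<circ> \<beta> \<in> hom (free_Abelian_group I) (?L Mod U)"
      by (rule hom_compose [OF \<beta>h br1 [OF h]])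
    then have fh: "?f \<in> hom (free_Abelian_group I) (?L Mod U)" by (simp add: o_def)
    have "br a h = ?f (\<alpha> a)" using \<beta>\<alpha> [OF a] by simp
    also have "\<dots> = frag_eval (?L Mod U) (\<lambda>i. br (e i) h) (\<alpha> a)"
      unfolding e_def by (rule hom_free_eq_frag_eval [OF T.comm_group_axioms fh \<alpha>k [OF a]])
    also have "\<dots> = finprod (?L Mod U) (\<lambda>i. br (e i) h [^]\<^bsub>?L Mod U\<^esub> coef (\<alpha> a) i) I"
      using br_closed e h by (intro T.frag_eval_superset [OF \<alpha>k [OF a] I]) auto
    also have "\<dots> = \<Gamma> (\<theta> (frag_of (a, h)))"
      unfolding \<Gamma>_def
    proof (rule T.finprod_cong')
      fix i assume i: "i \<in> I"
      have "\<theta> (frag_of (a, h)) i = co i (a, h)"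
        unfolding \<theta>_def co_def using i a h by (simp add: H.frag_eval_of)
      also have "\<dots> = h [^]\<^bsub>H\<^esub> coef (\<alpha> a) i" by (simp add: co_def)
      finally have t: "\<theta> (frag_of (a, h)) i = h [^]\<^bsub>H\<^esub> coef (\<alpha> a) i" .
      interpret b: group_hom H "?L Mod U" "br (e i)"
        using br2 [OF e [OF i]] H.group_axioms T.group_axioms by (simp add: group_hom_def group_hom_axioms_def)
      show "br (e i) h [^]\<^bsub>?L Mod U\<^esub> coef (\<alpha> a) i = br (e i) (\<theta> (frag_of (a, h)) i)"
        unfolding t using b.hom_int_pow [OF h] by simp
    next
      show "(\<lambda>i. br (e i) (\<theta> (frag_of (a, h)) i)) \<in> I \<rightarrow> carrier (?L Mod U)"
        using hom_in_carrier [OF \<theta>, of "frag_of (a, h)"] a h br_closed e by auto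
    qed simp
    finally show ?thesis by (simp add: br_def)
  qed
  have \<kappa>_eq: "\<kappa> z = \<Gamma> (\<theta> z)" if z: "z \<in> carrier ?L" for z
  proof -
    have "\<Gamma> \<circ> \<theta> \<in> hom ?L (?L Mod U)" by (rule hom_compose [OF \<theta> \<Gamma>])
    then have h: "(\<lambda>z. \<Gamma> (\<theta> z)) \<in> hom ?L (?L Mod U)" by (simp add: o_def)
    have k: "supp z \<subseteq> carrier A \<times> carrier H" using z by simp
    have "\<kappa> z = frag_eval (?L Mod U) (\<lambda>i. \<kappa> (frag_of i)) z"
      by (rule hom_free_eq_frag_eval [OF T.comm_group_axioms \<kappa> k])
    also have "\<dots> = frag_eval (?L Mod U) (\<lambda>i. \<Gamma> (\<theta> (frag_of i))) z"
    proof (rule T.frag_eval_cong)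
      show "\<kappa> (frag_of i) = \<Gamma> (\<theta> (frag_of i))" if "i \<in> supp z" for i
        using k that gen by (cases i) auto
      show "(\<lambda>i. \<Gamma> (\<theta> (frag_of i))) ` supp z \<subseteq> carrier (?L Mod U)"
        using k by (intro image_subsetI hom_in_carrier [OF h]) auto
    qed
    also have "\<dots> = \<Gamma> (\<theta> z)"
      by (rule hom_free_eq_frag_eval [OF T.comm_group_axioms h k, symmetric])
    finally show ?thesis .
  qed
  interpret th: group_hom ?L "product_group I (\<lambda>_. H)" \<theta>
    using \<theta> L.group_axioms H.group_axioms by (simp add: group_hom_def group_hom_axioms_def)
  have onto: "\<theta> ` carrier ?L = carrier (product_group I (\<lambda>_. H))"
  proof (intro equalityI image_subsetI th.hom_closed subsetI)
    fix g assume g: "g \<in> carrier (product_group I (\<lambda>_. H))"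
    let ?z = "\<Sum>i\<in>I. frag_of (e i, g i)"
    have ks: "supp (frag_of (e i, g i)) \<subseteq> carrier A \<times> carrier H" if "i \<in> I" for i
      using that e g by auto
    have k: "?z \<in> carrier ?L" by (rule sum_closed_free_Abelian_group) (use ks in auto)
    have "\<theta> ?z = g"
    proof (rule PiE_ext)
      show "\<theta> ?z \<in> (\<Pi>\<^sub>E i\<in>I. carrier H)" "g \<in> (\<Pi>\<^sub>E i\<in>I. carrier H)" using th.hom_closed [OF k] g by auto
      fix j assume j: "j \<in> I"
      have "\<theta> ?z j = finprod H (\<lambda>i. frag_eval H (co j) (frag_of (e i, g i))) I"
        unfolding \<theta>_def using j H.frag_eval_sum [OF I ks co_c] by simp
      also have "\<dots> = finprod H (\<lambda>i. if j = i then g i else \<one>\<^bsub>H\<^esub>) I"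
      proof (rule H.finprod_cong')
        fix i assume i: "i \<in> I"
        have "frag_eval H (co j) (frag_of (e i, g i)) = co j (e i, g i)"
          using ks [OF i] co_c by (intro H.frag_eval_of) auto
        also have "\<dots> = (if j = i then g i else \<one>\<^bsub>H\<^esub>)"
          using \<alpha>\<beta> [of "frag_of i"] i PiE_mem [OF g [unfolded carrier_product_group] i] by (auto simp: co_def e_def)
        finally show "frag_eval H (co j) (frag_of (e i, g i)) = (if j = i then g i else \<one>\<^bsub>H\<^esub>)" .
      qed (use g in auto)
      also have "\<dots> = g j" using g I j by (intro H.finprod_singleton) auto
      finally show "\<theta> ?z j = g j" .
    qed
    from image_eqI [where f = \<theta>, OF this [symmetric] k] show "g \<in> \<theta> ` carrier ?L" .
  qed
  have kill: "\<theta> z = \<one>\<^bsub>product_group I (\<lambda>_. H)\<^esub>" if "z \<in> Rel" for z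
  proof -
    have \<theta>_of: "\<theta> (frag_of (a, h)) i = h [^]\<^bsub>H\<^esub> coef (\<alpha> a) i"
      if "a \<in> carrier A" "h \<in> carrier H" "i \<in> I" for a h i
      unfolding \<theta>_def co_def using that by (simp add: H.frag_eval_of)
    have \<theta>_d: "\<theta> (frag_of p - frag_of q - frag_of r) i =
        \<theta> (frag_of p) i \<otimes>\<^bsub>H\<^esub> inv\<^bsub>H\<^esub> \<theta> (frag_of q) i \<otimes>\<^bsub>H\<^esub> inv\<^bsub>H\<^esub> \<theta> (frag_of r) i"
      if "p \<in> carrier A \<times> carrier H" "q \<in> carrier A \<times> carrier H" "r \<in> carrier A \<times> carrier H" "i \<in> I" for p q r i
    proof -
      have k: "supp (frag_of p) \<subseteq> carrier A \<times> carrier H"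
        "supp (frag_of q) \<subseteq> carrier A \<times> carrier H"
        "supp (frag_of r) \<subseteq> carrier A \<times> carrier H" using that by auto
      show ?thesis
        unfolding \<theta>_def using that(4)
        by (simp add: H.frag_eval_diff [OF keys_diff_subset [OF k(1,2)] k(3) co_c] H.frag_eval_diff [OF k(1,2) co_c])
    qed
    have canc: "p \<otimes>\<^bsub>H\<^esub> q \<otimes>\<^bsub>H\<^esub> inv\<^bsub>H\<^esub> p \<otimes>\<^bsub>H\<^esub> inv\<^bsub>H\<^esub> q = \<one>\<^bsub>H\<^esub>"
      if "p \<in> carrier H" "q \<in> carrier H" for p q
    proof -
      have "p \<otimes>\<^bsub>H\<^esub> q \<otimes>\<^bsub>H\<^esub> inv\<^bsub>H\<^esub> p = q"
        unfolding H.m_comm [OF that] using that by (simp add: H.m_assoc)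
      then show ?thesis using that by simp
    qed
    have "\<theta> z i = \<one>\<^bsub>H\<^esub>" if i: "i \<in> I" for i
      using \<open>z \<in> Rel\<close> unfolding Rel_def
    proof (elim UnE CollectE exE conjE)
      fix g g' h assume z: "z = frag_of (g \<otimes>\<^bsub>A\<^esub> g', h) - frag_of (g, h) - frag_of (g', h)"
        and c: "g \<in> carrier A" "g' \<in> carrier A" "h \<in> carrier H"
      have "\<alpha> (g \<otimes>\<^bsub>A\<^esub> g') = \<alpha> g + \<alpha> g'" using hom_mult [OF \<alpha>h c(1,2)] by simp
      then show "\<theta> z i = \<one>\<^bsub>H\<^esub>"
        unfolding z using c i by (simp add: \<theta>_d \<theta>_of lookup_add H.int_pow_mult canc)
    next
      fix g h h' assume z: "z = frag_of (g, h \<otimes>\<^bsub>H\<^esub> h') - frag_of (g, h) - frag_of (g, h')"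
        and c: "g \<in> carrier A" "h \<in> carrier H" "h' \<in> carrier H"
      then show "\<theta> z i = \<one>\<^bsub>H\<^esub>"
        unfolding z using c i by (simp add: \<theta>_d \<theta>_of H.int_pow_mult_distrib [OF H.m_comm] canc)
    qed
    moreover have "\<theta> z \<in> (\<Pi>\<^sub>E i\<in>I. carrier H)" using th.hom_closed [OF subsetD [OF Rel_sub that]] by simp
    ultimately show ?thesis by (intro PiE_ext [of _ I "\<lambda>_. carrier H"]) (simp_all add: PiE_iff)
  qed
  have "kernel ?L (product_group I (\<lambda>_. H)) \<theta> = U"
  proof
    have "U \<subseteq> kernel ?L (product_group I (\<lambda>_. H)) \<theta>"
      unfolding U_def
      by (rule L.generate_subgroup_incl [OF _ th.subgroup_kernel])
        (unfold kernel_def, use kill Rel_sub in blast)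
    then show "U \<subseteq> kernel ?L (product_group I (\<lambda>_. H)) \<theta>" .
    show "kernel ?L (product_group I (\<lambda>_. H)) \<theta> \<subseteq> U"
    proof
      fix z assume "z \<in> kernel ?L (product_group I (\<lambda>_. H)) \<theta>"
      then have z: "z \<in> carrier ?L" "\<theta> z = \<one>\<^bsub>product_group I (\<lambda>_. H)\<^esub>" by (auto simp: kernel_def)
      have "\<Gamma> \<one>\<^bsub>product_group I (\<lambda>_. H)\<^esub> = \<one>\<^bsub>?L Mod U\<^esub>"
        using hom_one [OF \<Gamma>] H.group_axioms T.group_axioms by simp
      then have "\<kappa> z = \<one>\<^bsub>?L Mod U\<^esub>" using \<kappa>_eq [OF z(1)] z(2) by simp
      then show "z \<in> U" using \<kappa>_one [OF z(1)] by blast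
    qed
  qed
  then show "tensor_group A H \<cong> product_group I (\<lambda>_. H)"
    unfolding T using th.FactGroup_iso [OF onto] by simp
qed

section \<open>The groups of top chains modulo relations\<close>

lemma lookup_frag_extend:
  "coef (frag_extend f z) \<tau> =
    (\<Sum>\<sigma>\<in>supp z. coef z \<sigma> * coef (f \<sigma>) \<tau>)"
  by (simp add: frag_extend_def lookup_sum)

lemma sum_keys_superset:
  assumes "supp z \<subseteq> S" "finite S"
  shows "(\<Sum>\<sigma>\<in>supp z. coef z \<sigma> * c \<sigma>) = (\<Sum>\<sigma>\<in>S. coef z \<sigma> * (c \<sigma> :: int))"
  using assms by (intro sum.mono_neutral_left) (auto simp: in_keys_iff)

lemma inner_bdry_face: "\<sigma> \<noteq> [] \<Longrightarrow> inner_bdry \<sigma> = (\<Sum>i<length \<sigma> - 1. frag_cmul ((-1) ^ i) (frag_of (face i \<sigma>)))"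
proof -
  assume "\<sigma> \<noteq> []"
  then obtain m where m: "length \<sigma> = Suc m" by (cases \<sigma>) auto
  have "face m \<sigma> = butlast \<sigma>" using m by (simp add: face_def butlast_conv_take)
  moreover have "bdry \<sigma> = inner_bdry \<sigma> + frag_cmul ((-1) ^ m) (frag_of (butlast \<sigma>))"
    using bdry_snoc [of "butlast \<sigma>" "last \<sigma>"] \<open>\<sigma> \<noteq> []\<close> m by simp
  ultimately show ?thesis using bdry_face [of \<sigma>] m by simp
qed

context proper_semimodular begin

lemma finite_dchains_len: "finite (dchains_len (x :: 'a) y m)"
  using finite_lists_length_eq [OF finite_lattice, of m] by (rule finite_subset [rotated]) auto

text \<open>
  The coranks increase strictly from at least \<open>0\<close> to \<open>n\<close> in \<open>n\<close> steps.
\<close>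

lemma top_chain_corank:
  assumes x: "corank Q rk x = int n" and \<sigma>: "\<sigma> \<in> dchains_len x Orderings.top (Suc n)" and "i \<le> n"
  shows "corank Q rk (\<sigma> ! i) = int i"
proof -
  let ?c = "\<lambda>i. corank Q rk (\<sigma> ! i)"
  have len: "length \<sigma> = Suc n" and srt: "sorted_wrt (>) \<sigma>" and lst: "\<sigma> ! n = x"
    and lt: "\<And>z. z \<in> set \<sigma> \<Longrightarrow> z < Orderings.top"
    using \<sigma> by (auto simp: dchains_def last_conv_nth)
  have step: "?c i < ?c (Suc i)" if "i < n" for i
    using sorted_wrt_nth_less [OF srt, of i "Suc i"] len that by (intro corank_strict) simp
  have low: "int i \<le> ?c i" if "i \<le> n" for i
    using that
  proof (induction i)
    case 0
    have "\<sigma> ! 0 \<in> Q" using lt len by (simp add: in_Q)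
    then show ?case using corank_nonneg by simp
  next
    case (Suc i)
    then show ?case using step [of i] by simp
  qed
  have high: "?c (n - i) \<le> int (n - i)" if "i \<le> n" for i
    using that
  proof (induction i)
    case 0
    then show ?case using x lst by simp
  next
    case (Suc i)
    have "Suc (n - Suc i) = n - i" using Suc.prems by simp
    then show ?case using step [of "n - Suc i"] Suc by auto
  qed
  show ?thesis using low [OF \<open>i \<le> n\<close>] high [of "n - i"] \<open>i \<le> n\<close> by simp
qed

lemma nd_simplices_up_set:
  assumes x: "x \<in> Q" "corank Q rk x = int n"
  shows "nd_simplices (up_set Q x) n = dchains_len x Orderings.top (Suc n)"
proof (intro equalityI subsetI)
  fix \<sigma> assume s: "\<sigma> \<in> nd_simplices (up_set Q x) n"
  then have len: "length \<sigma> = Suc n" and srt: "sorted_wrt (>) \<sigma>" and sub: "set \<sigma> \<subseteq> up_set Q x"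
    by (auto simp: nd_simplices_def)
  then have ne: "\<sigma> \<noteq> []" by auto
  have "\<And>z. z \<in> set \<sigma> \<Longrightarrow> z < Orderings.top" "\<And>z. z \<in> set \<sigma> \<Longrightarrow> x \<le> z"
    using sub by (auto simp: up_set_def in_Q)
  note ts = this
  have "last \<sigma> = x"
  proof (rule ccontr)
    assume "last \<sigma> \<noteq> x"
    then have "x < last \<sigma>" using ts(2) [of "last \<sigma>"] ne by (simp add: less_le)
    have wk: "sorted_wrt (\<ge>) \<sigma>" using srt by (rule sorted_wrt_mono_rel [rotated]) auto
    have "x < z" if "z \<in> set \<sigma>" for z
      using \<open>x < last \<sigma>\<close> sorted_last_le [OF wk that] by (rule less_le_trans)
    then have "\<sigma> @ [x] \<in> dchains x Orderings.top"
      using srt ts(1) x(1) by (auto simp: dchains_def sorted_wrt_append in_Q)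
    from length_chain [OF this] show False using len x(2) by (simp add: corank_eq)
  qed
  then show "\<sigma> \<in> dchains_len x Orderings.top (Suc n)"
    using len srt ne ts(1) by (simp add: dchains_def)
next
  fix \<sigma> assume s: "\<sigma> \<in> dchains_len x Orderings.top (Suc n)"
  then have "set \<sigma> \<subseteq> Q" "sorted_wrt (\<ge>) \<sigma>" using dchains_Q [OF x(1), of \<sigma>] by auto
  moreover have "last \<sigma> = x" using s by (auto simp: dchains_def)
  ultimately show "\<sigma> \<in> nd_simplices (up_set Q x) n"
    using s sorted_last_le [of \<sigma>] by (auto simp: nd_simplices_def up_set_def dchains_def)
qed

text \<open>
  The coranks along a chain that misses exactly the corank \<open>j\<close>.
\<close>

definition gap :: "nat \<Rightarrow> nat \<Rightarrow> 'a list \<Rightarrow> bool" where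
  "gap n j \<tau> \<longleftrightarrow> (\<forall>i<n. corank Q rk (\<tau> ! i) = (if i < j then int i else int i + 1))"

lemma gap_unique:
  assumes "gap n j \<tau>" "gap n j' \<tau>" "j < n" "j' < n" shows "j = j'"
proof (rule ccontr)
  assume "j \<noteq> j'"
  then consider "j < j'" | "j' < j" by linarith
  then show False
  proof cases
    case 1
    then show ?thesis using assms(1,2)[unfolded gap_def, rule_format, of j] assms by auto
  next
    case 2
    then show ?thesis using assms(1,2)[unfolded gap_def, rule_format, of j'] assms by auto
  qed
qed

lemma face_gap:
  assumes x: "corank Q rk x = int n" and \<sigma>: "\<sigma> \<in> dchains_len x Orderings.top (Suc n)" and "j < n"
  shows "gap n j (face j \<sigma>)"
proof -
  have len: "length \<sigma> = Suc n" using \<sigma> by simp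
  have "face j \<sigma> ! i = (if i < j then \<sigma> ! i else \<sigma> ! Suc i)" if "i < n" for i
    using that \<open>j < n\<close> len by (simp add: face_def nth_append)
  then show ?thesis
    using top_chain_corank [OF x \<sigma>] by (auto simp: gap_def)
qed

text \<open>
  A chain with a gap at \<open>j\<close> can only arise from a top chain by deleting the entry of corank \<open>j\<close>. So
  each relator of \<open>A\<^sub>x\<close> is, up to sign, a row of the matrix of the boundary.
\<close>

lemma lookup_inner_bdry_gap:
  assumes x: "corank Q rk x = int n" and \<sigma>: "\<sigma> \<in> dchains_len x Orderings.top (Suc n)" and j: "j < n" "gap n j \<tau>"
  shows "coef (inner_bdry \<sigma>) \<tau> = (if face j \<sigma> = \<tau> then (-1) ^ j else 0)"
proof -
  have "\<sigma> \<noteq> []" using \<sigma> by auto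
  then have "coef (inner_bdry \<sigma>) \<tau> = (\<Sum>i<n. (-1) ^ i * (if \<tau> = face i \<sigma> then 1 else 0))"
    using \<sigma> by (simp add: inner_bdry_face lookup_sum)
  also have "\<dots> = (\<Sum>i<n. if i = j then (if face j \<sigma> = \<tau> then (-1) ^ j else 0) else 0)"
    using gap_unique [OF j(2) _ j(1)] face_gap [OF x \<sigma>] by (intro sum.cong) auto
  also have "\<dots> = (if face j \<sigma> = \<tau> then (-1) ^ j else 0)" using j by simp
  finally show ?thesis .
qed

text \<open>
  The isomorphism pairs a chain with the cycles \<open>\<rho> b\<close>. It kills the relators because these are rows of
  the boundary matrix. Conversely, if \<open>v\<close> pairs to zero with all \<open>\<rho> b\<close>, then also with every cycle,
  in particular with \<open>\<sigma> - H (\<partial> \<sigma>)\<close>; hence the coefficient of \<open>v\<close> at \<open>\<sigma>\<close> is its pairing with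
  \<open>H (\<partial> \<sigma>)\<close>, which exhibits \<open>v\<close> as a combination of rows of the boundary matrix.
\<close>

theorem A_group_free:
  assumes x: "x \<in> Q" "corank Q rk x = int n" and sph: "spherical (Suc n) x Orderings.top H B \<rho>"
  shows "A_group Q rk x \<cong> free_Abelian_group B" "comm_group (A_group Q rk x)"
proof -
  let ?top = "Orderings.top :: 'a"
  define S where "S = dchains_len x ?top (Suc n)"
  let ?L = "free_Abelian_group S"
  let ?Rel = "A_relators Q rk x"
  interpret L: comm_group ?L by (rule abelian_free_Abelian_group)
  have finS: "finite S" unfolding S_def by (rule finite_dchains_len)
  define U where "U = generate ?L ?Rel"
  have A: "A_group Q rk x = ?L Mod U"
    using nd_simplices_up_set [OF x] x by (simp add: A_group_def U_def S_def Let_def)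
  have Rel: "?Rel = {\<Sum>\<sigma>\<in>{\<sigma> \<in> S. face j \<sigma> = \<tau>}. frag_of \<sigma> | j \<tau>.
      j < n \<and> \<tau> \<in> nd_simplices (up_set Q x) (n - 1) \<and> last \<tau> = x \<and> gap n j \<tau>}"
    using nd_simplices_up_set [OF x] x(2) unfolding A_relators_def S_def gap_def by force
  have kS: "supp (\<Sum>\<sigma>\<in>{\<sigma> \<in> S. face j \<sigma> = \<tau>}. frag_of \<sigma>) \<subseteq> S" for j \<tau>
    using keys_sum [of frag_of "{\<sigma> \<in> S. face j \<sigma> = \<tau>}"] by auto
  have Rel_sub: "?Rel \<subseteq> carrier ?L" unfolding Rel using kS by auto
  have U: "subgroup U ?L" unfolding U_def by (rule L.generate_is_subgroup [OF Rel_sub])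
  have U_diff: "u - v \<in> U" if "u \<in> U" "v \<in> U" for u v
  proof -
    have c: "supp v \<subseteq> S" using subsetD [OF subgroup.subset [OF U] that(2)] by simp
    have "u \<otimes>\<^bsub>?L\<^esub> inv\<^bsub>?L\<^esub> v \<in> U" using that subgroup.m_closed [OF U] subgroup.m_inv_closed [OF U] by blast
    then show ?thesis using c by simp
  qed
  have U_0: "0 \<in> U" using subgroup.one_closed [OF U] by simp
  have U_cmul: "frag_cmul c u \<in> U" if "u \<in> U" for c u
    by (rule frag_closure_minus_cmul [where P = "\<lambda>z. z \<in> U"]) (use that U_0 U_diff in auto)
  have U_sum: "sum f T \<in> U" if "\<And>t. t \<in> T \<Longrightarrow> f t \<in> U" for f and T :: "'a list set"
    using that
  proof (induction T rule: infinite_finite_induct)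
    case (insert t T)
    then have "f t \<in> U" "sum f T \<in> U" by auto
    then have "f t \<otimes>\<^bsub>?L\<^esub> sum f T \<in> U" by (rule subgroup.m_closed [OF U])
    then show ?case using insert by simp
  qed (use U_0 in auto)
  show "comm_group (A_group Q rk x)" unfolding A by (rule L.abelian_FactGroup [OF U])
  have finB: "finite B" and BS: "B \<subseteq> S" using spherical_basis [OF sph] by (auto simp: S_def)
  have \<rho>S: "supp (\<rho> b) \<subseteq> S" and \<rho>c: "frag_extend inner_bdry (\<rho> b) = 0"
    and \<rho>d: "\<And>b'. b' \<in> B \<Longrightarrow> coef (\<rho> b) b' = (if b' = b then 1 else 0)" if "b \<in> B" for b
    using spherical_dual [OF sph that] by (simp_all add: S_def)
  define \<Phi> where "\<Phi> = frag_extend (\<lambda>\<sigma>. \<Sum>b\<in>B. frag_cmul (coef (\<rho> b) \<sigma>) (frag_of b))"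
  have \<Phi>_of: "coef (\<Phi> (frag_of \<sigma>)) b = (if b \<in> B then coef (\<rho> b) \<sigma> else 0)" for \<sigma> b
  proof -
    have "coef (\<Phi> (frag_of \<sigma>)) b = (\<Sum>b'\<in>B. if b' = b then coef (\<rho> b) \<sigma> else 0)"
      unfolding \<Phi>_def by (simp add: lookup_sum if_distrib [of "\<lambda>u. _ * u"] cong: if_cong) (auto intro!: sum.cong)
    then show ?thesis using finB by simp
  qed
  have \<Phi>_k: "supp (\<Phi> z) \<subseteq> B" for z
  proof -
    have "supp (\<Phi> (frag_of \<sigma>)) \<subseteq> B" for \<sigma>
      using \<Phi>_of [of \<sigma>] by (auto simp: in_keys_iff split: if_splits)
    then show ?thesis unfolding \<Phi>_def frag_extend_of by (intro keys_extend_subset [of z UNIV]) auto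
  qed
  have \<Phi>_hom: "\<Phi> \<in> hom ?L (free_Abelian_group B)"
    by (rule homI) (use \<Phi>_k in \<open>auto simp: \<Phi>_def frag_lin\<close>)
  interpret ph: group_hom ?L "free_Abelian_group B" \<Phi>
    using \<Phi>_hom L.group_axioms by (simp add: group_hom_def group_hom_axioms_def)
  have \<Phi>_l: "coef (\<Phi> v) b = (\<Sum>\<sigma>\<in>S. coef v \<sigma> * coef (\<rho> b) \<sigma>)"
    if "supp v \<subseteq> S" "b \<in> B" for v b
  proof -
    have "coef (\<Phi> v) b = (\<Sum>\<sigma>\<in>supp v. coef v \<sigma> * coef (\<Phi> (frag_of \<sigma>)) b)"
      unfolding \<Phi>_def lookup_frag_extend frag_extend_of ..
    also have "\<dots> = (\<Sum>\<sigma>\<in>supp v. coef v \<sigma> * coef (\<rho> b) \<sigma>)"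
      using \<Phi>_of that(2) by simp
    also have "\<dots> = (\<Sum>\<sigma>\<in>S. coef v \<sigma> * coef (\<rho> b) \<sigma>)"
      by (rule sum_keys_superset [OF that(1) finS])
    finally show ?thesis .
  qed
  have onto: "\<Phi> ` carrier ?L = carrier (free_Abelian_group B)"
  proof (intro equalityI image_subsetI ph.hom_closed subsetI)
    fix w assume "w \<in> carrier (free_Abelian_group B)"
    then have w: "supp w \<subseteq> B" by simp
    have "\<Phi> w = w"
      using w
    proof (rule frag_ext_eq)
      fix b assume b: "b \<in> B"
      show "\<Phi> (frag_of b) = frag_of b"
      proof (rule poly_mapping_eqI)
        fix b' show "coef (\<Phi> (frag_of b)) b' = coef (frag_of b) b'"
          unfolding \<Phi>_of using \<rho>d [of b' b] b by auto
      qed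
    qed (simp_all add: \<Phi>_def frag_lin)
    then show "w \<in> \<Phi> ` carrier ?L" using w BS by (metis carrier_free_Abelian_group_iff image_eqI order_trans)
  qed
  have kill: "\<Phi> r = 0" if rR: "r \<in> ?Rel" for r
  proof -
    obtain j \<tau> where j: "j < n" "gap n j \<tau>" and r: "r = (\<Sum>\<sigma>\<in>{\<sigma> \<in> S. face j \<sigma> = \<tau>}. frag_of \<sigma>)"
      using rR unfolding Rel by blast
    have lr: "coef r \<sigma> = (if face j \<sigma> = \<tau> then 1 else 0)" if "\<sigma> \<in> S" for \<sigma>
      using finS that by (auto simp: r lookup_sum sum.delta' cong: if_cong)
    have "coef (\<Phi> r) b = 0" if b: "b \<in> B" for b
    proof -
      have "0 = coef (frag_extend inner_bdry (\<rho> b)) \<tau>" using \<rho>c [OF b] by simp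
      also have "\<dots> = (\<Sum>\<sigma>\<in>S. coef (\<rho> b) \<sigma> * coef (inner_bdry \<sigma>) \<tau>)"
        unfolding lookup_frag_extend by (rule sum_keys_superset [OF \<rho>S [OF b] finS])
      also have "\<dots> = (\<Sum>\<sigma>\<in>S. (-1) ^ j * (coef r \<sigma> * coef (\<rho> b) \<sigma>))"
        using lookup_inner_bdry_gap [OF x(2) _ j] lr by (intro sum.cong) (auto simp: S_def)
      also have "\<dots> = (-1) ^ j * coef (\<Phi> r) b"
        using \<Phi>_l [OF _ b, of r] kS r by (simp add: sum_distrib_left)
      finally show ?thesis by simp
    qed
    moreover have "coef (\<Phi> r) b = 0" if "b \<notin> B" for b
      using \<Phi>_k [of r] that by (auto simp: in_keys_iff)
    ultimately show ?thesis by (intro poly_mapping_eqI) auto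
  qed
  have "v \<in> U" if v: "supp v \<subseteq> S" "\<Phi> v = 0" for v
  proof -
    \<comment> \<open>The pairing with \<open>v\<close> on the finite set of top chains.\<close>
    define pv where "pv = (\<lambda>z. \<Sum>\<sigma>\<in>S. coef v \<sigma> * coef z \<sigma>)"
    have pv_lin: "pv (u - w) = pv u - pv w" "pv 0 = 0" "pv (frag_cmul c u) = c * pv u" for u w c
      by (simp_all add: pv_def lookup_minus sum_subtractf right_diff_distrib sum_distrib_left mult.left_commute)
    have pv_sum: "pv (sum f T) = (\<Sum>t\<in>T. pv (f t))" if "finite T" for f and T :: "'a list set"
      by (simp add: pv_def lookup_sum sum_distrib_left sum.swap [of _ S T])
    have pv_ext: "pv (frag_extend f z) = (\<Sum>\<tau>\<in>supp z. coef z \<tau> * pv (f \<tau>))"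
      for f and z :: "'a list \<Rightarrow>\<^sub>0 int"
      unfolding frag_extend_def by (simp add: pv_sum pv_lin)
    have pv_\<rho>: "pv (\<rho> b) = 0" if "b \<in> B" for b
      using \<Phi>_l [OF v(1) that] v(2) by (simp add: pv_def)
    have pv_of: "pv (frag_of \<sigma>) = coef v \<sigma>" if "\<sigma> \<in> S" for \<sigma>
      using that finS by (simp add: pv_def if_distrib [of "\<lambda>u. _ * u"] cong: if_cong)
    define T where "T = dchains_len x ?top n"
    have finT: "finite T" unfolding T_def by (rule finite_dchains_len)
    have bT: "supp (inner_bdry \<sigma>) \<subseteq> T" if "\<sigma> \<in> S" for \<sigma>
      using keys_inner_bdry_dchains [of \<sigma> x ?top] that by (auto simp: S_def T_def)
    have lv: "coef v \<sigma> = (\<Sum>\<tau>\<in>T. coef (inner_bdry \<sigma>) \<tau> * pv (H \<tau>))" if s: "\<sigma> \<in> S" for \<sigma>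
    proof -
      define \<pi> where "\<pi> = frag_of \<sigma> - frag_extend H (inner_bdry \<sigma>)"
      have HS: "supp (H \<tau>) \<subseteq> S" if "\<tau> \<in> T" for \<tau>
        using spherical_homotopy(1) [OF sph, of \<tau>] that by (auto simp: T_def S_def)
      have k: "supp \<pi> \<subseteq> S"
        unfolding \<pi>_def using s by (intro keys_diff_subset keys_extend_subset [OF bT [OF s] HS]) auto
      have "frag_extend inner_bdry (frag_extend H z) = z - frag_extend H (frag_extend inner_bdry z)"
        if "supp z \<subseteq> T" for z
        by (rule frag_ext_eq [OF that])
          (auto simp: frag_lin eq_diff_eq T_def spherical_homotopy(2) [OF sph])
      from this [OF bT [OF s]] have "frag_extend inner_bdry \<pi> = 0" by (simp add: \<pi>_def frag_lin inner_bdry_inner_bdry)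
      then have "\<pi> = (\<Sum>b\<in>B. frag_cmul (coef \<pi> b) (\<rho> b))"
        using spherical_cycle [OF sph] k by (simp add: S_def)
      then have "pv \<pi> = (\<Sum>b\<in>B. pv (frag_cmul (coef \<pi> b) (\<rho> b)))"
        using pv_sum [OF finB] by metis
      then have "pv \<pi> = 0" by (simp add: pv_lin pv_\<rho>)
      then have "coef v \<sigma> = pv (frag_extend H (inner_bdry \<sigma>))"
        using pv_of [OF s] by (simp add: \<pi>_def pv_lin)
      also have "\<dots> = (\<Sum>\<tau>\<in>T. coef (inner_bdry \<sigma>) \<tau> * pv (H \<tau>))"
        unfolding pv_ext by (rule sum_keys_superset [OF bT [OF s] finT])
      finally show ?thesis .
    qed
    \<comment> \<open>The row of the boundary matrix that belongs to \<open>\<tau>\<close>.\<close>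
    define w where "w = (\<lambda>\<tau>. \<Sum>\<sigma>\<in>S. frag_cmul (coef (inner_bdry \<sigma>) \<tau>) (frag_of \<sigma>))"
    have lw: "coef (w \<tau>) \<sigma> = (if \<sigma> \<in> S then coef (inner_bdry \<sigma>) \<tau> else 0)" for \<tau> \<sigma>
      using finS by (simp add: w_def lookup_sum if_distrib [of "\<lambda>u. _ * u"] cong: if_cong)
    have wU: "w \<tau> \<in> U" if t: "\<tau> \<in> T" for \<tau>
    proof (cases "\<exists>j<n. gap n j \<tau>")
      case True
      then obtain j where j: "j < n" "gap n j \<tau>" by blast
      have "w \<tau> = frag_cmul ((-1) ^ j) (\<Sum>\<sigma>\<in>{\<sigma> \<in> S. face j \<sigma> = \<tau>}. frag_of \<sigma>)"
      proof (rule poly_mapping_eqI)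
        fix \<sigma>
        show "coef (w \<tau>) \<sigma> = coef (frag_cmul ((-1) ^ j) (\<Sum>\<sigma>\<in>{\<sigma> \<in> S. face j \<sigma> = \<tau>}. frag_of \<sigma>)) \<sigma>"
          using finS lookup_inner_bdry_gap [OF x(2) _ j, of \<sigma>]
          by (auto simp: lw lookup_sum S_def [symmetric] sum.delta' cong: if_cong)
      qed
      moreover have "\<tau> \<in> nd_simplices (up_set Q x) (n - 1)" "last \<tau> = x"
      proof -
        have tt: "\<tau> \<in> dchains x ?top" "length \<tau> = n" using t by (auto simp: T_def)
        then have "set \<tau> \<subseteq> Q" "sorted_wrt (\<ge>) \<tau>" using dchains_Q [OF x(1)] by auto
        moreover show "last \<tau> = x" using tt by (simp add: dchains_def)
        ultimately show "\<tau> \<in> nd_simplices (up_set Q x) (n - 1)"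
          using tt j(1) sorted_last_le [of \<tau>] by (auto simp: nd_simplices_def up_set_def dchains_def)
      qed
      then have "(\<Sum>\<sigma>\<in>{\<sigma> \<in> S. face j \<sigma> = \<tau>}. frag_of \<sigma>) \<in> U"
        unfolding U_def Rel using j by (intro generate.incl) blast
      ultimately show ?thesis using U_cmul by simp
    next
      case False
      have "coef (inner_bdry \<sigma>) \<tau> = 0" if "\<sigma> \<in> S" for \<sigma>
      proof -
        have ne: "\<sigma> \<noteq> []" and len: "length \<sigma> = Suc n" using that by (auto simp: S_def)
        have nf: "face i \<sigma> \<noteq> \<tau>" if "i < n" for i
          using face_gap [OF x(2), of \<sigma> i] \<open>\<sigma> \<in> S\<close> that False by (auto simp: S_def)
        have "coef (inner_bdry \<sigma>) \<tau> = (\<Sum>i<n. (-1) ^ i * (if \<tau> = face i \<sigma> then 1 else 0))"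
          using len by (simp add: inner_bdry_face [OF ne] lookup_sum)
        also have "\<dots> = 0" using nf by (intro sum.neutral) auto
        finally show ?thesis .
      qed
      then have "w \<tau> = 0" by (intro poly_mapping_eqI) (simp add: lw)
      then show ?thesis using U_0 by simp
    qed
    have "v = (\<Sum>\<tau>\<in>T. frag_cmul (pv (H \<tau>)) (w \<tau>))"
    proof (rule poly_mapping_eqI)
      fix \<sigma> show "coef v \<sigma> = coef (\<Sum>\<tau>\<in>T. frag_cmul (pv (H \<tau>)) (w \<tau>)) \<sigma>"
      proof (cases "\<sigma> \<in> S")
        case True
        then show ?thesis using lv [OF True] by (simp add: lookup_sum lw mult.commute)
      next
        case False
        then have "coef v \<sigma> = 0" using v(1) by (auto simp: in_keys_iff)
        then show ?thesis using False by (simp add: lookup_sum lw)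
      qed
    qed
    then show "v \<in> U" using U_sum [of T "\<lambda>\<tau>. frag_cmul (pv (H \<tau>)) (w \<tau>)"] wU U_cmul by simp
  qed
  then have "kernel ?L (free_Abelian_group B) \<Phi> \<subseteq> U" by (auto simp: kernel_def)
  moreover have "U \<subseteq> kernel ?L (free_Abelian_group B) \<Phi>"
    unfolding U_def
    by (rule L.generate_subgroup_incl [OF _ ph.subgroup_kernel])
      (unfold kernel_def one_free_Abelian_group, use kill Rel_sub in blast)
  ultimately have "kernel ?L (free_Abelian_group B) \<Phi> = U" by blast
  then show "A_group Q rk x \<cong> free_Abelian_group B"
    unfolding A using ph.FactGroup_iso [OF onto] by simp
qed

end

lemma free_Abelian_integer_product:
  assumes "finite B"
  shows "free_Abelian_group B \<cong> product_group {..<card B} (\<lambda>_. integer_group)"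
proof -
  have "free_Abelian_group B \<cong> free_Abelian_group {..<card B}"
    using assms by (simp add: isomorphic_free_Abelian_groups eqpoll_iff_card)
  moreover have "free_Abelian_group {..<card B} \<cong> sum_group {..<card B} (\<lambda>_. integer_group)"
    by (rule group.iso_sym [OF _ isomorphic_sum_integer_group]) simp
  moreover have "sum_group {..<card B} (\<lambda>_. integer_group) = product_group {..<card B} (\<lambda>_. integer_group)"
    by (rule sum_group_finite) auto
  ultimately show ?thesis using iso_trans by metis
qed

section \<open>The cells\<close>

lemma (in proper_semimodular) spherical_choice:
  "\<exists>H B \<rho>. \<forall>x\<in>Q. spherical (Suc (nat (corank Q rk x))) x Orderings.top (H x) (B x) (\<rho> x)"
proof -
  have "\<exists>H B \<rho>. spherical (Suc (nat (corank Q rk x))) x Orderings.top H B \<rho>" if "x \<in> Q" for x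
    using that corank_nonneg [OF that] by (intro spherical_exists) (auto simp: in_Q corank_eq)
  then show ?thesis by metis
qed

text \<open>
  The degree \<open>n\<close> is fixed: \<open>Sn\<close> and \<open>Sm\<close> are the skeleta of dimension \<open>n\<close> and \<open>n - 1\<close>, and \<open>Xn\<close> is
  the set of elements of corank \<open>n\<close>.
\<close>

locale cell_presheaf = proper_semimodular rk Q + presheaf_on Q F
  for rk :: "'a::bounded_lattice \<Rightarrow> int" and Q :: "'a set" and F :: "('a, 'b) presheaf" +
  fixes H :: "'a \<Rightarrow> 'a list \<Rightarrow> 'a list \<Rightarrow>\<^sub>0 int" and B :: "'a \<Rightarrow> 'a list set"
    and \<rho> :: "'a \<Rightarrow> 'a list \<Rightarrow> 'a list \<Rightarrow>\<^sub>0 int" and n :: nat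
  assumes sph_all: "x \<in> Q \<Longrightarrow> spherical (Suc (nat (corank Q rk x))) x Orderings.top (H x) (B x) (\<rho> x)"
begin

definition Sn :: "'a set" where "Sn = skeleton Q rk (int n)"
definition Sm :: "'a set" where "Sm = skeleton Q rk (int n - 1)"
definition Xn :: "'a set" where "Xn = {x \<in> Q. corank Q rk x = int n}"

abbreviation "K \<equiv> rel_cochains Sn Sm F"
abbreviation "d \<equiv> differential Sn F"
abbreviation "h x \<equiv> simplex_homotopy x (H x)"
abbreviation "U m x \<equiv> upper Sn m x"

lemma sph: "x \<in> Xn \<Longrightarrow> spherical (Suc n) x Orderings.top (H x) (B x) (\<rho> x)"
  using sph_all [of x] by (simp add: Xn_def)

lemma X_Q: "x \<in> Xn \<Longrightarrow> x \<in> Q" and X_corank: "x \<in> Xn \<Longrightarrow> corank Q rk x = int n"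
  by (simp_all add: Xn_def)

lemma Sn_Q: "Sn \<subseteq> Q" and Sm_Sn: "Sm \<subseteq> Sn"
  by (auto simp: Sn_def Sm_def skeleton_def)

lemma skeleton_simplex:
  assumes "\<sigma> \<in> simplices Q m"
  shows "\<sigma> \<in> simplices (skeleton Q rk k) m \<longleftrightarrow> corank Q rk (last \<sigma>) \<le> k"
proof
  assume "\<sigma> \<in> simplices (skeleton Q rk k) m"
  then show "corank Q rk (last \<sigma>) \<le> k" using simplices_last_in by (fastforce simp: skeleton_def)
next
  assume c: "corank Q rk (last \<sigma>) \<le> k"
  have "z \<in> skeleton Q rk k" if "z \<in> set \<sigma>" for z
  proof -
    have "corank Q rk z \<le> corank Q rk (last \<sigma>)"
      using simplices_last_le [OF assms that] corank_strict [of "last \<sigma>" z] by (auto simp: order.order_iff_strict)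
    then show ?thesis using c assms that by (auto simp: skeleton_def simplices_def)
  qed
  then show "\<sigma> \<in> simplices (skeleton Q rk k) m" using assms by (auto simp: simplices_def)
qed

lemma Sn_simplex: "\<sigma> \<in> simplices Sn m \<longleftrightarrow> \<sigma> \<in> simplices Q m \<and> corank Q rk (last \<sigma>) \<le> int n"
  using skeleton_simplex [of \<sigma> m "int n"] simplices_mono [OF Sn_Q, of m] by (auto simp: Sn_def)

lemma Sm_simplex: "\<sigma> \<in> simplices Sm m \<longleftrightarrow> \<sigma> \<in> simplices Sn m \<and> last \<sigma> \<notin> Xn"
proof -
  have "\<sigma> \<in> simplices Sm m \<longleftrightarrow> \<sigma> \<in> simplices Q m \<and> corank Q rk (last \<sigma>) \<le> int n - 1"
    using skeleton_simplex [of \<sigma> m "int n - 1"] simplices_mono [OF order_trans [OF Sm_Sn Sn_Q], of m]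
    by (auto simp: Sm_def)
  then show ?thesis using simplices_last_in [of \<sigma> Q m] by (auto simp: Sn_simplex Xn_def)
qed

lemma K_iff: "s \<in> carrier (K m) \<longleftrightarrow>
    s \<in> carrier (cochains Sn F m) \<and> (\<forall>\<sigma>\<in>simplices Sn m. last \<sigma> \<notin> Xn \<longrightarrow> s \<sigma> = \<one>\<^bsub>sec F (last \<sigma>)\<^esub>)"
  using Sm_simplex by (auto simp: rel_cochains_iff [OF Sm_Sn])

lemma K_complex: "cochain_complex K d"
  by (rule rel_cochains_complex [OF Sn_Q Sm_Sn])

lemma above_X: "x \<in> Xn \<Longrightarrow> x < y \<Longrightarrow> y \<notin> Xn"
  using corank_strict [of x y] by (auto simp: Xn_def)

lemma U_iff: "x \<in> Xn \<Longrightarrow> \<tau> \<in> U m x \<longleftrightarrow> \<tau> \<in> simplices Q m \<and> x \<le> last \<tau>"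
  using corank_strict [of x "last \<tau>"] by (auto simp: upper_def Sn_simplex Xn_def order.order_iff_strict)

lemma dchains_U: "x \<in> Xn \<Longrightarrow> dchains_len x Orderings.top (Suc m) \<subseteq> U m x"
  using dchains_simplices [OF X_Q, of x m] by (auto simp: U_iff)

lemma coeval_one:
  assumes "x \<in> Xn" "supp z \<subseteq> U m x" "\<And>\<tau>. \<tau> \<in> supp z \<Longrightarrow> s \<tau> = \<one>\<^bsub>sec F (last \<tau>)\<^esub>"
  shows "coeval F x s z = \<one>\<^bsub>sec F x\<^esub>"
  unfolding coeval_def
proof (rule comm_group.frag_eval_one [OF sec_group [OF X_Q [OF assms(1)]]])
  fix \<tau> assume t: "\<tau> \<in> supp z"
  then have u: "\<tau> \<in> simplices Q m" "x \<le> last \<tau>" using assms(1,2) U_iff by blast+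
  then have "last \<tau> \<in> Q" using simplices_last_in by blast
  then show "res F (last \<tau>) x (s \<tau>) = \<one>\<^bsub>sec F x\<^esub>"
    unfolding assms(3) [OF t]
    using hom_one [OF res_hom [OF X_Q [OF assms(1)] _ u(2)]] sec_grp X_Q [OF assms(1)] by blast
qed

lemma coeval_above:
  assumes "x \<in> Xn" "s \<in> carrier (K m)" "supp z \<subseteq> {\<tau> \<in> simplices Q m. x < last \<tau>}"
  shows "coeval F x s z = \<one>\<^bsub>sec F x\<^esub>"
proof (rule coeval_one [OF assms(1)])
  show "supp z \<subseteq> U m x" using assms(1,3) U_iff by fastforce
  fix \<tau> assume "\<tau> \<in> supp z"
  then have "\<tau> \<in> U m x" "x < last \<tau>" using assms(1,3) U_iff by fastforce+
  then show "s \<tau> = \<one>\<^bsub>sec F (last \<tau>)\<^esub>" using assms(1,2) above_X by (auto simp: K_iff upper_def)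
qed

lemma h_keys:
  assumes "x \<in> Xn" "\<tau> \<in> simplices Q m"
  shows "supp (h x \<tau>) \<subseteq> {\<tau>' \<in> simplices Q (Suc m). last \<tau>' = last \<tau>}"
  by (rule simplex_homotopy_keys [OF X_Q [OF assms(1)] sph [OF assms(1)] assms(2)])

lemma h_U: "x \<in> Xn \<Longrightarrow> \<tau> \<in> U m x \<Longrightarrow> supp (h x \<tau>) \<subseteq> U (Suc m) x"
  using h_keys [of x \<tau> m] by (auto simp: U_iff)

lemma extend_h_U:
  assumes "x \<in> Xn" "\<sigma> \<in> U m x"
  shows "supp (frag_extend (h x) (bdry \<sigma>)) \<subseteq> U m x"
proof (cases m)
  case 0
  then obtain a where "\<sigma> = [a]" using assms by (auto simp: upper_def simplices_def length_Suc_conv)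
  then show ?thesis by (simp add: simplex_homotopy_def)
next
  case (Suc m')
  have "supp (bdry \<sigma>) \<subseteq> U m' x"
    using keys_bdry_simplex [of \<sigma> Sn m'] assms(2) Suc by (auto simp: upper_def)
  then show ?thesis using h_U [OF assms(1)] Suc by (intro keys_extend_subset) auto
qed

text \<open>
  Evaluation of the homotopy identity of \<open>simplex_homotopy\<close> on a relative cocycle.
\<close>

lemma cocycle_split:
  assumes s: "s \<in> cocycles K d m" and \<sigma>: "\<sigma> \<in> simplices Sn m" "last \<sigma> = x" and x: "x \<in> Xn"
  obtains \<pi> where "supp \<pi> \<subseteq> dchains_len x Orderings.top (Suc n)" "frag_extend inner_bdry \<pi> = 0"
    "m \<noteq> n \<Longrightarrow> \<pi> = 0"
    "s \<sigma> = coeval F x s (frag_extend (h x) (bdry \<sigma>)) \<otimes>\<^bsub>sec F x\<^esub> coeval F x s \<pi>"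
proof -
  have xQ: "x \<in> Q" using x by (rule X_Q)
  interpret Gx: comm_group "sec F x" by (rule sec_group [OF xQ])
  have sK: "s \<in> carrier (K m)" and ds: "d m s = \<one>\<^bsub>K (Suc m)\<^esub>"
    using s cochain_complex.cocycles_iff [OF K_complex] by auto
  have sc: "s \<in> carrier (cochains Sn F m)" using sK K_iff by blast
  have \<sigma>Q: "\<sigma> \<in> simplices Q m" using \<sigma> Sn_simplex by blast
  have \<sigma>U: "\<sigma> \<in> U m x" using \<sigma> by (simp add: upper_def)
  obtain j \<pi> where eq: "frag_extend bdry (h x \<sigma>) + frag_extend (h x) (bdry \<sigma>) = frag_of \<sigma> + j - \<pi>"
    and j: "supp j \<subseteq> {\<tau> \<in> simplices Q m. x < last \<tau>}"
    and \<pi>: "supp \<pi> \<subseteq> dchains_len x Orderings.top (Suc n)" "frag_extend inner_bdry \<pi> = 0" "m \<noteq> n \<Longrightarrow> \<pi> = 0"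
    using simplex_homotopy [OF xQ X_corank [OF x] sph [OF x] \<sigma>Q \<sigma>(2)] by blast
  have hU: "supp (h x \<sigma>) \<subseteq> U (Suc m) x" by (rule h_U [OF x \<sigma>U])
  have kU: "supp (frag_extend bdry (h x \<sigma>)) \<subseteq> U m x"
    using keys_bdry_simplex by (intro keys_extend_subset [OF hU]) (fastforce simp: upper_def)
  have eU: "supp (frag_extend (h x) (bdry \<sigma>)) \<subseteq> U m x" by (rule extend_h_U [OF x \<sigma>U])
  have jU: "supp j \<subseteq> U m x" using j U_iff [OF x] by fastforce
  have \<pi>U: "supp \<pi> \<subseteq> U m x"
  proof (cases "m = n")
    case True
    then show ?thesis using \<pi>(1) dchains_U [OF x, of n] by blast
  qed (use \<pi>(3) in simp)
  note closed = coeval_closed [OF Sn_Q xQ sc]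
  have "coeval F x s (frag_extend bdry (h x \<sigma>)) = coeval F x (d m s) (h x \<sigma>)"
    by (rule coeval_differential [OF Sn_Q xQ sc hU, symmetric])
  also have "\<dots> = \<one>\<^bsub>sec F x\<^esub>"
    using hU by (intro coeval_one [OF x hU]) (auto simp: ds cochains_one upper_def)
  finally have e1: "coeval F x s (frag_extend bdry (h x \<sigma>)) = \<one>\<^bsub>sec F x\<^esub>" .
  have e2: "coeval F x s j = \<one>\<^bsub>sec F x\<^esub>" by (rule coeval_above [OF x sK j])
  have "frag_of \<sigma> = frag_extend bdry (h x \<sigma>) + frag_extend (h x) (bdry \<sigma>) + \<pi> - j"
    using eq by (simp add: algebra_simps)
  then have "s \<sigma> = coeval F x s (frag_extend bdry (h x \<sigma>) + frag_extend (h x) (bdry \<sigma>) + \<pi> - j)"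
    using coeval_of [OF Sn_Q \<sigma>(1) sc] \<sigma>(2) by simp
  also have "\<dots> = coeval F x s (frag_extend bdry (h x \<sigma>)) \<otimes>\<^bsub>sec F x\<^esub> coeval F x s (frag_extend (h x) (bdry \<sigma>))
      \<otimes>\<^bsub>sec F x\<^esub> coeval F x s \<pi> \<otimes>\<^bsub>sec F x\<^esub> inv\<^bsub>sec F x\<^esub> coeval F x s j"
    using kU eU \<pi>U jU
    by (simp add: coeval_diff [OF Sn_Q xQ sc] coeval_add [OF Sn_Q xQ sc] keys_add_subset)
  also have "\<dots> = coeval F x s (frag_extend (h x) (bdry \<sigma>)) \<otimes>\<^bsub>sec F x\<^esub> coeval F x s \<pi>"
    using closed [OF eU] closed [OF \<pi>U] by (simp add: e1 e2)
  finally show thesis using that \<pi> by blast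
qed

text \<open>
  The transpose of the homotopy, applied to a cochain of degree \<open>Suc m\<close>.
\<close>

definition primitive :: "nat \<Rightarrow> ('a list \<Rightarrow> 'b) \<Rightarrow> 'a list \<Rightarrow> 'b" where
  "primitive m s = (\<lambda>\<tau>\<in>simplices Sn m. if last \<tau> \<in> Xn
     then coeval F (last \<tau>) s (h (last \<tau>) \<tau>) else \<one>\<^bsub>sec F (last \<tau>)\<^esub>)"

lemma primitive_closed:
  assumes "s \<in> carrier (K (Suc m))" shows "primitive m s \<in> carrier (K m)"
proof -
  have sc: "s \<in> carrier (cochains Sn F (Suc m))" using assms K_iff by blast
  have "primitive m s \<tau> \<in> carrier (sec F (last \<tau>))" if t: "\<tau> \<in> simplices Sn m" for \<tau>
  proof (cases "last \<tau> \<in> Xn")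
    case True
    have "coeval F (last \<tau>) s (h (last \<tau>) \<tau>) \<in> carrier (sec F (last \<tau>))"
      using t by (intro coeval_closed [OF Sn_Q X_Q [OF True] sc h_U [OF True]]) (simp add: upper_def)
    then show ?thesis using t True by (simp add: primitive_def)
  next
    case False
    have "last \<tau> \<in> Q" using simplices_last_in [OF t] Sn_Q by blast
    then show ?thesis using t False group.is_monoid [OF sec_grp] by (simp add: primitive_def monoid.one_closed)
  qed
  then show ?thesis
    unfolding K_iff by (auto simp: cochains_def PiE_iff simplices_last primitive_def)
qed

lemma coeval_primitive:
  assumes x: "x \<in> Xn" and s: "s \<in> carrier (K (Suc m))" and z: "supp z \<subseteq> U m x"
  shows "coeval F x (primitive m s) z = coeval F x s (frag_extend (h x) z)"
proof -
  have xQ: "x \<in> Q" using x by (rule X_Q)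
  interpret Gx: comm_group "sec F x" by (rule sec_group [OF xQ])
  have sc: "s \<in> carrier (cochains Sn F (Suc m))" using s K_iff by blast
  have "coeval F x s (frag_extend (h x) z) = frag_eval (sec F x) (\<lambda>\<tau>. coeval F x s (h x \<tau>)) z"
    unfolding coeval_def
    by (rule Gx.frag_eval_extend [OF z h_U [OF x] coeval_values [OF Sn_Q xQ sc]])
  moreover have "coeval F x (primitive m s) z = frag_eval (sec F x) (\<lambda>\<tau>. coeval F x s (h x \<tau>)) z"
    unfolding coeval_def [of F x "primitive m s"]
  proof (rule Gx.frag_eval_cong)
    have c: "coeval F x s (h x \<tau>) \<in> carrier (sec F x)" if "\<tau> \<in> U m x" for \<tau>
      by (rule coeval_closed [OF Sn_Q xQ sc h_U [OF x that]])
    then show "(\<lambda>\<tau>. coeval F x s (h x \<tau>)) ` supp z \<subseteq> carrier (sec F x)" using z by auto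
    fix \<tau> assume "\<tau> \<in> supp z"
    then have t: "\<tau> \<in> U m x" using z by blast
    then have tS: "\<tau> \<in> simplices Sn m" "x \<le> last \<tau>" "\<tau> \<in> simplices Q m" using U_iff [OF x] by (auto simp: upper_def)
    show "res F (last \<tau>) x (primitive m s \<tau>) = coeval F x s (h x \<tau>)"
    proof (cases "last \<tau> = x")
      case True
      then show ?thesis using tS(1) x c [OF t] res_id [OF xQ] by (simp add: primitive_def)
    next
      case False
      then have lt: "x < last \<tau>" using tS by (simp add: less_le)
      then have "primitive m s \<tau> = \<one>\<^bsub>sec F (last \<tau>)\<^esub>"
        using above_X [OF x] tS by (simp add: primitive_def)
      moreover have "last \<tau> \<in> Q" using simplices_last_in [OF tS(3)] .
      then have "res F (last \<tau>) x \<one>\<^bsub>sec F (last \<tau>)\<^esub> = \<one>\<^bsub>sec F x\<^esub>"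
        using hom_one [OF res_hom [OF xQ _ tS(2)]] sec_grp xQ by blast
      moreover have "coeval F x s (h x \<tau>) = \<one>\<^bsub>sec F x\<^esub>"
        using h_keys [OF x tS(3)] lt by (intro coeval_above [OF x s]) fastforce
      ultimately show ?thesis by simp
    qed
  qed
  ultimately show ?thesis by simp
qed

text \<open>
  By \<open>cocycle_split\<close> the cocycle is the coboundary of its transposed homotopy as soon as it vanishes on
  the cycles \<open>\<pi>\<close>, and these are combinations of the \<open>\<rho> x b\<close>.
\<close>

lemma coboundaryI:
  assumes s: "s \<in> cocycles K d m"
    and \<rho>1: "\<And>x b. m = n \<Longrightarrow> x \<in> Xn \<Longrightarrow> b \<in> B x \<Longrightarrow> coeval F x s (\<rho> x b) = \<one>\<^bsub>sec F x\<^esub>"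
  shows "s \<in> coboundaries K d m"
proof -
  have sK: "s \<in> carrier (K m)" using s cochain_complex.cocycles_iff [OF K_complex] by auto
  have sc: "s \<in> carrier (cochains Sn F m)" using sK K_iff by blast
  have main: "s \<sigma> = coeval F (last \<sigma>) s (frag_extend (h (last \<sigma>)) (bdry \<sigma>))"
    if \<sigma>: "\<sigma> \<in> simplices Sn m" and xX: "last \<sigma> \<in> Xn" for \<sigma>
  proof -
    let ?x = "last \<sigma>"
    have xQ: "?x \<in> Q" using xX by (rule X_Q)
    interpret Gx: comm_group "sec F ?x" by (rule sec_group [OF xQ])
    obtain \<pi> where \<pi>: "supp \<pi> \<subseteq> dchains_len ?x Orderings.top (Suc n)" "frag_extend inner_bdry \<pi> = 0"
      "m \<noteq> n \<Longrightarrow> \<pi> = 0" and e: "s \<sigma> = coeval F ?x s (frag_extend (h ?x) (bdry \<sigma>)) \<otimes>\<^bsub>sec F ?x\<^esub> coeval F ?x s \<pi>"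
      using cocycle_split [OF s \<sigma> refl xX] by blast
    have "coeval F ?x s \<pi> = \<one>\<^bsub>sec F ?x\<^esub>"
    proof (cases "m = n")
      case False
      then show ?thesis using \<pi>(3) by (simp add: coeval_def)
    next
      case True
      note sp = sph [OF xX]
      let ?f = "\<lambda>\<tau>. res F (last \<tau>) ?x (s \<tau>)"
      have v: "?f ` U n ?x \<subseteq> carrier (sec F ?x)" using coeval_values [OF Sn_Q xQ sc] True by simp
      have kr: "supp (\<rho> ?x b) \<subseteq> U n ?x" if "b \<in> B ?x" for b
        using spherical_dual(1) [OF sp that] dchains_U [OF xX, of n] by blast
      have one: "frag_eval (sec F ?x) ?f (frag_cmul c (\<rho> ?x b)) = \<one>\<^bsub>sec F ?x\<^esub>" if "b \<in> B ?x" for b c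
        using \<rho>1 [OF True xX that] by (intro Gx.frag_eval_cmul [OF kr [OF that] v]) (simp add: coeval_def)
      have "coeval F ?x s \<pi> = frag_eval (sec F ?x) ?f (\<Sum>b\<in>B ?x. frag_cmul (coef \<pi> b) (\<rho> ?x b))"
        unfolding coeval_def using spherical_cycle [OF sp \<pi>(1,2)] by simp
      also have "\<dots> = finprod (sec F ?x) (\<lambda>b. frag_eval (sec F ?x) ?f (frag_cmul (coef \<pi> b) (\<rho> ?x b))) (B ?x)"
        using kr keys_cmul by (intro Gx.frag_eval_sum [OF spherical_basis(1) [OF sp] _ v]) blast
      also have "\<dots> = \<one>\<^bsub>sec F ?x\<^esub>" by (rule Gx.finprod_one_eqI) (rule one)
      finally show ?thesis .
    qed
    then show ?thesis
      using e coeval_closed [OF Sn_Q xQ sc extend_h_U [OF xX]] \<sigma> by (simp add: upper_def)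
  qed
  show ?thesis
  proof (cases m)
    case 0
    have "s = \<one>\<^bsub>cochains Sn F 0\<^esub>"
    proof (rule cochains_eqI)
      show "s \<in> carrier (cochains Sn F 0)" using sc 0 by simp
      show "\<one>\<^bsub>cochains Sn F 0\<^esub> \<in> carrier (cochains Sn F 0)"
        using cochains_group [OF Sn_Q] by (simp add: comm_group_def group.is_monoid monoid.one_closed)
      fix \<sigma> assume \<sigma>: "\<sigma> \<in> simplices Sn 0"
      show "s \<sigma> = \<one>\<^bsub>cochains Sn F 0\<^esub> \<sigma>"
      proof (cases "last \<sigma> \<in> Xn")
        case True
        obtain a where "\<sigma> = [a]" using \<sigma> by (auto simp: simplices_def length_Suc_conv)
        then have "frag_extend (h (last \<sigma>)) (bdry \<sigma>) = 0" by (simp add: simplex_homotopy_def)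
        then show ?thesis
          using main [of \<sigma>] \<sigma> True 0 comm_group.frag_eval_0 [OF sec_group [OF X_Q [OF True]]]
          by (simp add: coeval_def cochains_one)
      next
        case False
        then show ?thesis using sK 0 \<sigma> by (simp add: K_iff cochains_one)
      qed
    qed
    then show ?thesis using 0 by (simp add: coboundaries_def)
  next
    case (Suc m')
    have sK': "s \<in> carrier (K (Suc m'))" using sK Suc by simp
    let ?t = "primitive m' s"
    have tK: "?t \<in> carrier (K m')" by (rule primitive_closed [OF sK'])
    then have tc: "?t \<in> carrier (cochains Sn F m')" using K_iff by blast
    have dK: "d m' ?t \<in> carrier (K (Suc m'))"
      using cochain_complex.d_hom [OF K_complex] tK by (rule hom_in_carrier)
    have "s = d m' ?t"
    proof (rule cochains_eqI)
      show "s \<in> carrier (cochains Sn F (Suc m'))" using sc Suc by simp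
      show "d m' ?t \<in> carrier (cochains Sn F (Suc m'))" by (rule differential_closed [OF Sn_Q tc])
      fix \<sigma> assume \<sigma>: "\<sigma> \<in> simplices Sn (Suc m')"
      show "s \<sigma> = d m' ?t \<sigma>"
      proof (cases "last \<sigma> \<in> Xn")
        case True
        have "d m' ?t \<sigma> = coeval F (last \<sigma>) ?t (bdry \<sigma>)" by (rule differential_eq [OF Sn_Q tc \<sigma>])
        also have "\<dots> = coeval F (last \<sigma>) s (frag_extend (h (last \<sigma>)) (bdry \<sigma>))"
          by (rule coeval_primitive [OF True sK' keys_bdry_simplex [OF \<sigma>]])
        finally show ?thesis using main [of \<sigma>] \<sigma> True Suc by simp
      next
        case False
        then show ?thesis using sK' dK \<sigma> by (simp add: K_iff)
      qed
    qed
    then show ?thesis using tK Suc by (auto simp: coboundaries_def)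
  qed
qed

lemma vanishing: "m \<noteq> n \<Longrightarrow> trivial_group (HS_rel Sn Sm F m)"
  unfolding HS_rel_def cochain_complex.trivial_cohomology [OF K_complex] using coboundaryI by blast

lemma \<rho>_U: "x \<in> Xn \<Longrightarrow> b \<in> B x \<Longrightarrow> supp (\<rho> x b) \<subseteq> U n x"
  using spherical_dual(1) [OF sph] dchains_U [of x n] by blast

text \<open>
  A coboundary evaluates on \<open>\<rho> x b\<close> as its primitive does on the boundary of \<open>\<rho> x b\<close>, whose terms end
  above \<open>x\<close>.
\<close>

lemma coboundary_pairing:
  assumes "s \<in> coboundaries K d n" "x \<in> Xn" "b \<in> B x"
  shows "coeval F x s (\<rho> x b) = \<one>\<^bsub>sec F x\<^esub>"
proof (cases n)
  case 0
  then have "s = \<one>\<^bsub>cochains Sn F n\<^esub>" using assms(1) by (simp add: coboundaries_def)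
  then show ?thesis
    using \<rho>_U [OF assms(2,3)] by (intro coeval_one [OF assms(2) \<rho>_U [OF assms(2,3)]]) (auto simp: cochains_one upper_def)
next
  case (Suc m)
  then obtain t where t: "t \<in> carrier (K m)" "s = d m t" using assms(1) by (auto simp: coboundaries_def)
  have tc: "t \<in> carrier (cochains Sn F m)" using t K_iff by blast
  have k: "supp (\<rho> x b) \<subseteq> dchains_len x Orderings.top (Suc (Suc m))"
    using spherical_dual(1) [OF sph [OF assms(2)] assms(3)] Suc by simp
  have "supp (\<rho> x b) \<subseteq> U (Suc m) x" using \<rho>_U [OF assms(2,3)] Suc by simp
  then have "coeval F x s (\<rho> x b) = coeval F x t (frag_extend bdry (\<rho> x b))"
    unfolding t(2) by (rule coeval_differential [OF Sn_Q X_Q [OF assms(2)] tc])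
  also have "\<dots> = coeval F x t (frag_extend (\<lambda>\<tau>. bdry \<tau> - inner_bdry \<tau>) (\<rho> x b))"
    unfolding extend_bdry_inner_bdry [of "\<rho> x b"] using spherical_dual(2) [OF sph [OF assms(2)] assms(3)] by simp
  also have "\<dots> = \<one>\<^bsub>sec F x\<^esub>"
    by (rule coeval_above [OF assms(2) t(1) keys_extend_subset [OF k keys_bdry_diff_inner_bdry [OF X_Q [OF assms(2)]]]])
  finally show ?thesis .
qed

abbreviation "cell_target \<equiv> product_group Xn (\<lambda>x. product_group (B x) (\<lambda>_. sec F x))"

lemma cell_target_group: "group cell_target"
  using sec_grp X_Q by auto

definition dual_cochain :: "('a \<Rightarrow> 'a list \<Rightarrow> 'b) \<Rightarrow> 'a list \<Rightarrow> 'b" where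
  "dual_cochain g = (\<lambda>\<sigma>\<in>simplices Sn n. if last \<sigma> \<in> Xn \<and> \<sigma> \<in> B (last \<sigma>) then g (last \<sigma>) \<sigma> else \<one>\<^bsub>sec F (last \<sigma>)\<^esub>)"

text \<open>
  A simplex of degree \<open>Suc n\<close> that ends in corank \<open>n\<close> is degenerate, and the non-degenerate part of its
  boundary is zero. So every cochain of degree \<open>n\<close> supported on non-degenerate simplices is a
  cocycle.
\<close>

lemma dual_cochain_cocycle:
  assumes g: "g \<in> carrier cell_target" shows "dual_cochain g \<in> cocycles K d n"
proof -
  let ?s = "dual_cochain g"
  have gi: "g x b \<in> carrier (sec F x)" if "x \<in> Xn" "b \<in> B x" for x b
    using g that by (fastforce simp: PiE_iff)
  have "?s \<sigma> \<in> carrier (sec F (last \<sigma>))" if "\<sigma> \<in> simplices Sn n" for \<sigma>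
  proof -
    have "last \<sigma> \<in> Q" using simplices_last_in [OF that] Sn_Q by blast
    then show ?thesis
      using that gi group.is_monoid [OF sec_grp] by (simp add: dual_cochain_def monoid.one_closed)
  qed
  then have sK: "?s \<in> carrier (K n)"
    unfolding K_iff by (auto simp: cochains_def PiE_iff simplices_last dual_cochain_def)
  then have sc: "?s \<in> carrier (cochains Sn F n)" using K_iff by blast
  have dK: "d n ?s \<in> carrier (K (Suc n))"
    using cochain_complex.d_hom [OF K_complex] sK by (rule hom_in_carrier)
  have "d n ?s = \<one>\<^bsub>cochains Sn F (Suc n)\<^esub>"
  proof (rule cochains_eqI)
    show "d n ?s \<in> carrier (cochains Sn F (Suc n))" by (rule differential_closed [OF Sn_Q sc])
    show "\<one>\<^bsub>cochains Sn F (Suc n)\<^esub> \<in> carrier (cochains Sn F (Suc n))"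
      using cochains_group [OF Sn_Q] by (simp add: comm_group_def group.is_monoid monoid.one_closed)
    fix \<sigma> assume \<sigma>: "\<sigma> \<in> simplices Sn (Suc n)"
    show "d n ?s \<sigma> = \<one>\<^bsub>cochains Sn F (Suc n)\<^esub> \<sigma>"
    proof (cases "last \<sigma> \<in> Xn")
      case False
      then show ?thesis using dK \<sigma> by (simp add: K_iff cochains_one)
    next
      case True
      let ?x = "last \<sigma>"
      have xQ: "?x \<in> Q" using True by (rule X_Q)
      interpret Gx: comm_group "sec F ?x" by (rule sec_group [OF xQ])
      have \<sigma>Q: "\<sigma> \<in> simplices Q (Suc n)" using \<sigma> Sn_simplex by blast
      have nd: "\<not> sorted_wrt (>) \<sigma>"
      proof
        assume "sorted_wrt (>) \<sigma>"
        then have "\<sigma> \<in> dchains_len ?x Orderings.top (Suc (Suc n))"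
          using dchains_simplices [OF xQ, of "Suc n"] \<sigma>Q by blast
        then show False using length_chain [of \<sigma> ?x Orderings.top] X_corank [OF True] by (simp add: corank_eq)
      qed
      have weak: "sorted_wrt (\<ge>) \<sigma>" using \<sigma>Q by (simp add: simplices_def)
      have k: "supp (bdry \<sigma>) \<subseteq> U n ?x" by (rule keys_bdry_simplex [OF \<sigma>])
      let ?f = "\<lambda>\<tau>. res F (last \<tau>) ?x (?s \<tau>)"
      have v: "?f ` U n ?x \<subseteq> carrier (sec F ?x)" by (rule coeval_values [OF Sn_Q xQ sc])
      have "d n ?s \<sigma> = frag_eval (sec F ?x) ?f (bdry \<sigma>)"
        using differential_eq [OF Sn_Q sc \<sigma>] by (simp add: coeval_def)
      also have "\<dots> = frag_eval (sec F ?x) (\<lambda>\<tau>. frag_eval (sec F ?x) ?f (if sorted_wrt (>) \<tau> then frag_of \<tau> else 0)) (bdry \<sigma>)"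
      proof (rule Gx.frag_eval_cong)
        have c: "frag_eval (sec F ?x) ?f (if sorted_wrt (>) \<tau> then frag_of \<tau> else 0) \<in> carrier (sec F ?x)"
          if "\<tau> \<in> U n ?x" for \<tau>
          using that by (intro Gx.frag_eval_closed [OF _ v]) auto
        then show "(\<lambda>\<tau>. frag_eval (sec F ?x) ?f (if sorted_wrt (>) \<tau> then frag_of \<tau> else 0)) ` supp (bdry \<sigma>)
            \<subseteq> carrier (sec F ?x)" using k by blast
        fix \<tau> assume "\<tau> \<in> supp (bdry \<sigma>)"
        then have t: "\<tau> \<in> U n ?x" using k by blast
        show "?f \<tau> = frag_eval (sec F ?x) ?f (if sorted_wrt (>) \<tau> then frag_of \<tau> else 0)"
        proof (cases "sorted_wrt (>) \<tau>")
          case s: True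
          have "?f \<tau> \<in> carrier (sec F ?x)" using v t by blast
          then show ?thesis using s by (simp add: Gx.frag_eval_of)
        next
          case False
          then have "\<tau> \<notin> B (last \<tau>)" if "last \<tau> \<in> Xn"
            using spherical_basis(3) [OF sph [OF that]] by (auto simp: dchains_def)
          then have "?s \<tau> = \<one>\<^bsub>sec F (last \<tau>)\<^esub>" using t by (auto simp: dual_cochain_def upper_def)
          moreover have "last \<tau> \<in> Q" using t simplices_last_in Sn_Q by (auto simp: upper_def)
          then have "res F (last \<tau>) ?x \<one>\<^bsub>sec F (last \<tau>)\<^esub> = \<one>\<^bsub>sec F ?x\<^esub>"
            using hom_one [OF res_hom [OF xQ]] sec_grp xQ t by (auto simp: upper_def)
          ultimately show ?thesis using False by simp
        qed
      qed
      also have "\<dots> = frag_eval (sec F ?x) ?f (nd_part (bdry \<sigma>))"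
        unfolding nd_part_def
        by (rule Gx.frag_eval_extend [OF k _ v, symmetric]) auto
      also have "\<dots> = \<one>\<^bsub>sec F ?x\<^esub>" by (simp add: nd_part_bdry [OF weak nd])
      finally show ?thesis using \<sigma> by (simp add: cochains_one)
    qed
  qed
  then show ?thesis using sK cochain_complex.cocycles_iff [OF K_complex] by simp
qed

lemma dual_cochain_pairing:
  assumes g: "g \<in> carrier cell_target" and x: "x \<in> Xn" and b: "b \<in> B x"
  shows "coeval F x (dual_cochain g) (\<rho> x b) = g x b"
proof -
  let ?s = "dual_cochain g"
  have xQ: "x \<in> Q" using x by (rule X_Q)
  interpret Gx: comm_group "sec F x" by (rule sec_group [OF xQ])
  have sc: "?s \<in> carrier (cochains Sn F n)"
    using dual_cochain_cocycle [OF g] cochain_complex.cocycles_iff [OF K_complex] K_iff by blast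
  have gb: "g x b \<in> carrier (sec F x)" using g x b by (fastforce simp: PiE_iff)
  have bD: "b \<in> dchains_len x Orderings.top (Suc n)" using spherical_basis(3) [OF sph [OF x]] b by blast
  then have bU: "b \<in> U n x" and bl: "last b = x" using dchains_U [OF x, of n] by (auto simp: dchains_def)
  have k1: "supp (frag_of b) \<subseteq> U n x" using bU by simp
  have k2: "supp (\<rho> x b - frag_of b) \<subseteq> U n x" by (rule keys_diff_subset [OF \<rho>_U [OF x b] k1])
  have "coeval F x ?s (\<rho> x b) = coeval F x ?s (frag_of b + (\<rho> x b - frag_of b))" by simp
  also have "\<dots> = coeval F x ?s (frag_of b) \<otimes>\<^bsub>sec F x\<^esub> coeval F x ?s (\<rho> x b - frag_of b)"
    by (rule coeval_add [OF Sn_Q xQ sc k1 k2])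
  also have "coeval F x ?s (\<rho> x b - frag_of b) = \<one>\<^bsub>sec F x\<^esub>"
  proof (rule coeval_one [OF x k2])
    fix \<tau> assume t: "\<tau> \<in> supp (\<rho> x b - frag_of b)"
    have dl: "supp (\<rho> x b - frag_of b) \<subseteq> dchains_len x Orderings.top (Suc n)"
      using bD by (intro keys_diff_subset spherical_dual(1) [OF sph [OF x] b]) auto
    then have tl: "last \<tau> = x" using t by (auto simp: dchains_def)
    have "\<tau> \<notin> B x"
    proof
      assume "\<tau> \<in> B x"
      then have "coef (\<rho> x b - frag_of b) \<tau> = 0"
        using spherical_dual(3) [OF sph [OF x] b] by (simp add: lookup_minus)
      then show False using t by (simp add: in_keys_iff)
    qed
    then show "?s \<tau> = \<one>\<^bsub>sec F (last \<tau>)\<^esub>" using t k2 tl by (auto simp: dual_cochain_def upper_def)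
  qed
  also have "coeval F x ?s (frag_of b) = g x b"
  proof -
    have "?s b = g x b" using bU bl b x by (simp add: dual_cochain_def upper_def)
    then show ?thesis using coeval_of [OF Sn_Q _ sc, of b] bU bl by (simp add: upper_def)
  qed
  finally show ?thesis using gb by simp
qed

text \<open>
  The isomorphism evaluates a cocycle on the cycles \<open>\<rho> x b\<close>.
\<close>

theorem cell_iso: "HS_rel Sn Sm F n \<cong> cell_target"
proof -
  define \<Psi> where "\<Psi> = (\<lambda>s. \<lambda>x\<in>Xn. \<lambda>b\<in>B x. coeval F x s (\<rho> x b))"
  have c: "s \<in> carrier (cochains Sn F n)" if "s \<in> cocycles K d n" for s
    using that cochain_complex.cocycles_iff [OF K_complex] K_iff by blast
  have hom: "\<Psi> \<in> hom (cocycle_group K d n) cell_target"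
    unfolding \<Psi>_def
  proof (intro product_group_hom homI)
    fix x b s assume x: "x \<in> Xn" and b: "b \<in> B x" and s: "s \<in> carrier (cocycle_group K d n)"
    then show "coeval F x s (\<rho> x b) \<in> carrier (sec F x)"
      using coeval_closed [OF Sn_Q X_Q [OF x] c \<rho>_U [OF x b]] by simp
    fix t assume t: "t \<in> carrier (cocycle_group K d n)"
    show "coeval F x (s \<otimes>\<^bsub>cocycle_group K d n\<^esub> t) (\<rho> x b) =
        coeval F x s (\<rho> x b) \<otimes>\<^bsub>sec F x\<^esub> coeval F x t (\<rho> x b)"
      using coeval_mult [OF Sn_Q X_Q [OF x] c c \<rho>_U [OF x b], of s t] s t by simp
  qed
  have surj: "\<Psi> ` cocycles K d n = carrier cell_target"
  proof (intro equalityI image_subsetI subsetI)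
    fix s assume "s \<in> cocycles K d n"
    then show "\<Psi> s \<in> carrier cell_target" using hom_in_carrier [OF hom, of s] by simp
  next
    fix g assume g: "g \<in> carrier cell_target"
    have "\<Psi> (dual_cochain g) = (\<lambda>x\<in>Xn. \<lambda>b\<in>B x. g x b)"
      unfolding \<Psi>_def using dual_cochain_pairing [OF g] by (intro restrict_ext) auto
    also have "\<dots> = g"
    proof
      fix x show "(\<lambda>x\<in>Xn. \<lambda>b\<in>B x. g x b) x = g x"
        using g by (cases "x \<in> Xn") (auto simp: PiE_iff extensional_def fun_eq_iff)
    qed
    finally show "g \<in> \<Psi> ` cocycles K d n" using dual_cochain_cocycle [OF g] by (metis image_eqI)
  qed
  have "\<Psi> s = \<one>\<^bsub>cell_target\<^esub> \<longleftrightarrow> s \<in> coboundaries K d n" if s: "s \<in> cocycles K d n" for s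
  proof -
    have "\<Psi> s = \<one>\<^bsub>cell_target\<^esub> \<longleftrightarrow> (\<forall>x\<in>Xn. \<forall>b\<in>B x. coeval F x s (\<rho> x b) = \<one>\<^bsub>sec F x\<^esub>)"
      by (auto simp: \<Psi>_def fun_eq_iff restrict_def)
    also have "\<dots> \<longleftrightarrow> s \<in> coboundaries K d n"
      using coboundaryI [OF s] coboundary_pairing by blast
    finally show ?thesis .
  qed
  then show ?thesis
    unfolding HS_rel_def
    by (intro cochain_complex.cohomology_iso [OF K_complex cell_target_group hom surj]) blast
qed

lemma A_group_B:
  assumes "x \<in> Xn" shows "A_group Q rk x \<cong> free_Abelian_group (B x)" "comm_group (A_group Q rk x)"
  using A_group_free [OF X_Q [OF assms] X_corank [OF assms] sph [OF assms]] by auto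

theorem cell_tensor_iso:
  "HS_rel Sn Sm F n \<cong> sum_group Xn (\<lambda>x. tensor_group (A_group Q rk x) (sec F x))"
proof -
  have T: "tensor_group (A_group Q rk x) (sec F x) \<cong> product_group (B x) (\<lambda>_. sec F x)"
    "group (tensor_group (A_group Q rk x) (sec F x))" if "x \<in> Xn" for x
    using tensor_free [OF A_group_B(2) [OF that] sec_group [OF X_Q [OF that]] spherical_basis(1) [OF sph [OF that]]
        A_group_B(1) [OF that]] by (auto simp: comm_group_def)
  have g: "group (product_group Xn (\<lambda>x. tensor_group (A_group Q rk x) (sec F x)))"
    by (rule product_group [OF T(2)])
  have "product_group Xn (\<lambda>x. tensor_group (A_group Q rk x) (sec F x)) \<cong> cell_target"
  proof (rule iso_product_groupI [OF T])
    show "group (product_group (B x) (\<lambda>_. sec F x))" if "x \<in> Xn" for x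
      by (rule product_group) (rule sec_grp [OF X_Q [OF that]])
  qed
  then have "cell_target \<cong> product_group Xn (\<lambda>x. tensor_group (A_group Q rk x) (sec F x))"
    by (rule group.iso_sym [OF g])
  moreover have "sum_group Xn (\<lambda>x. tensor_group (A_group Q rk x) (sec F x))
      = product_group Xn (\<lambda>x. tensor_group (A_group Q rk x) (sec F x))"
    by (rule sum_group_finite [OF finite_set T(2)])
  ultimately show ?thesis using iso_trans [OF cell_iso] by simp
qed

end

section \<open>Punctured geometric lattices are cellular\<close>

theorem mainTheorem10:
  fixes Q :: "'a::bounded_lattice set"
  assumes "geometric_lattice TYPE('a)"
    and "locally_finite (UNIV :: 'a set)"
    and "\<exists>x y :: 'a. x \<noteq> y"
    and "Q = UNIV - {Orderings.top}"
  shows "finite (UNIV :: 'a set) \<and>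
    cellular TYPE('b) Q lattice_rank \<and>
    (\<forall>F :: ('a, 'b) presheaf. is_presheaf Q F \<longrightarrow>
       (\<forall>n. cell_cochains Q lattice_rank F n \<cong>
          sum_group {x \<in> Q. corank Q lattice_rank x = int n}
            (\<lambda>x. tensor_group (A_group Q lattice_rank x) (sec F x)))) \<and>
    (\<forall>x\<in>Q. \<exists>k::nat. int k = mu_exponent Q lattice_rank x \<and>
       A_group Q lattice_rank x \<cong> product_group {..<k} (\<lambda>_. integer_group)) \<and>
    (\<forall>F :: ('a, 'b) presheaf. is_presheaf Q F \<longrightarrow>
       (\<forall>n. HS Q F n \<cong> HC Q lattice_rank F n))"
proof -
  let ?rk = "lattice_rank :: 'a \<Rightarrow> int"
  interpret S: semimodular ?rk by (rule geometric_semimodular [OF assms(1,2)])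
  have "(bot :: 'a) \<noteq> Orderings.top"
  proof
    assume eq: "(bot :: 'a) = Orderings.top"
    have "z = bot" for z :: 'a
      using bot.extremum [of z] top.extremum [of z] unfolding eq by (rule order.antisym [rotated])
    then show False using assms(3) by metis
  qed
  then interpret P: proper_semimodular ?rk Q
    using assms(4) by unfold_locales auto
  obtain H B \<rho> where sph: "\<And>x. x \<in> Q \<Longrightarrow>
      spherical (Suc (nat (corank Q ?rk x))) x Orderings.top (H x) (B x) (\<rho> x)"
    using P.spherical_choice by blast
  have cp: "cell_presheaf ?rk Q F H B \<rho>" if "is_presheaf Q F" for F :: "('a, 'b) presheaf"
    using that sph P.proper_semimodular_axioms
    by (simp add: cell_presheaf_def cell_presheaf_axioms_def presheaf_on_def)
  have triv: "trivial_group (HS_rel (skeleton Q ?rk (int n)) (skeleton Q ?rk (int n - 1)) F i)"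
    if "is_presheaf Q F" "i \<noteq> n" for F :: "('a, 'b) presheaf" and i n
    using cell_presheaf.vanishing [OF cp [OF that(1)] that(2)]
    by (simp add: cell_presheaf.Sn_def [OF cp [OF that(1)]] cell_presheaf.Sm_def [OF cp [OF that(1)]])
  have cell: "cellular TYPE('b) Q ?rk"
    using triv P.graded_Q P.bdd_Q by (simp add: cellular_def)
  have tens: "cell_cochains Q ?rk F n \<cong> sum_group {x \<in> Q. corank Q ?rk x = int n}
      (\<lambda>x. tensor_group (A_group Q ?rk x) (sec F x))" if "is_presheaf Q F" for F :: "('a, 'b) presheaf" and n
    using cell_presheaf.cell_tensor_iso [OF cp [OF that], of n]
    by (simp add: cell_cochains_def cell_presheaf.Sn_def [OF cp [OF that]]
        cell_presheaf.Sm_def [OF cp [OF that]] cell_presheaf.Xn_def [OF cp [OF that]])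
  have A: "\<exists>k::nat. int k = mu_exponent Q ?rk x \<and> A_group Q ?rk x \<cong> product_group {..<k} (\<lambda>_. integer_group)"
    if x: "x \<in> Q" for x
  proof (intro exI conjI)
    let ?n = "nat (corank Q ?rk x)"
    have n: "corank Q ?rk x = int ?n" using P.corank_nonneg [OF x] by simp
    note s = sph [OF x]
    show "int (card (B x)) = mu_exponent Q ?rk x"
      using spherical_basis(2) [OF s] by (simp add: mu_exponent_def)
    have "A_group Q ?rk x \<cong> free_Abelian_group (B x)" by (rule P.A_group_free(1) [OF x n s])
    then show "A_group Q ?rk x \<cong> product_group {..<card (B x)} (\<lambda>_. integer_group)"
      using free_Abelian_integer_product [OF spherical_basis(1) [OF s]] by (rule iso_trans)
  qed
  have HC: "HS Q F n \<cong> HC Q ?rk F n" if F: "is_presheaf Q F" for F :: "('a, 'b) presheaf" and n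
  proof -
    let ?R = "\<lambda>k::nat. skeleton Q ?rk (int k - 1)"
    let ?N = "nat (?rk Orderings.top - ?rk bot)"
    have low: "?rk bot \<le> ?rk x" for x
      using S.rk_strict [of bot x] by (cases "x = bot") (auto simp: bot.not_eq_extremum less_imp_le)
    interpret presheaf_on Q F using F by unfold_locales
    interpret FP: filtered_presheaf Q F ?R ?N
    proof
      show "?R 0 = {}" using P.corank_nonneg by (fastforce simp: skeleton_def)
      show "?R k \<subseteq> ?R (Suc k)" "?R k \<subseteq> Q" for k by (auto simp: skeleton_def)
      show "?R k = Q" if "?N \<le> k" for k
      proof -
        have "corank Q ?rk x \<le> int k - 1" if "x \<in> Q" for x
          using low [of x] \<open>?N \<le> k\<close> by (simp add: P.corank_eq)
        then show ?thesis by (auto simp: skeleton_def)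
      qed
      show "trivial_group (HS_rel (?R (Suc k)) (?R k) F i)" if "i \<noteq> k" for i k
        using triv [OF F that] by simp
    qed
    have "cell_cochains Q ?rk F = FP.E"
      by (simp add: fun_eq_iff cell_cochains_def HS_rel_def)
    moreover have "cell_differential Q ?rk F = FP.cell_conn"
      by (simp add: fun_eq_iff cell_differential_def add.commute)
    ultimately show ?thesis
      using FP.cohomology_iso_cellular [of n] by (simp add: HS_def HC_def)
  qed
  show ?thesis
    using S.finite_lattice cell tens A HC by blast
qed

end
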